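(* Let $k$ be an algebraically closed field of characteristic $2$ and let $n,m\ge 1$. The algebras $R_{n\times m}^{O(n)}$ and $R_{n\times m}^{SO(n)}$ are finitely generated as modules over $A_{n\times m}=k\left[Q^{(i)},B^{(ij)}:1\le i\le m,\ 1\le i<j\le m\right]$.
   Context: $k$ is an algebraically closed field of characteristic $2$. Coordinates on $k^n$ are $x_1,\dots,x_\nu,y_1,\dots,y_\nu$ if $n=2\nu$, and $x_1,\dots,x_\nu,y_1,\dots,y_\nu,z$ if $n=2\nu+1$. The standard quadratic form is $q=\sum_{t=1}^\nu x_ty_t$ if $n=2\nu$ and $q=\sum_{t=1}^\nu x_ty_t+z^2$ if $n=2\nu+1$; its polar form is $\beta(v,w)=q(v+w)-q(v)-q(w)$. $O(n)$ is the group of linear automorphisms of $k^n$ preserving $q$; $SO(n)$ is the connected component of the identity in the algebraic group $O(n)$ (so $SO(n)=O(n)$ for odd $n$, and $SO(n)$ has index $2$ in $O(n)$ for even $n$). $R_{n\times m}$ is the algebra of polynomials over $k$ in the coordinates of $m$ indeterminate vectors $v^{(1)},\dots,v^{(m)}$ in $k^n$; $O(n)$ acts diagonally, and a superscript group denotes the subalgebra of invariants. $Q^{(i)}=q(v^{(i)})$ and $B^{(ij)}=\beta(v^{(i)},v^{(j)})$, which belong to $R_{n\times m}^{O(n)}$. *)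

theory Defs
  imports
    Jordan_Normal_Form.Matrix
    "HOL.Hull"
    "HOL-Library.Poly_Mapping"
    "HOL-Computational_Algebra.Computational_Algebra"
    "HOL-Analysis.Abstract_Topology_2"
begin

section \<open>Multivariate polynomials\<close>

text \<open>
  A polynomial in indeterminates indexed by \<open>'x\<close> is a finitely supported map from monomials
  (finitely supported exponent functions) to coefficients; multiplication on this type is the
  convolution product of \<^theory>\<open>HOL-Library.Poly_Mapping\<close>.
\<close>

type_synonym ('x, 'k) mpolynomial = "('x \<Rightarrow>\<^sub>0 nat) \<Rightarrow>\<^sub>0 'k"

definition Const :: "'k::zero \<Rightarrow> ('x, 'k) mpolynomial" where
  "Const c = Poly_Mapping.single 0 c"

definition Var :: "'x \<Rightarrow> ('x, 'k::zero_neq_one) mpolynomial" where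
  "Var x = Poly_Mapping.single (Poly_Mapping.single x 1) 1"

text \<open>
  Evaluation in a commutative ring that receives the coefficients through \<open>\<phi>\<close>. It is used with
  \<open>\<phi> = id\<close> (values at points) and with \<open>\<phi> = Const\<close> (substitution of polynomials).
\<close>

definition eval_mpoly ::
    "('k::zero \<Rightarrow> 'r::comm_semiring_1) \<Rightarrow> ('x \<Rightarrow> 'r) \<Rightarrow> ('x, 'k) mpolynomial \<Rightarrow> 'r" where
  "eval_mpoly \<phi> s f =
     (\<Sum>a\<in>Poly_Mapping.keys f. \<phi> (Poly_Mapping.lookup f a) *
        (\<Prod>x\<in>Poly_Mapping.keys a. s x ^ Poly_Mapping.lookup a x))"

text \<open>
  The algebra \<open>R\<^bsub>n\<times>m\<^esub>\<close>. Indices are counted from 0: for \<open>r < n\<close> and \<open>i < m\<close>, the indeterminate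
  \<open>Var (r, i)\<close> is the \<open>r\<close>-th coordinate of the \<open>i\<close>-th indeterminate vector.
\<close>

definition poly_ring :: "nat \<Rightarrow> nat \<Rightarrow> (nat \<times> nat, 'k::zero) mpolynomial set" where
  "poly_ring n m = {f. \<forall>a\<in>Poly_Mapping.keys f. Poly_Mapping.keys a \<subseteq> {..<n} \<times> {..<m}}"

definition indet_vec :: "nat \<Rightarrow> nat \<Rightarrow> (nat \<times> nat, 'k::zero_neq_one) mpolynomial vec" where
  "indet_vec n i = vec n (\<lambda>r. Var (r, i))"


section \<open>The standard quadratic form\<close>

text \<open>
  With \<open>\<nu> = n div 2\<close>, the coordinates \<open>x\<^sub>1, \<dots>, x\<^sub>\<nu>\<close> are the entries \<open>0, \<dots>, \<nu> - 1\<close>,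
  the coordinates \<open>y\<^sub>1, \<dots>, y\<^sub>\<nu>\<close> are the entries \<open>\<nu>, \<dots>, 2\<nu> - 1\<close>, and for odd \<open>n\<close>
  the coordinate \<open>z\<close> is the last entry \<open>2\<nu>\<close>. The coefficient ring is left open because the form
  is applied both to points of \<open>k\<^sup>n\<close> and to the indeterminate vectors.
\<close>

definition quad_form :: "'r::comm_ring_1 vec \<Rightarrow> 'r" where
  "quad_form v = (let \<nu> = dim_vec v div 2 in
     (\<Sum>t<\<nu>. v $ t * v $ (\<nu> + t)) + (if odd (dim_vec v) then (v $ (2 * \<nu>))\<^sup>2 else 0))"

definition polar_form :: "'r::comm_ring_1 vec \<Rightarrow> 'r vec \<Rightarrow> 'r" where
  "polar_form v w = quad_form (v + w) - quad_form v - quad_form w"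

definition Q_poly :: "nat \<Rightarrow> nat \<Rightarrow> (nat \<times> nat, 'k::comm_ring_1) mpolynomial" where
  "Q_poly n i = quad_form (indet_vec n i)"

definition B_poly :: "nat \<Rightarrow> nat \<Rightarrow> nat \<Rightarrow> (nat \<times> nat, 'k::comm_ring_1) mpolynomial" where
  "B_poly n i j = polar_form (indet_vec n i) (indet_vec n j)"


section \<open>The orthogonal groups\<close>

definition orth_group :: "nat \<Rightarrow> 'k::field mat set" where
  "orth_group n = {g \<in> carrier_mat n n. invertible_mat g \<and>
     (\<forall>v\<in>carrier_vec n. quad_form (g *\<^sub>v v) = quad_form v)}"

text \<open>
  The Zariski topology on \<open>n \<times> n\<close> matrices, generated by the principal open sets. Here the
  indeterminate \<open>Var (r, c)\<close> is the matrix entry in row \<open>r\<close> and column \<open>c\<close>.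
\<close>

definition zariski_mat :: "nat \<Rightarrow> 'k::field mat topology" where
  "zariski_mat n = topology_generated_by
     {{g \<in> carrier_mat n n. eval_mpoly id (\<lambda>rc. g $$ rc) p \<noteq> 0} | p. p \<in> poly_ring n n}"

definition special_orth_group :: "nat \<Rightarrow> 'k::field mat set" where
  "special_orth_group n =
     connected_component_of_set (subtopology (zariski_mat n) (orth_group n)) (1\<^sub>m n)"


section \<open>Invariants\<close>

text \<open>
  \<open>diag_subst n g f\<close> is the polynomial \<open>f(g v\<^sup>(\<^sup>1\<^sup>), \<dots>, g v\<^sup>(\<^sup>m\<^sup>))\<close>. The left action of a group
  of matrices on polynomials uses the inverse of \<open>g\<close> instead, which gives the same invariants.
\<close>

definition diag_subst ::
    "nat \<Rightarrow> 'k::comm_ring_1 mat \<Rightarrow> (nat \<times> nat, 'k) mpolynomial \<Rightarrow> (nat \<times> nat, 'k) mpolynomial"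
  where
  "diag_subst n g = eval_mpoly Const (\<lambda>(r, i). (map_mat Const g *\<^sub>v indet_vec n i) $ r)"

definition invariants ::
    "nat \<Rightarrow> nat \<Rightarrow> 'k::comm_ring_1 mat set \<Rightarrow> (nat \<times> nat, 'k) mpolynomial set" where
  "invariants n m G = {f \<in> poly_ring n m. \<forall>g\<in>G. diag_subst n g f = f}"


section \<open>Generated subalgebras and finitely generated modules\<close>

definition subalgebra :: "('x, 'k::comm_ring_1) mpolynomial set \<Rightarrow> bool" where
  "subalgebra S \<longleftrightarrow> range Const \<subseteq> S \<and> (\<forall>f\<in>S. \<forall>g\<in>S. f + g \<in> S \<and> f * g \<in> S)"

definition QB_algebra :: "nat \<Rightarrow> nat \<Rightarrow> (nat \<times> nat, 'k::comm_ring_1) mpolynomial set" where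
  "QB_algebra n m =
     subalgebra hull ({Q_poly n i | i. i < m} \<union> {B_poly n i j | i j. i < j \<and> j < m})"

text \<open>
  For a subring \<open>A\<close> of the ambient ring: \<open>M\<close> is the set of \<open>A\<close>-linear combinations of finitely many
  of its own elements. In particular \<open>M\<close> is then closed under addition and under
  multiplication by elements of \<open>A\<close>.
\<close>

definition finitely_generated_over :: "'r::comm_ring_1 set \<Rightarrow> 'r set \<Rightarrow> bool" where
  "finitely_generated_over A M \<longleftrightarrow>
     (\<exists>S. finite S \<and> S \<subseteq> M \<and> M = {\<Sum>s\<in>S. a s * s | a. \<forall>s\<in>S. a s \<in> A})"

end

theory Submission
  imports "HOL-Library.Product_Lexorder" "HOL-Algebra.Algebraic_Closure_Type" Defs
begin

text \<open>
  Write \<open>A\<close> for the algebra generated by the \<open>Q\<^sup>(\<^sup>i\<^sup>)\<close> and \<open>B\<^sup>(\<^sup>i\<^sup>j\<^sup>)\<close>. It is Noetherian and the invariants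
  are \<open>A\<close>-modules containing each other, so it suffices to put the \<open>SO(n)\<close>-invariants into one finitely
  generated \<open>A\<close>-module.

  Integrality: let \<open>K\<close> be an algebraically closed field containing the polynomial ring and \<open>V\<close> a valuation
  ring of \<open>K\<close> containing \<open>A\<close>. The coordinates of the generic vectors span a lattice on which the quadratic
  form is \<open>V\<close>-valued. Splitting off planes on which the polar form has minimal valuation, one moves this
  lattice into the standard one by reflections defined over \<open>K\<close>. Since \<open>SO(n)\<close> contains all products of two
  reflections, an invariant \<open>f\<close> satisfies \<open>f (s\<^sub>u v) = f' v\<close> for a fixed polynomial \<open>f'\<close>, also over \<open>K\<close>; hence \<open>f\<close>,
  which is its own value at the generic vectors, lies in \<open>V\<close>. So \<open>f\<close> is integral over \<open>A\<close>.

  Finiteness: a homogeneous integral \<open>f\<close> of degree \<open>d\<close> has, for \<open>q\<close> a large power of 2, \<open>f^q\<close> in the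
  \<open>(d q/2 - const)\<close>-th power of the ideal generated by the \<open>s\<close> generators of \<open>A\<close>. Frobenius splitting of
  the polynomial ring (the tight closure proof of the Briancon-Skoda theorem) then gives \<open>f\<close> in the
  \<open>(d/2 - s)\<close>-th power of this ideal, so \<open>f\<close> is an \<open>A\<close>-combination of monomials of degree at most \<open>2 s + 1\<close>.
\<close>

section \<open>Noetherian modules over subrings\<close>

text \<open>Integrality alone does not give finiteness: in general the polynomial ring is not a
  finite \<open>A\<close>-module, because the generators of \<open>A\<close> have nontrivial common
  zeros. The finite module must come from a degree bound. The generators have degree 2, so degree
  \<open>d\<close> should mean membership in the (d/2)-th ideal power. An integral equation gives
  this only up to a loss \<open>k\<close>, but \<open>k\<close> does not grow with the power
  \<open>q\<close> of \<open>f\<close>. Multiplying \<open>f ^ q\<close> by a fixed nonzero element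
  of the k-th ideal power repairs the loss, and the splitting at a monomial of that element removes
  it again. For even \<open>n\<close> a single reflection is not in \<open>SO(n)\<close>, so it
  carries \<open>f\<close> to some \<open>f'\<close> and back. Along a chain of reflections only the
  unordered pair of the values of \<open>f\<close> and \<open>f'\<close> survives; this is enough,
  since both values are integral at an integral point. The field \<open>K\<close> is algebraically
  closed so that isotropic vectors \<open>w + r u\<close> can be found by solving a quadratic. Going
  from \<open>k\<close> to \<open>K\<close> requires a polynomial identity; the denominators of a
  reflection can be cleared uniformly only for homogeneous \<open>f\<close>.\<close>

definition is_subring :: "'r::comm_ring_1 set \<Rightarrow> bool" where
  "is_subring A \<longleftrightarrow> 1 \<in> A \<and> (\<forall>x\<in>A. \<forall>y\<in>A. x - y \<in> A \<and> x * y \<in> A)"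

definition is_submodule :: "'r::comm_ring_1 set \<Rightarrow> 'r set \<Rightarrow> bool" where
  "is_submodule A M \<longleftrightarrow> 0 \<in> M \<and> (\<forall>x\<in>M. \<forall>y\<in>M. x + y \<in> M) \<and> (\<forall>a\<in>A. \<forall>x\<in>M. a * x \<in> M)"

text \<open>\<open>N\<close> may be any set; only the submodules inside it are tested. So the
  property passes to subsets at no cost, and the invariants need only be contained in a finitely
  generated module.\<close>

definition noetherian_over :: "'r::comm_ring_1 set \<Rightarrow> 'r set \<Rightarrow> bool" where
  "noetherian_over A N \<longleftrightarrow>
     (\<forall>M. is_submodule A M \<and> M \<subseteq> N \<longrightarrow> (\<exists>S. finite S \<and> M = is_submodule A hull S))"

lemma subring_closed:
  assumes "is_subring A"
  shows "1 \<in> A" "0 \<in> A" "x \<in> A \<Longrightarrow> y \<in> A \<Longrightarrow> x - y \<in> A"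
    "x \<in> A \<Longrightarrow> y \<in> A \<Longrightarrow> x * y \<in> A" "x \<in> A \<Longrightarrow> - x \<in> A"
    "x \<in> A \<Longrightarrow> y \<in> A \<Longrightarrow> x + y \<in> A"
proof -
  show one: "1 \<in> A" using assms by (simp add: is_subring_def)
  have diff: "x - y \<in> A" if "x \<in> A" "y \<in> A" for x y using assms that by (simp add: is_subring_def)
  then show "x \<in> A \<Longrightarrow> y \<in> A \<Longrightarrow> x - y \<in> A" .
  show zero: "0 \<in> A" using diff[OF one one] by simp
  show "x \<in> A \<Longrightarrow> y \<in> A \<Longrightarrow> x * y \<in> A" using assms by (simp add: is_subring_def)
  have neg: "- x \<in> A" if "x \<in> A" for x using diff[OF zero that] by simp
  then show "x \<in> A \<Longrightarrow> - x \<in> A" .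
  show "x \<in> A \<Longrightarrow> y \<in> A \<Longrightarrow> x + y \<in> A" using diff[OF _ neg, of x y] by simp
qed

lemma subring_power: "is_subring A \<Longrightarrow> x \<in> A \<Longrightarrow> x ^ n \<in> A"
  by (induction n) (auto intro: subring_closed)

lemma subring_sum: "is_subring A \<Longrightarrow> (\<And>i. i \<in> I \<Longrightarrow> f i \<in> A) \<Longrightarrow> sum f I \<in> A"
  by (induction I rule: infinite_finite_induct) (auto intro: subring_closed)

lemma subring_prod: "is_subring A \<Longrightarrow> (\<And>i. i \<in> I \<Longrightarrow> f i \<in> A) \<Longrightarrow> prod f I \<in> A"
  by (induction I rule: infinite_finite_induct) (auto intro: subring_closed)

lemma submodule_closed:
  assumes "is_submodule A M"
  shows "0 \<in> M" "x \<in> M \<Longrightarrow> y \<in> M \<Longrightarrow> x + y \<in> M" "a \<in> A \<Longrightarrow> x \<in> M \<Longrightarrow> a * x \<in> M"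
  using assms by (auto simp: is_submodule_def)

lemma submoduleI:
  assumes "0 \<in> M" "\<And>x y. x \<in> M \<Longrightarrow> y \<in> M \<Longrightarrow> x + y \<in> M"
    "\<And>a x. a \<in> A \<Longrightarrow> x \<in> M \<Longrightarrow> a * x \<in> M"
  shows "is_submodule A M"
  using assms by (auto simp: is_submodule_def)

lemma submodule_diff:
  assumes "is_subring A" "is_submodule A M" "x \<in> M" "y \<in> M"
  shows "x - y \<in> M"
proof -
  have "- 1 * y \<in> M" using assms by (intro submodule_closed) (auto intro: subring_closed)
  then show ?thesis using submodule_closed(2)[OF assms(2,3)] by force
qed

lemma submodule_sum: "is_submodule A M \<Longrightarrow> (\<And>i. i \<in> I \<Longrightarrow> f i \<in> M) \<Longrightarrow> sum f I \<in> M"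
  by (induction I rule: infinite_finite_induct) (auto intro: submodule_closed)

lemma submodule_Inter: "(\<And>M. M \<in> F \<Longrightarrow> is_submodule A M) \<Longrightarrow> is_submodule A (\<Inter>F)"
  by (auto simp: is_submodule_def)

lemma submodule_span [simp]: "is_submodule A (is_submodule A hull S)"
  by (rule hull_in) (simp add: submodule_Inter)

lemmas span_closed = submodule_closed[OF submodule_span]

lemma span_base: "x \<in> S \<Longrightarrow> x \<in> is_submodule A hull S"
  by (rule hull_inc)

lemma span_minimal: "S \<subseteq> M \<Longrightarrow> is_submodule A M \<Longrightarrow> is_submodule A hull S \<subseteq> M"
  by (rule hull_minimal)

lemma span_finite:
  assumes A: "is_subring A" and S: "finite S"
  shows "is_submodule A hull S = {\<Sum>s\<in>S. a s * s | a. \<forall>s\<in>S. a s \<in> A}" (is "_ = ?R")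
proof
  have "is_submodule A ?R"
    proof (rule submoduleI)
    show "0 \<in> ?R" using subring_closed(2)[OF A] by (intro CollectI exI[of _ "\<lambda>_. 0"]) auto
  next
    fix x y assume "x \<in> ?R" "y \<in> ?R"
    then obtain a b where "x = (\<Sum>s\<in>S. a s * s)" "\<forall>s\<in>S. a s \<in> A"
      "y = (\<Sum>s\<in>S. b s * s)" "\<forall>s\<in>S. b s \<in> A" by auto
    then show "x + y \<in> ?R"
      by (intro CollectI exI[of _ "\<lambda>s. a s + b s"])
        (auto simp: distrib_right sum.distrib intro: subring_closed[OF A])
  next
    fix c x assume "c \<in> A" "x \<in> ?R"
    then obtain a where "x = (\<Sum>s\<in>S. a s * s)" "\<forall>s\<in>S. a s \<in> A" by auto
    then show "c * x \<in> ?R" using \<open>c \<in> A\<close>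
      by (intro CollectI exI[of _ "\<lambda>s. c * a s"])
        (auto simp: sum_distrib_left mult.assoc intro: subring_closed[OF A])
  qed
  moreover have "S \<subseteq> ?R"
  proof
    fix s assume s: "s \<in> S"
    have "s = (\<Sum>t\<in>S. (if t = s then 1 else 0) * t)"
      using s S by (simp add: if_distrib[of "\<lambda>c. c * _"] cong: if_cong)
    then show "s \<in> ?R" using subring_closed(1,2)[OF A]
      by (intro CollectI exI[of _ "\<lambda>t. if t = s then 1 else 0"]) auto
  qed
  ultimately show "is_submodule A hull S \<subseteq> ?R" by (rule span_minimal[rotated])
  show "?R \<subseteq> is_submodule A hull S"
    by (auto intro!: submodule_sum[OF submodule_span] intro: span_closed span_base)
qed

lemma finitely_generated_over_noetherian:
  assumes "is_subring A" "noetherian_over A N" "is_submodule A M" "M \<subseteq> N"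
  shows "finitely_generated_over A M"
proof -
  obtain S where S: "finite S" "M = is_submodule A hull S"
    using assms unfolding noetherian_over_def by blast
  then have "S \<subseteq> M" by (simp add: hull_subset)
  then show ?thesis
    unfolding finitely_generated_over_def
    using S span_finite[OF assms(1) S(1)] by blast
qed

lemma noetherian_overE:
  assumes "noetherian_over A N" "is_submodule A M" "M \<subseteq> N"
  obtains S where "finite S" "M = is_submodule A hull S"
  using assms unfolding noetherian_over_def by metis

lemma noetherian_over_subset: "noetherian_over A N \<Longrightarrow> N' \<subseteq> N \<Longrightarrow> noetherian_over A N'"
  unfolding noetherian_over_def by blast

lemma noetherian_over_zero: "noetherian_over A {0}"
  unfolding noetherian_over_def
proof (intro allI impI)
  fix M assume "is_submodule A M \<and> M \<subseteq> {0}"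
  then have "M = is_submodule A hull M" "finite M"
    using hull_same[of "is_submodule A" M] finite_subset by auto
  then show "\<exists>S. finite S \<and> M = is_submodule A hull S" by blast
qed

text \<open>The extension argument for a sum that need not be direct: generators of \<open>M\<close>
  modulo \<open>N2\<close> are lifted to \<open>M\<close>, and what then remains of an element lies
  in \<open>M \<inter> N2\<close>.\<close>

lemma noetherian_over_plus:
  assumes A: "is_subring A" and mod: "is_submodule A N1" "is_submodule A N2"
    and noeth: "noetherian_over A N1" "noetherian_over A N2"
  shows "noetherian_over A {x + y | x y. x \<in> N1 \<and> y \<in> N2}"
  unfolding noetherian_over_def
proof (intro allI impI)
  fix M assume asm: "is_submodule A M \<and> M \<subseteq> {x + y | x y. x \<in> N1 \<and> y \<in> N2}"
  then have M: "is_submodule A M" by simp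
  \<comment> \<open>The image of \<open>M\<close> modulo \<open>N2\<close>, represented by all
    possible first summands.\<close>
  define M1 where "M1 = {x \<in> N1. \<exists>y\<in>N2. x + y \<in> M}"
  have "is_submodule A M1"
    unfolding M1_def
  proof (rule submoduleI)
    show "0 \<in> {x \<in> N1. \<exists>y\<in>N2. x + y \<in> M}"
      using mod M by (auto intro!: bexI[of _ 0] intro: submodule_closed)
  next
    fix x x' assume "x \<in> {x \<in> N1. \<exists>y\<in>N2. x + y \<in> M}" "x' \<in> {x \<in> N1. \<exists>y\<in>N2. x + y \<in> M}"
    then obtain y y' where *: "x \<in> N1" "x' \<in> N1" "y \<in> N2" "y' \<in> N2" "x + y \<in> M" "x' + y' \<in> M" by auto
    then have "(x + x') + (y + y') \<in> M"
      using submodule_closed(2)[OF M, of "x + y" "x' + y'"] by (simp add: algebra_simps)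
    then show "x + x' \<in> {x \<in> N1. \<exists>y\<in>N2. x + y \<in> M}"
      using * mod by (auto intro: submodule_closed)
  next
    fix a x assume a: "a \<in> A" and "x \<in> {x \<in> N1. \<exists>y\<in>N2. x + y \<in> M}"
    then obtain y where *: "x \<in> N1" "y \<in> N2" "x + y \<in> M" by auto
    then have "a * x + a * y \<in> M"
      using submodule_closed(3)[OF M a, of "x + y"] by (simp add: algebra_simps)
    then show "a * x \<in> {x \<in> N1. \<exists>y\<in>N2. x + y \<in> M}"
      using * mod a by (auto intro: submodule_closed)
  qed
  moreover have "M1 \<subseteq> N1" by (auto simp: M1_def)
  ultimately obtain S1 where S1: "finite S1" "M1 = is_submodule A hull S1"
    using noeth(1) unfolding noetherian_over_def by blast
  have "is_submodule A (M \<inter> N2)" using M mod by (auto simp: is_submodule_def)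
  then obtain S2 where S2: "finite S2" "M \<inter> N2 = is_submodule A hull S2"
    using noeth(2) unfolding noetherian_over_def by blast
  have "\<forall>x\<in>S1. \<exists>z\<in>M. z - x \<in> N2"
  proof
    fix x assume "x \<in> S1"
    then have "x \<in> M1" using S1 span_base by blast
    then obtain y where "y \<in> N2" "x + y \<in> M" by (auto simp: M1_def)
    then show "\<exists>z\<in>M. z - x \<in> N2" by (intro bexI[of _ "x + y"]) auto
  qed
  then obtain t where t: "\<And>x. x \<in> S1 \<Longrightarrow> t x \<in> M" "\<And>x. x \<in> S1 \<Longrightarrow> t x - x \<in> N2" by metis
  define H where "H = is_submodule A hull (t ` S1 \<union> S2)"
  have H: "is_submodule A H" by (simp add: H_def)
  have HM: "H \<subseteq> M" unfolding H_def
    by (rule span_minimal) (use t S2 M hull_subset[of S2 "is_submodule A"] in auto)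
  have "is_submodule A hull S1 \<subseteq> {x. \<exists>w\<in>H. w - x \<in> N2}"
  proof (rule span_minimal)
    show "S1 \<subseteq> {x. \<exists>w\<in>H. w - x \<in> N2}"
      using t by (auto simp: H_def intro!: bexI[of _ "t _"] span_base)
    show "is_submodule A {x. \<exists>w\<in>H. w - x \<in> N2}"
      proof (rule submoduleI)
      show "0 \<in> {x. \<exists>w\<in>H. w - x \<in> N2}"
        using H mod by (auto intro!: bexI[of _ 0] intro: submodule_closed)
    next
      fix x x' assume "x \<in> {x. \<exists>w\<in>H. w - x \<in> N2}" "x' \<in> {x. \<exists>w\<in>H. w - x \<in> N2}"
      then obtain w w' where *: "w \<in> H" "w' \<in> H" "w - x \<in> N2" "w' - x' \<in> N2" by auto
      then have "(w + w') - (x + x') \<in> N2"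
        using submodule_closed(2)[OF mod(2) *(3,4)] by (simp add: algebra_simps)
      then show "x + x' \<in> {x. \<exists>w\<in>H. w - x \<in> N2}" using * submodule_closed(2)[OF H] by blast
    next
      fix a x assume a: "a \<in> A" and "x \<in> {x. \<exists>w\<in>H. w - x \<in> N2}"
      then obtain w where *: "w \<in> H" "w - x \<in> N2" by auto
      then have "a * w - a * x \<in> N2"
        using submodule_closed(3)[OF mod(2) a *(2)] by (simp add: algebra_simps)
      then show "a * x \<in> {x. \<exists>w\<in>H. w - x \<in> N2}" using * submodule_closed(3)[OF H a] by blast
    qed
  qed
  then have lift: "\<exists>w\<in>H. w - x \<in> N2" if "x \<in> M1" for x using that S1 by auto
  have "M \<subseteq> H"
  proof
    fix z assume z: "z \<in> M"
    then obtain x y where xy: "z = x + y" "x \<in> N1" "y \<in> N2" using asm by blast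
    then have "x \<in> M1" using z by (auto simp: M1_def)
    then obtain w where w: "w \<in> H" "w - x \<in> N2" using lift by blast
    have eq: "z - w = y - (w - x)" using xy by simp
    have "z - w \<in> N2" unfolding eq by (rule submodule_diff[OF A mod(2) xy(3) w(2)])
    moreover have "z - w \<in> M" using submodule_diff[OF A M z] w HM by blast
    ultimately have "z - w \<in> is_submodule A hull S2" using S2 by blast
    also have "\<dots> \<subseteq> H" unfolding H_def by (rule hull_mono) auto
    finally show "z \<in> H" using submodule_closed(2)[OF H w(1)] by force
  qed
  then have "M = is_submodule A hull (t ` S1 \<union> S2)" using HM by (auto simp: H_def)
  then show "\<exists>S. finite S \<and> M = is_submodule A hull S"
    using S1(1) S2(1) by (intro exI[of _ "t ` S1 \<union> S2"] conjI) simp_all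
qed

text \<open>The cyclic module of multiples of \<open>h\<close> is a quotient of \<open>A\<close>, so
  generators of the preimage ideal of \<open>M\<close> give generators of \<open>M\<close>.\<close>

lemma noetherian_over_smult:
  assumes A: "is_subring A" and noeth: "noetherian_over A A"
  shows "noetherian_over A ((\<lambda>a. a * h) ` A)"
  unfolding noetherian_over_def
proof (intro allI impI)
  fix M assume asm: "is_submodule A M \<and> M \<subseteq> (\<lambda>a. a * h) ` A"
  then have M: "is_submodule A M" by simp
  have "is_submodule A {a \<in> A. a * h \<in> M}"
    using M A by (auto simp: is_submodule_def distrib_right mult.assoc intro: subring_closed)
  then obtain S where S: "finite S" "{a \<in> A. a * h \<in> M} = is_submodule A hull S"
    by (rule noetherian_overE[OF noeth]) auto
  have "is_submodule A hull S \<subseteq> {a. a * h \<in> is_submodule A hull ((\<lambda>a. a * h) ` S)}"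
  proof (rule span_minimal)
    show "is_submodule A {a. a * h \<in> is_submodule A hull (\<lambda>a. a * h) ` S}"
      by (auto simp: is_submodule_def distrib_right mult.assoc intro: span_closed)
  qed (auto intro: span_base)
  then have "M \<subseteq> is_submodule A hull ((\<lambda>a. a * h) ` S)" using asm S by blast
  moreover have "is_submodule A hull ((\<lambda>a. a * h) ` S) \<subseteq> M"
    by (rule span_minimal) (use S M hull_subset[of S "is_submodule A"] in auto)
  ultimately show "\<exists>S. finite S \<and> M = is_submodule A hull S"
    using S(1) by (intro exI[of _ "(\<lambda>a. a * h) ` S"] conjI) simp_all
qed

lemma noetherian_over_span:
  assumes "is_subring A" "noetherian_over A A" "finite S"
  shows "noetherian_over A (is_submodule A hull S)"
  using assms(3)
proof (induction S)
  case empty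
  have "is_submodule A hull {} = {0}"
    by (intro equalityI span_minimal) (auto simp: is_submodule_def intro: span_closed)
  then show ?case by (simp add: noetherian_over_zero)
next
  case (insert h S)
  have mod: "is_submodule A ((\<lambda>a. a * h) ` A)"
  proof (rule submoduleI)
    show "0 \<in> (\<lambda>a. a * h) ` A" using subring_closed(2)[OF assms(1)] by force
  next
    fix x y assume "x \<in> (\<lambda>a. a * h) ` A" "y \<in> (\<lambda>a. a * h) ` A"
    then obtain a b where "x = a * h" "y = b * h" "a \<in> A" "b \<in> A" by auto
    then show "x + y \<in> (\<lambda>a. a * h) ` A"
      using subring_closed(6)[OF assms(1)] by (intro image_eqI[of _ _ "a + b"]) (auto simp: distrib_right)
  next
    fix a x assume "a \<in> A" "x \<in> (\<lambda>a. a * h) ` A"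
    then obtain b where "x = b * h" "b \<in> A" by auto
    then show "a * x \<in> (\<lambda>a. a * h) ` A"
      using subring_closed(4)[OF assms(1) \<open>a \<in> A\<close>] by (intro image_eqI[of _ _ "a * b"]) (auto simp: mult.assoc)
  qed
  let ?N = "{x + y | x y. x \<in> (\<lambda>a. a * h) ` A \<and> y \<in> is_submodule A hull S}"
  have N: "noetherian_over A ?N"
    using insert assms mod by (intro noetherian_over_plus noetherian_over_smult) auto
  have "is_submodule A ?N"
    proof (rule submoduleI)
    show "0 \<in> ?N" using submodule_closed(1)[OF mod] span_closed(1)[of A S] by force
  next
    fix u v assume "u \<in> ?N" "v \<in> ?N"
    then obtain x y x' y' where *: "u = x + y" "v = x' + y'" "x \<in> (\<lambda>a. a * h) ` A" "x' \<in> (\<lambda>a. a * h) ` A"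
      "y \<in> is_submodule A hull S" "y' \<in> is_submodule A hull S" by blast
    have "u + v = (x + x') + (y + y')" using * by simp
    then show "u + v \<in> ?N"
      using submodule_closed(2)[OF mod *(3,4)] span_closed(2)[OF *(5,6)] by blast
  next
    fix a u assume a: "a \<in> A" and "u \<in> ?N"
    then obtain x y where *: "u = x + y" "x \<in> (\<lambda>a. a * h) ` A" "y \<in> is_submodule A hull S" by blast
    have "a * u = a * x + a * y" using * by (simp add: distrib_left)
    then show "a * u \<in> ?N"
      using submodule_closed(3)[OF mod a *(2)] span_closed(3)[OF a *(3)] by blast
  qed
  moreover have "insert h S \<subseteq> ?N"
  proof -
    have "h = h + 0" "h \<in> (\<lambda>a. a * h) ` A" using subring_closed(1)[OF assms(1)] by force+
    moreover have "s = 0 * h + s" for s by simp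
    ultimately show ?thesis
      using subring_closed(2)[OF assms(1)] span_closed(1) span_base by blast
  qed
  ultimately have "is_submodule A hull (insert h S) \<subseteq> ?N" by (rule span_minimal[rotated])
  with N show ?case by (rule noetherian_over_subset)
qed

section \<open>Hilbert's basis theorem for adjoining one element\<close>

primrec adjoin_deg :: "'r::comm_ring_1 set \<Rightarrow> 'r \<Rightarrow> nat \<Rightarrow> 'r set" where
  "adjoin_deg C x 0 = {0}"
| "adjoin_deg C x (Suc n) = {c * x ^ n + r | c r. c \<in> C \<and> r \<in> adjoin_deg C x n}"

declare adjoin_deg.simps(2) [simp del]

context
  fixes C :: "'r::comm_ring_1 set" and x :: 'r
  assumes C: "is_subring C"
begin

lemma adjoin_degI: "c \<in> C \<Longrightarrow> r \<in> adjoin_deg C x n \<Longrightarrow> c * x ^ n + r \<in> adjoin_deg C x (Suc n)"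
  by (auto simp: adjoin_deg.simps)

lemma submodule_adjoin_deg: "is_submodule C (adjoin_deg C x n)"
proof (induction n)
  case (Suc n)
  show ?case
    proof (rule submoduleI)
    show "0 \<in> adjoin_deg C x (Suc n)"
      using adjoin_degI[OF subring_closed(2)[OF C] submodule_closed(1)[OF Suc]] by simp
  next
    fix y z assume "y \<in> adjoin_deg C x (Suc n)" "z \<in> adjoin_deg C x (Suc n)"
    then obtain c r d s where *: "y = c * x ^ n + r" "z = d * x ^ n + s" "c \<in> C" "d \<in> C"
      "r \<in> adjoin_deg C x n" "s \<in> adjoin_deg C x n" by (auto simp: adjoin_deg.simps)
    then have "y + z = (c + d) * x ^ n + (r + s)" by (simp add: algebra_simps)
    then show "y + z \<in> adjoin_deg C x (Suc n)"
      using adjoin_degI[OF subring_closed(6)[OF C *(3,4)] submodule_closed(2)[OF Suc *(5,6)]] by simp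
  next
    fix a y assume a: "a \<in> C" and "y \<in> adjoin_deg C x (Suc n)"
    then obtain c r where *: "y = c * x ^ n + r" "c \<in> C" "r \<in> adjoin_deg C x n" by (auto simp: adjoin_deg.simps)
    then have "a * y = (a * c) * x ^ n + a * r" by (simp add: algebra_simps)
    then show "a * y \<in> adjoin_deg C x (Suc n)"
      using adjoin_degI[OF subring_closed(4)[OF C a *(2)] submodule_closed(3)[OF Suc a *(3)]] by simp
  qed
qed (auto simp: is_submodule_def)

lemma adjoin_deg_mono: "n \<le> N \<Longrightarrow> adjoin_deg C x n \<subseteq> adjoin_deg C x N"
proof (induction N rule: dec_induct)
  case (step N)
  have "r \<in> adjoin_deg C x (Suc N)" if "r \<in> adjoin_deg C x N" for r
    using adjoin_degI[OF subring_closed(2)[OF C] that] by simp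
  then show ?case using step by blast
qed auto

lemma adjoin_deg_shift: "r \<in> adjoin_deg C x n \<Longrightarrow> x ^ k * r \<in> adjoin_deg C x (n + k)"
proof (induction n arbitrary: r)
  case 0
  then show ?case using submodule_closed(1)[OF submodule_adjoin_deg] by simp
next
  case (Suc n)
  then obtain c s where "r = c * x ^ n + s" "c \<in> C" "s \<in> adjoin_deg C x n" by (auto simp: adjoin_deg.simps)
  moreover from this have "x ^ k * r = c * x ^ (n + k) + x ^ k * s"
    by (simp add: algebra_simps power_add)
  ultimately show ?case using adjoin_degI[of c "x ^ k * s" "n + k"] Suc.IH[of s] by simp
qed

lemma adjoin_deg_mult: "r \<in> adjoin_deg C x n \<Longrightarrow> s \<in> adjoin_deg C x k \<Longrightarrow> r * s \<in> adjoin_deg C x (n + k)"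
proof (induction n arbitrary: r)
  case 0
  then show ?case using submodule_closed(1)[OF submodule_adjoin_deg] by simp
next
  case (Suc n)
  then obtain c t where *: "r = c * x ^ n + t" "c \<in> C" "t \<in> adjoin_deg C x n" by (auto simp: adjoin_deg.simps)
  have "x ^ n * s \<in> adjoin_deg C x (Suc n + k)"
    using adjoin_deg_shift[OF Suc.prems(2), of n] adjoin_deg_mono[of "k + n" "Suc n + k"] by auto
  then have "c * (x ^ n * s) \<in> adjoin_deg C x (Suc n + k)"
    by (rule submodule_closed(3)[OF submodule_adjoin_deg *(2)])
  moreover have "t * s \<in> adjoin_deg C x (Suc n + k)"
    using Suc.IH[OF *(3) Suc.prems(2)] adjoin_deg_mono[of "n + k" "Suc n + k"] by auto
  moreover have "r * s = c * (x ^ n * s) + t * s" using * by (simp add: algebra_simps)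
  ultimately show ?case using submodule_closed(2)[OF submodule_adjoin_deg] by metis
qed

lemma subring_adjoin: "is_subring (\<Union>n. adjoin_deg C x n)"
  unfolding is_subring_def
proof (intro conjI ballI)
  have "1 * x ^ 0 + 0 \<in> adjoin_deg C x (Suc 0)"
    by (rule adjoin_degI) (auto intro: subring_closed[OF C])
  then show "1 \<in> (\<Union>n. adjoin_deg C x n)" unfolding power_0 mult_1 add_0_right by blast
next
  fix y z assume "y \<in> (\<Union>n. adjoin_deg C x n)" "z \<in> (\<Union>n. adjoin_deg C x n)"
  then obtain n k where nk: "y \<in> adjoin_deg C x n" "z \<in> adjoin_deg C x k" by auto
  then show "y * z \<in> (\<Union>n. adjoin_deg C x n)" using adjoin_deg_mult by blast
  have "y \<in> adjoin_deg C x (max n k)" "z \<in> adjoin_deg C x (max n k)"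
    using nk adjoin_deg_mono[of n "max n k"] adjoin_deg_mono[of k "max n k"] by auto
  then show "y - z \<in> (\<Union>n. adjoin_deg C x n)"
    using submodule_diff[OF C submodule_adjoin_deg] by blast
qed

lemma adjoin_base: "C \<subseteq> (\<Union>n. adjoin_deg C x n)" "x \<in> (\<Union>n. adjoin_deg C x n)"
proof -
  have "c * x ^ 0 + 0 \<in> adjoin_deg C x (Suc 0)" if "c \<in> C" for c
    by (rule adjoin_degI) (use that in auto)
  then show "C \<subseteq> (\<Union>n. adjoin_deg C x n)" unfolding power_0 mult_1_right add_0_right by blast
  have "1 * x ^ 1 + 0 \<in> adjoin_deg C x (Suc 1)"
    by (rule adjoin_degI) (use subring_closed[OF C] submodule_closed(1)[OF submodule_adjoin_deg] in auto)
  then show "x \<in> (\<Union>n. adjoin_deg C x n)" unfolding UN_iff power_one_right mult_1 add_0_right by blast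
qed

lemma adjoin_minimal:
  assumes "is_subring D" "C \<subseteq> D" "x \<in> D"
  shows "(\<Union>n. adjoin_deg C x n) \<subseteq> D"
proof -
  have "adjoin_deg C x n \<subseteq> D" for n
    by (induction n) (use assms subring_closed(2)[OF assms(1)] in
        \<open>auto simp: adjoin_deg.simps intro!: subring_closed(4,6) intro: subring_power\<close>)
  then show ?thesis by blast
qed

lemma noetherian_adjoin_deg:
  assumes "noetherian_over C C"
  shows "noetherian_over C (adjoin_deg C x n)"
proof -
  have "adjoin_deg C x n \<subseteq> is_submodule C hull ((\<lambda>i. x ^ i) ` {..<n})"
  proof (induction n)
    case (Suc n)
    have "is_submodule C hull ((\<lambda>i. x ^ i) ` {..<n}) \<subseteq> is_submodule C hull ((\<lambda>i. x ^ i) ` {..<Suc n})"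
      by (rule hull_mono) auto
    then show ?case using Suc by (auto simp: adjoin_deg.simps intro!: span_closed intro: span_base)
  qed (auto intro: span_closed)
  moreover have "noetherian_over C (is_submodule C hull ((\<lambda>i. x ^ i) ` {..<n}))"
    by (rule noetherian_over_span[OF C assms]) auto
  ultimately show ?thesis by (rule noetherian_over_subset[rotated])
qed

text \<open>In the ambient ring \<open>x\<close> may satisfy relations, so degrees and leading
  coefficients are not well defined. \<open>adjoin_deg\<close> only bounds the length of some
  expression in \<open>x\<close>, and Hilbert's argument runs over all expressions at once.\<close>

lemma noetherian_adjoin:
  assumes noeth: "noetherian_over C C"
  defines "D \<equiv> (\<Union>n. adjoin_deg C x n)"
  shows "noetherian_over D D"
  unfolding noetherian_over_def
proof (intro allI impI)
  fix I assume asm: "is_submodule D I \<and> I \<subseteq> D"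
  then have I: "is_submodule D I" by simp
  have D: "is_subring D" unfolding D_def by (rule subring_adjoin)
  have CD: "C \<subseteq> D" and xD: "x \<in> D" unfolding D_def using adjoin_base by auto
  have IC: "is_submodule C I" using I CD by (auto simp: is_submodule_def)
  \<comment> \<open>All coefficients at \<open>x ^ n\<close> in expressions of length
    \<open>n + 1\<close> for elements of \<open>I\<close>. Multiplication by \<open>x\<close> makes
    these ideals increase with \<open>n\<close>, so finitely many generators of their union lie in a
    single \<open>L N\<close>.\<close>
  define L where "L n = {c \<in> C. \<exists>r\<in>adjoin_deg C x n. c * x ^ n + r \<in> I}" for n
  have L: "is_submodule C (L n)" for n
    unfolding L_def
  proof (rule submoduleI)
    show "0 \<in> {c \<in> C. \<exists>r\<in>adjoin_deg C x n. c * x ^ n + r \<in> I}"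
      using subring_closed(2)[OF C] submodule_closed(1)[OF submodule_adjoin_deg]
        submodule_closed(1)[OF I] by (auto intro!: bexI[of _ 0])
  next
    fix c d assume "c \<in> {c \<in> C. \<exists>r\<in>adjoin_deg C x n. c * x ^ n + r \<in> I}"
      "d \<in> {c \<in> C. \<exists>r\<in>adjoin_deg C x n. c * x ^ n + r \<in> I}"
    then obtain r s where *: "c \<in> C" "d \<in> C" "r \<in> adjoin_deg C x n" "s \<in> adjoin_deg C x n"
      "c * x ^ n + r \<in> I" "d * x ^ n + s \<in> I" by auto
    have "(c + d) * x ^ n + (r + s) \<in> I"
      using submodule_closed(2)[OF I *(5,6)] by (simp add: algebra_simps)
    then show "c + d \<in> {c \<in> C. \<exists>r\<in>adjoin_deg C x n. c * x ^ n + r \<in> I}"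
      using subring_closed(6)[OF C *(1,2)] submodule_closed(2)[OF submodule_adjoin_deg *(3,4)] by blast
  next
    fix a c assume a: "a \<in> C" and "c \<in> {c \<in> C. \<exists>r\<in>adjoin_deg C x n. c * x ^ n + r \<in> I}"
    then obtain r where *: "c \<in> C" "r \<in> adjoin_deg C x n" "c * x ^ n + r \<in> I" by auto
    have "(a * c) * x ^ n + a * r \<in> I"
      using submodule_closed(3)[OF IC a *(3)] by (simp add: algebra_simps)
    then show "a * c \<in> {c \<in> C. \<exists>r\<in>adjoin_deg C x n. c * x ^ n + r \<in> I}"
      using subring_closed(4)[OF C a *(1)] submodule_closed(3)[OF submodule_adjoin_deg a *(2)] by blast
  qed
  have Lmono: "L n \<subseteq> L N" if "n \<le> N" for n N
  proof -
    have "c \<in> L (Suc n)" if "c \<in> L n" for c n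
    proof -
      obtain r where r: "c \<in> C" "r \<in> adjoin_deg C x n" "c * x ^ n + r \<in> I"
        using \<open>c \<in> L n\<close> by (auto simp: L_def)
      have "c * x ^ Suc n + x ^ 1 * r \<in> I"
        using submodule_closed(3)[OF I xD r(3)] by (simp add: algebra_simps)
      then show ?thesis using r adjoin_deg_shift[OF r(2), of 1] unfolding L_def by auto
    qed
    then have "incseq L" by (intro incseq_SucI) blast
    then show ?thesis using that by (simp add: incseq_def)
  qed
  have "is_submodule C (\<Union>n. L n)"
    proof (rule submoduleI)
    show "0 \<in> (\<Union>n. L n)" using submodule_closed(1)[OF L] by auto
  next
    fix c d assume "c \<in> (\<Union>n. L n)" "d \<in> (\<Union>n. L n)"
    then obtain n k where "c \<in> L n" "d \<in> L k" by auto
    then have "c \<in> L (max n k)" "d \<in> L (max n k)" using Lmono[of n "max n k"] Lmono[of k "max n k"] by auto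
    then show "c + d \<in> (\<Union>n. L n)" using submodule_closed(2)[OF L] by blast
  next
    fix a c assume "a \<in> C" "c \<in> (\<Union>n. L n)"
    then show "a * c \<in> (\<Union>n. L n)" using submodule_closed(3)[OF L] by blast
  qed
  moreover have "(\<Union>n. L n) \<subseteq> C" by (auto simp: L_def)
  ultimately obtain S where S: "finite S" "(\<Union>n. L n) = is_submodule C hull S"
    by (rule noetherian_overE[OF noeth])
  have "\<exists>N. S \<subseteq> L N"
  proof -
    have "S \<subseteq> (\<Union>n. L n)" unfolding S(2) by (rule hull_subset)
    then have "\<forall>s\<in>S. \<exists>n. s \<in> L n" by auto
    then obtain k where k: "\<And>s. s \<in> S \<Longrightarrow> s \<in> L (k s)" by metis
    have "k s \<le> Max (k ` S)" if "s \<in> S" for s using S(1) that by auto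
    then have "S \<subseteq> L (Max (k ` S))" using k Lmono by blast
    then show ?thesis by blast
  qed
  then obtain N where N: "S \<subseteq> L N" by blast
  have LN: "L n \<subseteq> is_submodule C hull S" for n unfolding S(2)[symmetric] by blast
  have "\<forall>s\<in>S. \<exists>r\<in>adjoin_deg C x N. s * x ^ N + r \<in> I" using N by (auto simp: L_def)
  then obtain t where t: "\<And>s. s \<in> S \<Longrightarrow> t s \<in> adjoin_deg C x N" "\<And>s. s \<in> S \<Longrightarrow> s * x ^ N + t s \<in> I"
    by metis
  \<comment> \<open>Short elements are treated separately: they lie in a Noetherian
    \<open>C\<close>-module.\<close>
  have "is_submodule C (I \<inter> adjoin_deg C x N)"
    using IC submodule_adjoin_deg[of N] by (auto simp: is_submodule_def)
  then obtain T where T: "finite T" "I \<inter> adjoin_deg C x N = is_submodule C hull T"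
    using noetherian_adjoin_deg[OF noeth, of N] unfolding noetherian_over_def by blast
  define G where "G = (\<lambda>s. s * x ^ N + t s) ` S \<union> T"
  have G: "finite G" using S T by (simp add: G_def)
  have GI: "is_submodule D hull G \<subseteq> I"
    by (rule span_minimal) (use t T I hull_subset[of T "is_submodule C"] in \<open>auto simp: G_def\<close>)
  have lift: "\<exists>w\<in>is_submodule D hull G. w - c * x ^ N \<in> adjoin_deg C x N" if "c \<in> is_submodule C hull S" for c
  proof -
    have "is_submodule C hull S \<subseteq> {c. \<exists>w\<in>is_submodule D hull G. w - c * x ^ N \<in> adjoin_deg C x N}"
    proof (rule span_minimal)
      show "S \<subseteq> {c. \<exists>w\<in>is_submodule D hull G. w - c * x ^ N \<in> adjoin_deg C x N}"
        using t by (auto simp: G_def intro!: bexI[of _ "_ + _"] span_base)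
      show "is_submodule C {c. \<exists>w\<in>is_submodule D hull G. w - c * x ^ N \<in> adjoin_deg C x N}"
        proof (rule submoduleI)
        show "0 \<in> {c. \<exists>w\<in>is_submodule D hull G. w - c * x ^ N \<in> adjoin_deg C x N}"
          using submodule_closed(1)[OF submodule_adjoin_deg] by (auto intro!: bexI[of _ 0] span_closed)
      next
        fix c d assume "c \<in> {c. \<exists>w\<in>is_submodule D hull G. w - c * x ^ N \<in> adjoin_deg C x N}"
          "d \<in> {c. \<exists>w\<in>is_submodule D hull G. w - c * x ^ N \<in> adjoin_deg C x N}"
        then obtain w v where *: "w \<in> is_submodule D hull G" "v \<in> is_submodule D hull G"
          "w - c * x ^ N \<in> adjoin_deg C x N" "v - d * x ^ N \<in> adjoin_deg C x N" by auto
        then have "(w + v) - (c + d) * x ^ N \<in> adjoin_deg C x N"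
          using submodule_closed(2)[OF submodule_adjoin_deg *(3,4)] by (simp add: algebra_simps)
        then show "c + d \<in> {c. \<exists>w\<in>is_submodule D hull G. w - c * x ^ N \<in> adjoin_deg C x N}"
          using span_closed(2)[OF *(1,2)] by blast
      next
        fix a c assume a: "a \<in> C" and "c \<in> {c. \<exists>w\<in>is_submodule D hull G. w - c * x ^ N \<in> adjoin_deg C x N}"
        then obtain w where *: "w \<in> is_submodule D hull G" "w - c * x ^ N \<in> adjoin_deg C x N" by auto
        then have "a * w - a * c * x ^ N \<in> adjoin_deg C x N"
          using submodule_closed(3)[OF submodule_adjoin_deg a *(2)] by (simp add: algebra_simps)
        then show "a * c \<in> {c. \<exists>w\<in>is_submodule D hull G. w - c * x ^ N \<in> adjoin_deg C x N}"
          using span_closed(3)[OF _ *(1)] a CD by blast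
      qed
    qed
    then show ?thesis using that by blast
  qed
  \<comment> \<open>Beyond length \<open>N\<close> the top term is cancelled by
    \<open>x ^ (n - N)\<close> times a lift of its coefficient, which shortens the
    expression.\<close>
  have main: "p \<in> I \<Longrightarrow> p \<in> adjoin_deg C x n \<Longrightarrow> p \<in> is_submodule D hull G" for p n
  proof (induction n arbitrary: p)
    case 0
    then show ?case by (auto intro: span_closed)
  next
    case (Suc n)
    show ?case
    proof (cases "Suc n \<le> N")
      case True
      then have "p \<in> is_submodule C hull T" using Suc.prems adjoin_deg_mono T by blast
      also have "\<dots> \<subseteq> is_submodule D hull G"
      proof (rule span_minimal)
        show "is_submodule C (is_submodule D hull G)" using submodule_span[of D G] CD unfolding is_submodule_def by blast
      qed (auto simp: G_def intro: span_base)
      finally show ?thesis .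
    next
      case False
      obtain c r where cr: "p = c * x ^ n + r" "c \<in> C" "r \<in> adjoin_deg C x n" using Suc.prems by (auto simp: adjoin_deg.simps)
      then have "c \<in> L n" using Suc.prems by (auto simp: L_def)
      then obtain w where w: "w \<in> is_submodule D hull G" "w - c * x ^ N \<in> adjoin_deg C x N"
        using LN lift by blast
      let ?k = "n - N"
      have nk: "n = N + ?k" using False by simp
      have xw: "x ^ ?k * w \<in> is_submodule D hull G"
        using span_closed(3)[OF subring_power[OF D xD] w(1)] .
      have "p - x ^ ?k * w = r - x ^ ?k * (w - c * x ^ N)"
        using cr by (subst (2) nk) (simp add: algebra_simps flip: power_add, use nk in simp)
      moreover have "x ^ ?k * (w - c * x ^ N) \<in> adjoin_deg C x n"
        using adjoin_deg_shift[OF w(2), of ?k] nk by simp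
      ultimately have "p - x ^ ?k * w \<in> adjoin_deg C x n"
        using submodule_diff[OF C submodule_adjoin_deg cr(3)] by simp
      moreover have "p - x ^ ?k * w \<in> I" using submodule_diff[OF D I Suc.prems(1)] xw GI by blast
      ultimately have "p - x ^ ?k * w \<in> is_submodule D hull G" by (rule Suc.IH[rotated])
      then show ?thesis using span_closed(2)[OF xw] by force
    qed
  qed
  have "I \<subseteq> is_submodule D hull G"
  proof
    fix p assume "p \<in> I"
    moreover from this obtain n where "p \<in> adjoin_deg C x n" using asm by (auto simp: D_def)
    ultimately show "p \<in> is_submodule D hull G" by (rule main)
  qed
  then show "\<exists>S. finite S \<and> I = is_submodule D hull S"
    using G GI by (intro exI[of _ G] conjI equalityI)
qed

end

text \<open>The constants are a field only as a subset of the polynomial ring, so inverses are taken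
  before applying \<open>\<phi>\<close>.\<close>

lemma noetherian_field_image:
  fixes \<phi> :: "'k::field \<Rightarrow> 'r::comm_ring_1"
  assumes "\<phi> 1 = 1" and mult: "\<And>x y. \<phi> (x * y) = \<phi> x * \<phi> y" and "\<phi> 0 = 0"
  shows "noetherian_over (range \<phi>) (range \<phi>)"
  unfolding noetherian_over_def
proof (intro allI impI)
  fix M assume asm: "is_submodule (range \<phi>) M \<and> M \<subseteq> range \<phi>"
  show "\<exists>S. finite S \<and> M = is_submodule (range \<phi>) hull S"
  proof (cases "M = {0}")
    case True
    then show ?thesis using noetherian_over_zero[of "range \<phi>"] asm
      unfolding noetherian_over_def by blast
  next
    case False
    then obtain c where c: "\<phi> c \<in> M" "\<phi> c \<noteq> 0"
      using asm submodule_closed(1)[of "range \<phi>" M] by blast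
    then have "c \<noteq> 0" using assms by auto
    then have eq: "\<phi> (x * inverse c) * \<phi> c = \<phi> x" for x
      by (simp add: mult[symmetric] mult.assoc)
    have "\<phi> x \<in> is_submodule (range \<phi>) hull {\<phi> c}" for x
      using span_closed(3)[of "\<phi> (x * inverse c)" "range \<phi>" "\<phi> c" "{\<phi> c}"] span_base[of "\<phi> c" "{\<phi> c}"]
      unfolding eq by blast
    then have "M \<subseteq> is_submodule (range \<phi>) hull {\<phi> c}" using asm by blast
    moreover have "is_submodule (range \<phi>) hull {\<phi> c} \<subseteq> M"
      by (rule span_minimal) (use c asm in auto)
    ultimately show ?thesis by blast
  qed
qed

lemma subring_if_subalgebra:
  assumes "subalgebra (S :: ('x, 'k::comm_ring_1) mpolynomial set)"
  shows "is_subring S"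
proof -
  have c: "Const c \<in> S" for c using assms by (auto simp: subalgebra_def)
  have "Const 1 = (1 :: ('x, 'k) mpolynomial)" by (simp add: Const_def)
  moreover have "x - y = x + Const (- 1) * y" for x y :: "('x, 'k) mpolynomial"
    by (simp add: Const_def single_uminus)
  ultimately show ?thesis
    using assms c unfolding is_subring_def subalgebra_def by metis
qed

lemma subalgebra_hull: "subalgebra (subalgebra hull S)"
  by (rule hull_in) (auto simp: subalgebra_def)

lemma noetherian_subalgebra_hull:
  assumes "finite (S :: ('x, 'k::field) mpolynomial set)"
  shows "noetherian_over (subalgebra hull S) (subalgebra hull S)"
  using assms
proof (induction S)
  case empty
  have "subalgebra (range Const :: ('x, 'k) mpolynomial set)"
    by (auto simp: subalgebra_def Const_def mult_single simp flip: single_add intro: rangeI)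
  then have "subalgebra hull {} = (range Const :: ('x, 'k) mpolynomial set)"
    using subalgebra_hull[of "{}"] by (intro equalityI hull_minimal) (auto simp: subalgebra_def)
  then show ?case
    using noetherian_field_image[of "Const :: 'k \<Rightarrow> ('x, 'k) mpolynomial"]
    by (simp add: Const_def mult_single)
next
  case (insert x S)
  let ?C = "subalgebra hull S" and ?D = "subalgebra hull (insert x S)"
  have C: "is_subring ?C" by (intro subring_if_subalgebra subalgebra_hull)
  let ?E = "\<Union>n. adjoin_deg ?C x n"
  have E: "is_subring ?E" "?C \<subseteq> ?E" "x \<in> ?E"
    using subring_adjoin[OF C] adjoin_base[OF C] by auto
  have "range Const \<subseteq> ?C" using subalgebra_hull[of S] by (simp add: subalgebra_def)
  then have "subalgebra ?E"
    unfolding subalgebra_def[of ?E] using subring_closed(4,6)[OF E(1)]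
    by (intro conjI ballI subset_trans[OF _ E(2)])
  then have "?D \<subseteq> ?E" using E hull_subset[of S subalgebra] by (intro hull_minimal) auto
  moreover have "?E \<subseteq> ?D"
  proof (rule adjoin_minimal[OF C])
    show "is_subring ?D" by (intro subring_if_subalgebra subalgebra_hull)
    show "?C \<subseteq> ?D" by (rule hull_mono) auto
    show "x \<in> ?D" using hull_subset[of "insert x S" subalgebra] by auto
  qed
  ultimately have "?D = ?E" by (rule equalityI)
  then show ?case using noetherian_adjoin[OF C insert.IH] by simp
qed

section \<open>Integrality and valuation rings\<close>

text \<open>As \<open>inverse 0 = 0\<close>, the condition at zero only says that zero lies in
  \<open>V\<close>; so this is the usual notion.\<close>

definition valuation_subring :: "'a::field set \<Rightarrow> bool" where
  "valuation_subring V \<longleftrightarrow> is_subring V \<and> (\<forall>x. x \<in> V \<or> inverse x \<in> V)"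

text \<open>The case \<open>r = 0\<close> would assert \<open>1 = 0\<close>, so in a nontrivial ring
  this is an ordinary monic equation.\<close>

definition integral_over :: "'r::comm_ring_1 set \<Rightarrow> 'r \<Rightarrow> bool" where
  "integral_over A x \<longleftrightarrow> (\<exists>r a. (\<forall>i<r. a i \<in> A) \<and> x ^ r = (\<Sum>i<r. a i * x ^ i))"

lemma adjoin_deg_sum:
  "y \<in> adjoin_deg C x n \<Longrightarrow> \<exists>c. (\<forall>i. i < n \<longrightarrow> c i \<in> C) \<and> y = (\<Sum>i<n. c i * x ^ i)"
proof (induction n arbitrary: y)
  case (Suc n)
  then obtain d r where *: "y = d * x ^ n + r" "d \<in> C" "r \<in> adjoin_deg C x n"
    by (auto simp: adjoin_deg.simps)
  from Suc.IH[OF *(3)] obtain c where c: "\<forall>i. i < n \<longrightarrow> c i \<in> C" "r = (\<Sum>i<n. c i * x ^ i)" by blast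
  have "y = (\<Sum>i<Suc n. (c(n := d)) i * x ^ i)" using * c by simp
  moreover have "\<forall>i. i < Suc n \<longrightarrow> (c(n := d)) i \<in> C" using c * by (auto simp: less_Suc_eq)
  ultimately show ?case by blast
qed auto

lemma adjoin_deg_power:
  assumes "is_subring C" "i < n"
  shows "x ^ i \<in> adjoin_deg C x n"
proof -
  have "1 * x ^ i + 0 \<in> adjoin_deg C x (Suc i)"
    using assms by (intro adjoin_degI submodule_closed(1)[OF submodule_adjoin_deg] subring_closed(1))
  then show ?thesis using adjoin_deg_mono[OF assms(1), of "Suc i" n] assms(2) by auto
qed

text \<open>A subring that is maximal among those containing \<open>inverse x\<close> but not \<open>x\<close> is a valuation
  ring; such subrings exist above \<open>A\<close> because \<open>x \<in> A[inverse x]\<close> is an integral equation.\<close>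

lemma valuation_subring_if_maximal:
  fixes x :: "'a::field"
  assumes V: "is_subring V" and xV: "x \<notin> V" and yV: "inverse x \<in> V" and x0: "x \<noteq> 0"
    and max: "\<And>W. is_subring W \<Longrightarrow> V \<subseteq> W \<Longrightarrow> x \<notin> W \<Longrightarrow> W = V"
  shows "valuation_subring V"
proof -
  define y where "y = inverse x"
  have xy: "x * y = 1" and yV: "y \<in> V" using x0 yV by (auto simp: y_def)
  \<comment> \<open>Maximality: adjoining anything outside \<open>V\<close> brings in
    \<open>x\<close>.\<close>
  have adj: "\<exists>n. x \<in> adjoin_deg V t n" if "t \<notin> V" for t
  proof (rule ccontr)
    assume "\<nexists>n. x \<in> adjoin_deg V t n"
    then have "x \<notin> (\<Union>n. adjoin_deg V t n)" by blast
    then have "(\<Union>n. adjoin_deg V t n) = V"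
      by (intro max subring_adjoin adjoin_base V)
    then show False using adjoin_base(2)[OF V] that by blast
  qed
  \<comment> \<open>The multiples of \<open>y\<close> lie in the Jacobson radical of
    \<open>V\<close>. Otherwise \<open>x\<close> is a polynomial in \<open>inverse e\<close>;
    clearing denominators puts \<open>e ^ n * x\<close> into \<open>V\<close>. Since
    \<open>e ^ n\<close> is 1 modulo \<open>y\<close> and \<open>x * y = 1\<close>, this differs
    from \<open>x\<close> by an element of \<open>V\<close>.\<close>
  have unit: "1 - y * d \<noteq> 0 \<and> inverse (1 - y * d) \<in> V" if d: "d \<in> V" for d
  proof
    define e where "e = 1 - y * d"
    show e0: "1 - y * d \<noteq> 0"
    proof
      assume "1 - y * d = 0"
      then have "x * (y * d) = x" by simp
      then have "d = x" using xy by (simp flip: mult.assoc)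
      then show False using d xV by simp
    qed
    show "inverse (1 - y * d) \<in> V"
    proof (rule ccontr)
      assume "inverse (1 - y * d) \<notin> V"
      then obtain n where n: "x \<in> adjoin_deg V (inverse e) n" using adj e_def by blast
      have eV: "e \<in> V" unfolding e_def using d yV by (intro subring_closed[OF V])
      have "e ^ k * r \<in> V" if "r \<in> adjoin_deg V (inverse e) k" for r k
        using that
      proof (induction k arbitrary: r)
        case 0
        then show ?case using subring_closed(2)[OF V] by simp
      next
        case (Suc k)
        then obtain c s where *: "r = c * inverse e ^ k + s" "c \<in> V" "s \<in> adjoin_deg V (inverse e) k"
          by (auto simp: adjoin_deg.simps)
        have "e ^ k * inverse e ^ k = 1" using e0 by (simp add: e_def flip: power_mult_distrib)
        then have "e ^ Suc k * r = e * c + e * (e ^ k * s)"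
          using * by (simp add: algebra_simps)
        then show ?case using Suc.IH[OF *(3)] eV *(2) subring_closed(4,6)[OF V] by simp
      qed
      from this[OF n] have exV: "e ^ n * x \<in> V" .
      have "\<exists>d'\<in>V. e ^ n = 1 - y * d'"
      proof (induction n)
        case 0
        then show ?case using subring_closed(2)[OF V] by (intro bexI[of _ 0]) auto
      next
        case (Suc n)
        then obtain d' where d': "d' \<in> V" "e ^ n = 1 - y * d'" by blast
        have "e ^ Suc n = 1 - y * (d + d' - y * d * d')"
          unfolding power_Suc d'(2) by (simp add: e_def algebra_simps)
        moreover have "d + d' - y * d * d' \<in> V"
          by (intro subring_closed(3,4,6)[OF V] d d'(1) yV)
        ultimately show ?case by blast
      qed
      then obtain d' where d': "d' \<in> V" "e ^ n = 1 - y * d'" by blast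
      have "e ^ n * x + d' = x - (x * y) * d' + d'" unfolding d'(2) by (simp add: algebra_simps)
      then have "e ^ n * x + d' = x" by (simp add: xy)
      then show False using subring_closed(6)[OF V exV d'(1)] xV by simp
    qed
  qed
  \<comment> \<open>In the expression through \<open>inverse t\<close>, let \<open>z\<close> be the
    part without constant term; then \<open>y * z\<close> is the unit \<open>e\<close>. Multiplying
    by \<open>t ^ a\<close> writes \<open>t ^ a\<close> through lower powers of \<open>t\<close>,
    since \<open>b\<close> is at most \<open>a\<close>; so the top term of the other expression can
    be replaced.\<close>
  have reduce: "x \<in> adjoin_deg V t a"
    if t: "t \<noteq> 0" and a: "x \<in> adjoin_deg V t (Suc a)"
      and b: "x \<in> adjoin_deg V (inverse t) (Suc b)" and ba: "b \<le> a" for t a b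
  proof -
    obtain d where d: "\<forall>j. j < Suc b \<longrightarrow> d j \<in> V" "x = (\<Sum>j<Suc b. d j * inverse t ^ j)"
      using adjoin_deg_sum[OF b] by blast
    obtain c r where cr: "x = c * t ^ a + r" "c \<in> V" "r \<in> adjoin_deg V t a"
      using a by (auto simp: adjoin_deg.simps)
    define e where "e = 1 - y * d 0"
    have e: "e \<noteq> 0" "inverse e \<in> V" unfolding e_def using unit[of "d 0"] d by auto
    define z where "z = (\<Sum>j<b. d (Suc j) * inverse t ^ Suc j)"
    have xz: "x = d 0 + z" unfolding z_def by (subst d(2), subst sum.lessThan_Suc_shift) simp
    have "y * z = y * (x - d 0)" by (simp add: xz)
    also have "\<dots> = e" using xy by (simp add: e_def algebra_simps)
    finally have yz: "y * z = e" .
    have "t ^ a * z = (\<Sum>j<b. d (Suc j) * t ^ (a - Suc j))"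
      unfolding z_def sum_distrib_left
    proof (rule sum.cong[OF refl])
      fix j assume "j \<in> {..<b}"
      then have "t ^ a * inverse t ^ Suc j = t ^ (a - Suc j)"
        using ba t by (simp add: power_diff power_inverse field_simps)
      then show "t ^ a * (d (Suc j) * inverse t ^ Suc j) = d (Suc j) * t ^ (a - Suc j)"
        by (simp add: mult.left_commute)
    qed
    also have "\<dots> \<in> adjoin_deg V t a"
    proof (intro submodule_sum[OF submodule_adjoin_deg[OF V]] submodule_closed(3)[OF submodule_adjoin_deg[OF V]])
      fix j assume "j \<in> {..<b}"
      then show "d (Suc j) \<in> V" "t ^ (a - Suc j) \<in> adjoin_deg V t a"
        using d ba by (auto intro!: adjoin_deg_power[OF V])
    qed
    finally have "(inverse e * y) * (t ^ a * z) \<in> adjoin_deg V t a"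
      by (rule submodule_closed(3)[OF submodule_adjoin_deg[OF V] subring_closed(4)[OF V e(2) yV]])
    moreover have "(inverse e * y) * (t ^ a * z) = t ^ a"
      using yz e by (metis (no_types, lifting) left_inverse mult.assoc mult.commute mult.right_neutral)
    ultimately have "c * t ^ a \<in> adjoin_deg V t a"
      using submodule_closed(3)[OF submodule_adjoin_deg[OF V] cr(2)] by metis
    then show ?thesis using cr submodule_closed(2)[OF submodule_adjoin_deg[OF V]] by blast
  qed
  \<comment> \<open>Descent on the total length: the expression that is not the shorter one loses
    its top term, and \<open>reduce\<close> is symmetric in \<open>t\<close> and
    \<open>inverse t\<close>.\<close>
  have none: "\<not> (x \<in> adjoin_deg V t a \<and> x \<in> adjoin_deg V (inverse t) b)" if t: "t \<noteq> 0" for t a b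
  proof (induction "a + b" arbitrary: a b rule: less_induct)
    case less
    show ?case
    proof
      assume *: "x \<in> adjoin_deg V t a \<and> x \<in> adjoin_deg V (inverse t) b"
      then have "a \<noteq> 0" "b \<noteq> 0" using x0 by (cases a; cases b; simp)+
      then obtain a' b' where ab: "a = Suc a'" "b = Suc b'" by (meson not0_implies_Suc)
      show False
      proof (cases "b' \<le> a'")
        case True
        then have "x \<in> adjoin_deg V t a'" using reduce[OF t] * ab by blast
        then show False using less[of a' b] * ab by simp
      next
        case False
        then have "x \<in> adjoin_deg V (inverse t) b'"
          using reduce[of "inverse t" b' a'] * ab t by simp
        then show False using less[of a b'] * ab by simp
      qed
    qed
  qed
  have "t \<in> V \<or> inverse t \<in> V" for t
  proof (rule ccontr)
    assume *: "\<not> (t \<in> V \<or> inverse t \<in> V)"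
    then have "t \<noteq> 0" using subring_closed(2)[OF V] by auto
    then show False using none adj * by meson
  qed
  then show ?thesis using V by (simp add: valuation_subring_def)
qed

lemma not_integral_imp_valuation_subring:
  fixes x :: "'a::field"
  assumes A: "is_subring A" and x: "\<not> integral_over A x"
  obtains V where "valuation_subring V" "A \<subseteq> V" "x \<notin> V"
proof -
  have x0: "x \<noteq> 0"
  proof
    assume "x = 0"
    then have "integral_over A x" unfolding integral_over_def
      using subring_closed(2)[OF A] by (intro exI[of _ 1] exI[of _ "\<lambda>_. 0"]) auto
    then show False using x by simp
  qed
  let ?D = "\<Union>n. adjoin_deg A (inverse x) n"
  have xD: "x \<notin> ?D"
  proof
    assume "x \<in> ?D"
    then obtain n where "x \<in> adjoin_deg A (inverse x) n" by blast
    then obtain c where c: "\<forall>i. i < n \<longrightarrow> c i \<in> A" "x = (\<Sum>i<n. c i * inverse x ^ i)"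
      using adjoin_deg_sum by blast
    have n0: "n \<noteq> 0"
    proof
      assume "n = 0"
      then show False using c(2) x0 by simp
    qed
    \<comment> \<open>Multiplying the expression of \<open>x\<close> in \<open>inverse x\<close> by
      \<open>x ^ (n - 1)\<close> clears the negative powers and leaves a monic equation of degree
      \<open>n\<close>.\<close>
    then have "x ^ n = x ^ (n - 1) * x" by (simp add: power_eq_if)
    also have "\<dots> = (\<Sum>i<n. x ^ (n - 1) * (c i * inverse x ^ i))"
      by (subst (2) c(2)) (simp add: sum_distrib_left)
    also have "\<dots> = (\<Sum>i<n. c i * x ^ (n - Suc i))"
    proof (rule sum.cong[OF refl])
      fix i assume "i \<in> {..<n}"
      then have "x ^ (n - 1) * inverse x ^ i = x ^ (n - Suc i)"
        using x0 by (simp add: power_inverse power_diff[of x i "n - 1", symmetric] field_simps flip: power_add)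
      then show "x ^ (n - 1) * (c i * inverse x ^ i) = c i * x ^ (n - Suc i)"
        by (simp add: mult.left_commute)
    qed
    also have "\<dots> = (\<Sum>i<n. c (n - Suc i) * x ^ i)"
      by (subst sum.nat_diff_reindex[symmetric]) (intro sum.cong, auto)
    finally have "integral_over A x" unfolding integral_over_def
      using c(1) n0 by (intro exI[of _ n] exI[of _ "\<lambda>i. c (n - Suc i)"]) auto
    then show False using x by simp
  qed
  let ?F = "{V. is_subring V \<and> ?D \<subseteq> V \<and> x \<notin> V}"
  have "\<exists>V\<in>?F. \<forall>W\<in>?F. V \<subseteq> W \<longrightarrow> W = V"
  proof (rule subset_Zorn_nonempty)
    show "?F \<noteq> {}" using xD subring_adjoin[OF A] by blast
  next
    fix \<C> assume ne: "\<C> \<noteq> {}" and chain: "subset.chain ?F \<C>"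
    have sub: "is_subring V" "?D \<subseteq> V" "x \<notin> V" if "V \<in> \<C>" for V
      using chain that by (auto simp: subset.chain_def)
    have "is_subring (\<Union>\<C>)"
      unfolding is_subring_def
    proof (intro conjI ballI)
      show "1 \<in> \<Union>\<C>" using ne sub(1) subring_closed(1) by blast
    next
      fix a b assume "a \<in> \<Union>\<C>" "b \<in> \<Union>\<C>"
      then obtain V W where VW: "V \<in> \<C>" "W \<in> \<C>" "a \<in> V" "b \<in> W" by blast
      then have "V \<subseteq> W \<or> W \<subseteq> V" using chain by (auto simp: subset_chain_def)
      then obtain U where U: "U \<in> \<C>" "a \<in> U" "b \<in> U" using VW by blast
      then show "a - b \<in> \<Union>\<C>" "a * b \<in> \<Union>\<C>" using subring_closed(3,4)[OF sub(1)[OF U(1)]] by blast+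
    qed
    moreover have "?D \<subseteq> \<Union>\<C>"
    proof -
      obtain V where V: "V \<in> \<C>" using ne by blast
      then show ?thesis using sub(2)[OF V] by (rule Sup_upper2)
    qed
    moreover have "x \<notin> \<Union>\<C>" using sub(3) by (meson UnionE)
    ultimately show "\<Union>\<C> \<in> ?F" by (intro CollectI conjI)
  qed
  then obtain V where V: "is_subring V" "?D \<subseteq> V" "x \<notin> V"
    and max: "\<And>W. is_subring W \<Longrightarrow> ?D \<subseteq> W \<Longrightarrow> x \<notin> W \<Longrightarrow> V \<subseteq> W \<Longrightarrow> W = V"
    by (metis (mono_tags, lifting) mem_Collect_eq)
  have "inverse x \<in> V" "A \<subseteq> V" using V(2) adjoin_base[OF A, of "inverse x"] by auto
  moreover have "valuation_subring V"
    by (rule valuation_subring_if_maximal[OF V(1,3) calculation(1) x0]) (rule max, use V(2) in auto)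
  ultimately show thesis using that V(3) by blast
qed

section \<open>Reflections and lattices over a valuation ring\<close>

text \<open>Vectors are functions on all naturals, so linear combinations need no dimension
  bookkeeping; only the first \<open>n\<close> values enter.\<close>

definition qf :: "nat \<Rightarrow> (nat \<Rightarrow> 'a::comm_ring_1) \<Rightarrow> 'a" where
  "qf n v = (\<Sum>t<n div 2. v t * v (n div 2 + t)) + (if odd n then (v (2 * (n div 2)))\<^sup>2 else 0)"

text \<open>For odd \<open>n\<close> the polar form has a further term, twice the product of the
  last coordinates. It vanishes in characteristic 2, where the last axis therefore lies in the
  radical.\<close>

definition bf :: "nat \<Rightarrow> (nat \<Rightarrow> 'a::comm_ring_1) \<Rightarrow> (nat \<Rightarrow> 'a) \<Rightarrow> 'a" where
  "bf n v w = (\<Sum>t<n div 2. v t * w (n div 2 + t) + v (n div 2 + t) * w t)"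

definition unit_fun :: "nat \<Rightarrow> nat \<Rightarrow> 'a::comm_ring_1" where
  "unit_fun i r = (if r = i then 1 else 0)"

lemma bf_commute: "bf n v w = bf n w v"
  unfolding bf_def by (intro sum.cong) (auto simp: algebra_simps)

lemma bf_add_left: "bf n (\<lambda>r. v r + w r) x = bf n v x + bf n w x"
  unfolding bf_def by (simp add: algebra_simps sum.distrib)

lemma bf_add_right: "bf n x (\<lambda>r. v r + w r) = bf n x v + bf n x w"
  unfolding bf_def by (simp add: algebra_simps sum.distrib)

lemma bf_scale_left: "bf n (\<lambda>r. c * v r) x = c * bf n v x"
  unfolding bf_def by (simp add: algebra_simps sum_distrib_left)

lemma bf_scale_right: "bf n x (\<lambda>r. c * v r) = c * bf n x v"
  unfolding bf_def by (simp add: algebra_simps sum_distrib_left)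

lemmas bf_linear = bf_add_left bf_add_right bf_scale_left bf_scale_right

lemma qf_scale: "qf n (\<lambda>r. c * v r) = c\<^sup>2 * qf n v"
  unfolding qf_def by (simp add: algebra_simps sum_distrib_left power2_eq_square)

lemma qf_add_general:
  "qf n (\<lambda>r. v r + w r) = qf n v + qf n w + bf n v w
     + (if odd n then 2 * v (2 * (n div 2)) * w (2 * (n div 2)) else 0)"
  unfolding qf_def bf_def by (simp add: algebra_simps sum.distrib power2_eq_square)

lemma bf_unit_low: "i < n div 2 \<Longrightarrow> bf n v (unit_fun i) = v (n div 2 + i)"
  unfolding bf_def unit_fun_def by (simp add: if_distrib[of "\<lambda>c. _ * c"] cong: if_cong)

lemma bf_unit_high: "i < n div 2 \<Longrightarrow> bf n v (unit_fun (n div 2 + i)) = v i"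
  unfolding bf_def unit_fun_def by (simp add: if_distrib[of "\<lambda>c. _ * c"] cong: if_cong)

lemma qf_unit: "i < 2 * (n div 2) \<Longrightarrow> qf n (unit_fun i) = 0"
  unfolding qf_def unit_fun_def by (auto intro!: sum.neutral)

text \<open>The orthogonal transvection along \<open>u\<close>, written with the sign of
  characteristic 2. For \<open>qf n u = 0\<close> division by zero makes it the identity.\<close>

definition reflect :: "nat \<Rightarrow> (nat \<Rightarrow> 'a::field) \<Rightarrow> (nat \<Rightarrow> 'a) \<Rightarrow> nat \<Rightarrow> 'a" where
  "reflect n u v = (\<lambda>r. v r + bf n v u / qf n u * u r)"

locale char2 =
  fixes n :: nat and ty :: "'a::field itself"
  assumes two: "(2 :: 'a) = 0"
begin

lemma add_self [simp]: "(x :: 'a) + x = 0"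
  by (metis two mult_2 mult_zero_left)

lemma add_self' [simp]: "(x :: 'a) + (x + y) = y"
  by (simp flip: add.assoc)

lemma add_eq_0: "(x :: 'a) + y = 0 \<longleftrightarrow> x = y"
  by (metis add_self add_left_cancel)

lemma qf_add: "qf n (\<lambda>r. v r + w r :: 'a) = qf n v + qf n w + bf n v w"
  by (simp add: qf_add_general two)

lemma bf_self [simp]: "bf n v v = (0 :: 'a)"
  unfolding bf_def by (simp add: mult.commute)

lemma qf_reflect: "qf n u \<noteq> (0 :: 'a) \<Longrightarrow> qf n (reflect n u v) = qf n v"
  unfolding reflect_def qf_add qf_scale bf_linear by (simp add: power2_eq_square add.assoc)

lemma bf_reflect: "qf n u \<noteq> (0 :: 'a) \<Longrightarrow> bf n (reflect n u v) (reflect n u w) = bf n v w"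
  unfolding reflect_def bf_linear by (simp add: bf_commute[of n u w] add.assoc mult.commute)

lemma reflect_reflect: "qf n u \<noteq> (0 :: 'a) \<Longrightarrow> reflect n u (reflect n u v) = v"
  unfolding reflect_def bf_linear by (simp add: add.assoc)

lemma reflect_orthogonal: "bf n v u = (0 :: 'a) \<Longrightarrow> reflect n u v = v"
  by (simp add: reflect_def)

lemma reflect_add: "reflect n u (\<lambda>r. v r + w r :: 'a) = (\<lambda>r. reflect n u v r + reflect n u w r)"
  unfolding reflect_def bf_linear by (simp add: add_divide_distrib algebra_simps)

lemma reflect_scale: "reflect n u (\<lambda>r. c * v r :: 'a) = (\<lambda>r. c * reflect n u v r)"
  unfolding reflect_def bf_linear by (simp add: algebra_simps)

text \<open>For \<open>j \<le> n div 2\<close> this is the orthogonal complement, in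
  \<open>n\<close>-space, of the first \<open>j\<close> standard hyperbolic planes, from which the
  induction peels off one plane at a time.\<close>

definition Sub :: "nat \<Rightarrow> (nat \<Rightarrow> 'a) set" where
  "Sub j = {v. (\<forall>t<j. v t = 0 \<and> v (n div 2 + t) = 0) \<and> (\<forall>r\<ge>n. v r = 0)}"

definition nonsing :: "nat \<Rightarrow> (nat \<Rightarrow> 'a) set" where
  "nonsing j = {u \<in> Sub j. qf n u \<noteq> 0}"

definition act :: "(nat \<Rightarrow> 'a) list \<Rightarrow> (nat \<Rightarrow> 'a) \<Rightarrow> nat \<Rightarrow> 'a" where
  "act us = foldr (reflect n) us"

lemma act_simps [simp]: "act [] v = v" "act (u # us) v = reflect n u (act us v)"
  "act (us @ us') v = act us (act us' v)"
  by (auto simp: act_def)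

lemma act_add: "act us (\<lambda>r. v r + w r) = (\<lambda>r. act us v r + act us w r)"
  by (induction us) (auto simp: reflect_add)

lemma act_scale: "act us (\<lambda>r. c * v r) = (\<lambda>r. c * act us v r)"
  by (induction us) (auto simp: reflect_scale)

lemma qf_act: "set us \<subseteq> nonsing j \<Longrightarrow> qf n (act us v) = qf n v"
  by (induction us) (auto simp: qf_reflect nonsing_def)

lemma bf_act: "set us \<subseteq> nonsing j \<Longrightarrow> bf n (act us v) (act us w) = bf n v w"
  by (induction us) (auto simp: bf_reflect nonsing_def)

lemma act_orthogonal: "(\<And>u. u \<in> set us \<Longrightarrow> bf n v u = 0) \<Longrightarrow> act us v = v"
  by (induction us) (auto simp: reflect_orthogonal)

lemma Sub_add: "v \<in> Sub j \<Longrightarrow> w \<in> Sub j \<Longrightarrow> (\<lambda>r. v r + w r) \<in> Sub j"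
  by (auto simp: Sub_def)

lemma Sub_scale: "v \<in> Sub j \<Longrightarrow> (\<lambda>r. c * v r) \<in> Sub j"
  by (auto simp: Sub_def)

lemma Sub_reflect: "v \<in> Sub j \<Longrightarrow> u \<in> Sub j \<Longrightarrow> reflect n u v \<in> Sub j"
  unfolding reflect_def by (intro Sub_add Sub_scale)

lemma Sub_act: "set us \<subseteq> nonsing j \<Longrightarrow> v \<in> Sub j \<Longrightarrow> act us v \<in> Sub j"
  by (induction us) (auto simp: nonsing_def intro: Sub_reflect)

lemma Sub_Suc: "Sub (Suc j) \<subseteq> Sub j"
  by (auto simp: Sub_def)

lemma nonsing_Suc: "nonsing (Suc j) \<subseteq> nonsing j"
  using Sub_Suc by (auto simp: nonsing_def)

lemma Sub_unit:
  assumes "j \<le> t" "t < n div 2"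
  shows "unit_fun t \<in> Sub j" "unit_fun (n div 2 + t) \<in> Sub j"
  using assms by (auto simp: Sub_def unit_fun_def)

lemma Sub_Suc_iff:
  assumes "j < n div 2"
  shows "v \<in> Sub (Suc j) \<longleftrightarrow> v \<in> Sub j \<and> bf n v (unit_fun j) = 0 \<and> bf n v (unit_fun (n div 2 + j)) = 0"
  using assms by (auto simp: Sub_def bf_unit_low bf_unit_high less_Suc_eq)

section \<open>Moving isotropic vectors and hyperbolic pairs by reflections, after Witt\<close>

lemma isotropic_reflect:
  assumes "v \<in> Sub j" "w \<in> Sub j" "qf n v = 0" "qf n w = 0" "bf n v w \<noteq> 0"
  shows "(\<lambda>r. v r + w r) \<in> nonsing j" "reflect n (\<lambda>r. v r + w r) v = w"
  \<comment> \<open>By isotropy the form of \<open>v + w\<close> equals the pairing of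
    \<open>v\<close> and \<open>w\<close>, so the reflection adds exactly \<open>v + w\<close> to
    \<open>v\<close>, which leaves \<open>w\<close>.\<close>
  using assms by (auto simp: nonsing_def Sub_add qf_add reflect_def bf_linear)

text \<open>For isotropic \<open>e\<close>, a nonzero coordinate in some plane just means that
  \<open>e\<close> is nonzero. If \<open>e\<close> is orthogonal to the target, one goes through an
  isotropic vector that is orthogonal to neither.\<close>

lemma isotropic_to_unit:
  assumes j: "j < n div 2" and e: "e \<in> Sub j" "qf n e = 0"
    and t: "t < n div 2" "e t \<noteq> 0 \<or> e (n div 2 + t) \<noteq> 0"
  obtains us where "set us \<subseteq> nonsing j" "act us e = unit_fun j"
proof -
  note result = that
  let ?\<epsilon> = "unit_fun j :: nat \<Rightarrow> 'a" and ?\<phi> = "unit_fun (n div 2 + j) :: nat \<Rightarrow> 'a"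
  have units: "?\<epsilon> \<in> Sub j" "?\<phi> \<in> Sub j" "qf n ?\<epsilon> = 0" "qf n ?\<phi> = 0" "bf n ?\<phi> ?\<epsilon> = 1" "bf n ?\<epsilon> ?\<phi> = 1"
    using j by (auto simp: Sub_unit qf_unit bf_unit_low bf_unit_high) (auto simp: unit_fun_def)
  have via: thesis if "w \<in> Sub j" "qf n w = 0" "bf n e w \<noteq> 0" "bf n w ?\<epsilon> \<noteq> 0" for w
  proof (rule result)
    show "set [\<lambda>r. w r + ?\<epsilon> r, \<lambda>r. e r + w r] \<subseteq> nonsing j"
      using isotropic_reflect(1) e units that by auto
    show "act [\<lambda>r. w r + ?\<epsilon> r, \<lambda>r. e r + w r] e = ?\<epsilon>"
      using isotropic_reflect(2)[of e j w] isotropic_reflect(2)[of w j ?\<epsilon>] e units that by simp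
  qed
  consider "e (n div 2 + j) \<noteq> 0" | "e (n div 2 + j) = 0" "e j \<noteq> 0" | "e (n div 2 + j) = 0" "e j = 0" by blast
  then show thesis
  proof cases
    case 1
    then have "bf n e ?\<epsilon> \<noteq> 0" using j by (simp add: bf_unit_low)
    then show ?thesis
      using isotropic_reflect[of e j ?\<epsilon>] e units result[of "[\<lambda>r. e r + ?\<epsilon> r]"] by auto
  next
    case 2
    then have "bf n e ?\<phi> \<noteq> 0" using j by (simp add: bf_unit_high)
    then show ?thesis using via[of ?\<phi>] units by simp
  next
    case 3
    then have "t \<noteq> j" using t by auto
    moreover have "\<not> t < j" using t e by (auto simp: Sub_def)
    ultimately have jt: "j < t" by simp
    \<comment> \<open>\<open>w\<close> pairs with \<open>e\<close> but is orthogonal to plane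
      \<open>j\<close>, in which \<open>?\<phi>\<close> pairs with \<open>?\<epsilon>\<close>. The
      sum of \<open>w\<close> and \<open>?\<phi>\<close> is isotropic and pairs with both
      ends.\<close>
    obtain w where w: "w = unit_fun t \<or> w = unit_fun (n div 2 + t)" "bf n e w \<noteq> 0"
      using t by (metis bf_unit_low bf_unit_high)
    then have w': "w \<in> Sub (Suc j)" "qf n w = 0" using t jt Sub_unit[of "Suc j" t] by (auto simp: qf_unit)
    then have w'': "w \<in> Sub j" "bf n w ?\<epsilon> = 0" "bf n w ?\<phi> = 0" using Sub_Suc_iff[OF j] by auto
    have "bf n e ?\<phi> = 0" using 3 j by (simp add: bf_unit_high)
    then show ?thesis
      using via[of "\<lambda>r. w r + ?\<phi> r"] w w' w'' units by (simp add: Sub_add qf_add bf_linear)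
  qed
qed

text \<open>Every vector on the route from \<open>f\<close> to its target pairs to 1 with
  \<open>unit_fun j\<close>. So sums of two of them are orthogonal to \<open>unit_fun j\<close>, and
  the reflections along these sums fix it.\<close>

lemma isotropic_to_unit_fixing:
  assumes inf: "infinite (UNIV :: 'a set)" and j: "j < n div 2"
    and f: "f \<in> Sub j" "qf n f = 0" "bf n f (unit_fun j) = 1"
  obtains us where "set us \<subseteq> nonsing j" "act us (unit_fun j) = unit_fun j"
    "act us f = unit_fun (n div 2 + j)"
proof -
  let ?\<epsilon> = "unit_fun j :: nat \<Rightarrow> 'a" and ?\<phi> = "unit_fun (n div 2 + j) :: nat \<Rightarrow> 'a"
  have units: "?\<epsilon> \<in> Sub j" "?\<phi> \<in> Sub j" "qf n ?\<epsilon> = 0" "qf n ?\<phi> = 0" "bf n ?\<phi> ?\<epsilon> = 1" "bf n ?\<epsilon> ?\<phi> = 1"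
    using j by (auto simp: Sub_unit qf_unit bf_unit_low bf_unit_high) (auto simp: unit_fun_def)
  have f': "bf n ?\<epsilon> f = 1" using f(3) bf_commute by metis
  show thesis
  proof (cases "bf n f ?\<phi> = 0")
    case False
    show ?thesis
    proof (rule that)
      show "set [\<lambda>r. f r + ?\<phi> r] \<subseteq> nonsing j" "act [\<lambda>r. f r + ?\<phi> r] f = ?\<phi>"
        using isotropic_reflect[of f j ?\<phi>] f units False by auto
      show "act [\<lambda>r. f r + ?\<phi> r] ?\<epsilon> = ?\<epsilon>"
        using units f' by (intro act_orthogonal) (auto simp: bf_linear)
    qed
  next
    case True
    define a where "a = (\<lambda>r. f r + ?\<phi> r)"
    have fa: "f = (\<lambda>r. ?\<phi> r + a r)" by (auto simp: a_def add.commute[of "f _"])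
    have a: "a \<in> Sub (Suc j)" "qf n a = 0"
      using f units True unfolding Sub_Suc_iff[OF j] by (auto simp: a_def Sub_add qf_add bf_linear)
    then have aj: "a \<in> Sub j" "bf n a ?\<epsilon> = 0" "bf n a ?\<phi> = 0" using Sub_Suc_iff[OF j] by auto
    show ?thesis
    proof (cases "\<exists>t<n div 2. a t \<noteq> 0 \<or> a (n div 2 + t) \<noteq> 0")
      case False
      \<comment> \<open>With no plane coordinates left, isotropy makes the square of the last
        coordinate vanish.\<close>
      have "a r = 0" for r
      proof -
        consider "r < n div 2" | "n div 2 \<le> r" "r < 2 * (n div 2)" | "r = 2 * (n div 2)" "odd n" | "r \<ge> n"
          by fastforce
        then show ?thesis
        proof cases
          case 2
          then have "r = n div 2 + (r - n div 2)" "r - n div 2 < n div 2" by auto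
          then show ?thesis using False by metis
        next
          case 3
          have "qf n a = (a r)\<^sup>2" using False 3 by (auto simp: qf_def)
          then show ?thesis using a by simp
        qed (use False a in \<open>auto simp: Sub_def\<close>)
      qed
      then have "f = ?\<phi>" using fa by simp
      then show ?thesis using that[of "[]"] by simp
    next
      case True
      then obtain t where t: "t < n div 2" "a t \<noteq> 0 \<or> a (n div 2 + t) \<noteq> 0" by blast
      moreover have "\<not> t < Suc j" using t a by (auto simp: Sub_def)
      ultimately have jt: "j < t" by simp
      obtain w where w: "w = unit_fun t \<or> w = unit_fun (n div 2 + t)" "bf n a w \<noteq> 0"
        using t by (metis bf_unit_low bf_unit_high)
      then have w': "w \<in> Sub (Suc j)" "qf n w = 0" using t jt Sub_unit[of "Suc j" t] by (auto simp: qf_unit)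
      then have wj: "w \<in> Sub j" "bf n w ?\<epsilon> = 0" "bf n w ?\<phi> = 0" using Sub_Suc_iff[OF j] by auto
      \<comment> \<open>The intermediate vector \<open>g\<close> will pair to
        \<open>\<mu> * bf n a w\<close> with the target and to \<open>(\<mu> + 1) * bf n a w\<close>
        with \<open>f\<close>. Both must be nonzero, which takes a field with more than two
        elements.\<close>
      obtain \<mu> :: 'a where \<mu>: "\<mu> \<noteq> 0" "\<mu> \<noteq> 1"
        using infinite_imp_nonempty[of "UNIV - {0, 1 :: 'a}"] inf by auto
      define b where "b = (\<lambda>r. w r + \<mu> * a r)"
      have b: "b \<in> Sub j" "bf n b ?\<epsilon> = 0" "bf n b ?\<phi> = 0" "qf n b = \<mu> * bf n a w" "bf n a b = bf n a w"
        "bf n ?\<epsilon> b = 0" "bf n ?\<phi> b = 0"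
        using aj wj a w' bf_commute[of n ?\<epsilon>] bf_commute[of n ?\<phi>] bf_commute[of n w a]
        by (auto simp: b_def bf_linear Sub_add Sub_scale qf_add qf_scale)
      \<comment> \<open>The multiple of \<open>?\<epsilon>\<close> corrects
        \<open>?\<phi> + b\<close> to an isotropic vector without changing its pairing with
        \<open>?\<epsilon>\<close>.\<close>
      define g where "g = (\<lambda>r. (?\<phi> r + b r) + qf n b * ?\<epsilon> r)"
      have g: "g \<in> Sub j" "qf n g = 0" "bf n g ?\<phi> = qf n b" "bf n g ?\<epsilon> = 1" "bf n ?\<epsilon> g = 1"
        using units b by (auto simp: g_def Sub_add Sub_scale qf_add qf_scale bf_linear power2_eq_square)
      have "bf n a ?\<epsilon> = 0" "bf n ?\<phi> ?\<phi> = 0" using aj by auto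
      then have fg: "bf n f g = qf n b + bf n a w"
        using units b aj by (simp add: fa g_def bf_linear)
      have "bf n f g = (\<mu> + 1) * bf n a w" using fg b by (simp add: algebra_simps)
      moreover have "\<mu> + 1 \<noteq> 0" using \<mu> by (simp add: add_eq_0)
      ultimately have fg0: "bf n f g \<noteq> 0" using w by simp
      have gphi: "bf n g ?\<phi> \<noteq> 0" using g b \<mu> w by simp
      show ?thesis
      proof (rule that)
        show "set [\<lambda>r. g r + ?\<phi> r, \<lambda>r. f r + g r] \<subseteq> nonsing j"
          using isotropic_reflect(1) f units g fg0 gphi by auto
        show "act [\<lambda>r. g r + ?\<phi> r, \<lambda>r. f r + g r] f = ?\<phi>"
          using isotropic_reflect(2)[of f j g] isotropic_reflect(2)[of g j ?\<phi>] f units g fg0 gphi by simp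
        show "act [\<lambda>r. g r + ?\<phi> r, \<lambda>r. f r + g r] ?\<epsilon> = ?\<epsilon>"
          using units f' g by (intro act_orthogonal) (auto simp: bf_linear)
      qed
    qed
  qed
qed

end

section \<open>Divisibility and quadratic equations in a valuation ring\<close>

lemma valuation_subring_minimal:
  fixes S :: "'a::field set"
  assumes V: "valuation_subring V" and "finite S" "S \<noteq> {}"
  shows "\<exists>\<delta>\<in>S. \<forall>x\<in>S. \<exists>c\<in>V. x = c * \<delta>"
  using assms(2,3)
proof (induction S rule: finite_ne_induct)
  case (singleton x)
  then show ?case using V by (auto simp: valuation_subring_def intro!: bexI[of _ 1] subring_closed)
next
  case (insert y S)
  have R: "is_subring V" using V by (simp add: valuation_subring_def)
  from insert obtain \<delta> where \<delta>: "\<delta> \<in> S" "\<forall>x\<in>S. \<exists>c\<in>V. x = c * \<delta>" by blast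
  show ?case
  proof (cases "\<exists>c\<in>V. y = c * \<delta>")
    case True
    then show ?thesis using \<delta> by blast
  next
    case False
    have y0: "y \<noteq> 0" using False subring_closed(2)[OF R] by force
    have "\<exists>c\<in>V. \<delta> = c * y"
    proof (cases "\<delta> = 0")
      case True
      then show ?thesis using subring_closed(2)[OF R] by force
    next
      case \<delta>0: False
      have "y / \<delta> \<notin> V" using False \<delta>0 by force
      then have "inverse (y / \<delta>) \<in> V" using V by (auto simp: valuation_subring_def)
      then show ?thesis using y0 by (intro bexI[of _ "inverse (y / \<delta>)"]) auto
    qed
    then obtain c where c: "c \<in> V" "\<delta> = c * y" by blast
    have "\<exists>c\<in>V. x = c * y" if xS: "x \<in> S" for x
    proof -
      obtain d where "d \<in> V" "x = d * \<delta>" using bspec[OF \<delta>(2) xS] by metis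
      then show ?thesis using c subring_closed(4)[OF R] by (intro bexI[of _ "d * c"]) auto
    qed
    moreover have "\<exists>c\<in>V. y = c * y" using subring_closed(1)[OF R] by force
    ultimately show ?thesis by blast
  qed
qed

lemma valuation_subring_common_denominator:
  fixes S :: "'a::field set"
  assumes V: "valuation_subring V" and "finite S"
  shows "\<exists>c. c \<noteq> 0 \<and> (\<forall>x\<in>S. c * x \<in> V)"
proof -
  have R: "is_subring V" using V by (simp add: valuation_subring_def)
  obtain c where c: "c \<noteq> 0" "\<And>x. x \<in> S \<Longrightarrow> c * x \<in> V"
    using assms(2)
  proof (induction S arbitrary: thesis)
    case empty
    then show ?case by (metis empty_iff zero_neq_one)
  next
    case (insert x S)
    obtain c where c: "c \<noteq> 0" "\<And>x. x \<in> S \<Longrightarrow> c * x \<in> V" using insert.IH by blast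
    show ?case
    proof (cases "c * x \<in> V")
      case True
      then show ?thesis using insert.prems c by blast
    next
      case False
      \<comment> \<open>This element of \<open>V\<close> rescales the new product
        \<open>c * x\<close> to 1 and keeps the earlier products in \<open>V\<close>.\<close>
      let ?d = "inverse (c * x)"
      have d: "?d \<in> V" using V False by (auto simp: valuation_subring_def)
      have "c * x \<noteq> 0" using False subring_closed(2)[OF R] by auto
      then have "?d * c \<noteq> 0" by simp
      moreover have "?d * c * y \<in> V" if "y \<in> S" for y
        using subring_closed(4)[OF R d c(2)[OF that]] by (simp add: mult.assoc)
      moreover have "?d * c * x \<in> V"
        using \<open>c * x \<noteq> 0\<close> subring_closed(1)[OF R] by (metis left_inverse mult.assoc)
      ultimately show ?thesis using insert.prems by blast
    qed
  qed
  then show ?thesis by blast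
qed

lemma valuation_subring_root:
  assumes V: "valuation_subring V" and x: "x\<^sup>2 \<in> V"
  shows "x \<in> V"
proof (rule ccontr)
  assume "x \<notin> V"
  then have "inverse x \<in> V" "x \<noteq> 0" using V subring_closed(2)[of V] by (auto simp: valuation_subring_def)
  then have "x\<^sup>2 * inverse x \<in> V" using x V by (auto simp: valuation_subring_def intro: subring_closed)
  moreover have "x\<^sup>2 * inverse x = x" using \<open>x \<noteq> 0\<close> by (simp add: power2_eq_square)
  ultimately show False using \<open>x \<notin> V\<close> by simp
qed

text \<open>A root or its inverse lies in \<open>V\<close>, and the inverse solves the reversed
  quadratic. With \<open>\<alpha>\<close> and \<open>\<gamma>\<close> the forms of \<open>u\<close>
  and \<open>w\<close> and \<open>\<delta>\<close> their pairing, a root \<open>r\<close> makes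
  \<open>w + r u\<close> isotropic; reversing means exchanging \<open>u\<close> and
  \<open>w\<close>.\<close>

lemma quadratic_root_or_inverse:
  fixes \<alpha> \<delta> \<gamma> :: "'a::alg_closed_field"
  assumes V: "valuation_subring V" and \<delta>: "\<delta> \<noteq> 0"
  shows "(\<exists>r\<in>V. \<alpha> * r\<^sup>2 + \<delta> * r + \<gamma> = 0) \<or> (\<exists>r\<in>V. \<gamma> * r\<^sup>2 + \<delta> * r + \<alpha> = 0)"
proof (cases "\<alpha> = 0")
  case True
  then show ?thesis using V subring_closed(2)[of V]
    by (intro disjI2 bexI[of _ 0]) (auto simp: valuation_subring_def)
next
  case False
  obtain r where "(\<Sum>k\<le>2. [\<gamma>, \<delta>, \<alpha>] ! k * r ^ k) = 0"
    using alg_closed[of 2 "\<lambda>k. [\<gamma>, \<delta>, \<alpha>] ! k"] False by auto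
  then have r: "\<alpha> * r\<^sup>2 + \<delta> * r + \<gamma> = 0" by (simp add: numeral_2_eq_2 algebra_simps)
  show ?thesis
  proof (cases "r \<in> V")
    case True
    then show ?thesis using r by blast
  next
    case False
    then have ir: "inverse r \<in> V" "r \<noteq> 0" using V subring_closed(2)[of V] by (auto simp: valuation_subring_def)
    have "\<gamma> * (inverse r)\<^sup>2 + \<delta> * inverse r + \<alpha> = (\<alpha> * r\<^sup>2 + \<delta> * r + \<gamma>) * (inverse r)\<^sup>2"
      using ir(2) by (simp add: field_simps power2_eq_square)
    then show ?thesis using r ir by auto
  qed
qed

section \<open>Moving form-integral lattices into the standard lattice\<close>

context char2
begin

text \<open>\<open>M\<close> stands for the \<open>V\<close>-lattice that it generates: integrality
  of both forms on generators passes to all combinations.\<close>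

definition form_integral :: "'a set \<Rightarrow> nat \<Rightarrow> (nat \<Rightarrow> 'a) set \<Rightarrow> bool" where
  "form_integral V j M \<longleftrightarrow> finite M \<and> M \<subseteq> Sub j \<and> (\<forall>v\<in>M. qf n v \<in> V) \<and> (\<forall>v\<in>M. \<forall>w\<in>M. bf n v w \<in> V)"

definition movable :: "'a set \<Rightarrow> nat \<Rightarrow> (nat \<Rightarrow> 'a) set \<Rightarrow> bool" where
  "movable V j M \<longleftrightarrow> (\<exists>us. set us \<subseteq> nonsing j \<and> (\<forall>v\<in>M. \<forall>r. act us v r \<in> V))"

text \<open>The plane of \<open>u\<close> and \<open>w\<close> splits off the lattice because
  \<open>bf n u w\<close> divides all pairings. From it one forms a hyperbolic pair
  \<open>f\<close>, \<open>e\<close>, which is moved to a standard pair. \<open>f\<close> itself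
  need not lie in the lattice, but \<open>w'\<close> and \<open>u\<close> do; they are
  \<open>\<delta> f\<close> and \<open>e + \<alpha> f\<close>, so their images are integral. The
  projections of \<open>M\<close> off the plane are left to the induction.\<close>

lemma movable_split:
  assumes V: "is_subring V" and inf: "infinite (UNIV :: 'a set)" and j: "j < n div 2"
    and IH: "\<And>M. form_integral V (Suc j) M \<Longrightarrow> movable V (Suc j) M"
    and M: "form_integral V j M" and uM: "u \<in> M" and wM: "w \<in> M" and \<delta>: "bf n u w \<noteq> 0"
    and min: "\<And>v v'. v \<in> M \<Longrightarrow> v' \<in> M \<Longrightarrow> bf n v v' / bf n u w \<in> V"
    and r: "r \<in> V" "qf n u * r\<^sup>2 + bf n u w * r + qf n w = 0"
  shows "movable V j M"
proof -
  let ?\<epsilon> = "unit_fun j :: nat \<Rightarrow> 'a" and ?\<phi> = "unit_fun (n div 2 + j) :: nat \<Rightarrow> 'a"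
  define \<delta> where "\<delta> = bf n u w"
  define \<alpha> where "\<alpha> = qf n u"
  define w' where "w' = (\<lambda>i. w i + r * u i)"
  define f where "f = (\<lambda>i. inverse \<delta> * w' i)"
  define e where "e = (\<lambda>i. u i + \<alpha> * f i)"
  have \<delta>0: "\<delta> \<noteq> 0" using assms by (simp add: \<delta>_def)
  have Mj: "finite M" "\<And>v. v \<in> M \<Longrightarrow> v \<in> Sub j" "\<And>v. v \<in> M \<Longrightarrow> qf n v \<in> V"
    "\<And>v w. v \<in> M \<Longrightarrow> w \<in> M \<Longrightarrow> bf n v w \<in> V" using M by (auto simp: form_integral_def)
  have \<alpha>V: "\<alpha> \<in> V" and \<delta>V: "\<delta> \<in> V" using Mj uM wM by (auto simp: \<alpha>_def \<delta>_def)
  have qw': "qf n w' = 0"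
    using r(2) by (simp add: w'_def qf_add qf_scale bf_linear bf_commute[of n w u] algebra_simps)
  have uw': "bf n u w' = \<delta>" "bf n w' u = \<delta>"
    by (auto simp: w'_def bf_linear \<delta>_def bf_commute[of n w u])
  have w'j: "w' \<in> Sub j" using Mj uM wM by (simp add: w'_def Sub_add Sub_scale)
  have fj: "f \<in> Sub j" "qf n f = 0" "bf n u f = 1" "bf n f u = 1"
    using w'j \<delta>0 qw' uw' by (auto simp: f_def Sub_scale qf_scale bf_linear)
  have ej: "e \<in> Sub j" "qf n e = 0" "bf n e f = 1" "bf n f e = 1"
    using fj Mj uM by (auto simp: e_def Sub_add Sub_scale qf_add qf_scale bf_linear \<alpha>_def)
  have "\<exists>t<n div 2. f t \<noteq> 0 \<or> f (n div 2 + t) \<noteq> 0"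
  proof (rule ccontr)
    assume "\<not> ?thesis"
    then have "bf n u f = 0" by (auto simp: bf_def intro!: sum.neutral)
    then show False using fj by simp
  qed
  then obtain us1 where us1: "set us1 \<subseteq> nonsing j" "act us1 f = ?\<epsilon>"
    using isotropic_to_unit[OF j fj(1,2)] by metis
  define e1 where "e1 = act us1 e"
  have e1: "e1 \<in> Sub j" "qf n e1 = 0" "bf n e1 ?\<epsilon> = 1"
    using ej us1 Sub_act qf_act bf_act[OF us1(1), of e f] by (auto simp: e1_def)
  obtain us2 where us2: "set us2 \<subseteq> nonsing j" "act us2 ?\<epsilon> = ?\<epsilon>" "act us2 e1 = ?\<phi>"
    using isotropic_to_unit_fixing[OF inf j e1] by metis
  define g where "g = act (us2 @ us1)"
  have gs: "set (us2 @ us1) \<subseteq> nonsing j" using us1 us2 by simp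
  have gf: "g f = ?\<epsilon>" and ge: "g e = ?\<phi>" using us1 us2 by (auto simp: g_def e1_def)
  \<comment> \<open>Orthogonal projection off the plane. As the form is alternating, the basis dual
    to \<open>u\<close>, \<open>w'\<close> is \<open>w'\<close>, \<open>u\<close> divided by
    \<open>\<delta>\<close>; minimality puts the coefficients into \<open>V\<close>.\<close>
  define p where "p v = (\<lambda>i. (v i + bf n v w' / \<delta> * u i) + bf n v u / \<delta> * w' i)" for v
  have coef: "bf n v w' / \<delta> \<in> V" "bf n v u / \<delta> \<in> V" if v: "v \<in> M" for v
  proof -
    show "bf n v u / \<delta> \<in> V" using min[OF v uM] by (simp add: \<delta>_def)
    have "bf n v w' / \<delta> = bf n v w / \<delta> + r * (bf n v u / \<delta>)"
      by (simp add: w'_def bf_linear add_divide_distrib)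
    moreover have "bf n v w / \<delta> + r * (bf n v u / \<delta>) \<in> V"
      unfolding \<delta>_def by (intro subring_closed(4,6)[OF V] min v wM uM r(1))
    ultimately show "bf n v w' / \<delta> \<in> V" by simp
  qed
  have p_orth: "bf n (p v) w' = 0" "bf n (p v) u = 0" for v
    using \<delta>0 unfolding p_def bf_linear by (simp_all add: uw' add.assoc)
  have p_orth': "bf n w' (p v) = 0" "bf n u (p v) = 0" for v
    using p_orth bf_commute by metis+
  have p_bf: "bf n (p v) (p v') = bf n v v' + (bf n v' w' / \<delta>) * bf n v u + (bf n v' u / \<delta>) * bf n v w'" for v v'
  proof -
    have "bf n (p v) (p v') = bf n v (p v')"
      by (subst (1) p_def) (simp add: bf_linear p_orth' del: times_divide_eq_left)
    then show ?thesis by (simp add: p_def[of v'] bf_linear del: times_divide_eq_left)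
  qed
  \<comment> \<open>In this grouping each factor visibly lies in \<open>V\<close>; the two terms
    left over are equal and cancel.\<close>
  have p_qf: "qf n (p v) = qf n v + (bf n v w' / \<delta>)\<^sup>2 * \<alpha> + (bf n v w' / \<delta>) * bf n v u" for v
  proof -
    have "qf n (p v) = (qf n v + (bf n v w' / \<delta>)\<^sup>2 * \<alpha> + (bf n v w' / \<delta>) * bf n v u)
       + ((bf n v u / \<delta>) * bf n v w' + (bf n v u / \<delta>) * ((bf n v w' / \<delta>) * \<delta>))"
      unfolding p_def qf_add qf_scale bf_linear by (simp add: qw' uw' \<alpha>_def algebra_simps del: times_divide_eq_left)
    also have "(bf n v w' / \<delta>) * \<delta> = bf n v w'" using \<delta>0 by simp
    finally show ?thesis by simp
  qed
  have bw': "bf n v w' \<in> V" if "v \<in> M" for v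
    using Mj(4)[OF that uM] Mj(4)[OF that wM] r(1) by (simp add: w'_def bf_linear subring_closed[OF V])
  have pj: "p v \<in> Sub j" if "v \<in> M" for v
    unfolding p_def using Mj that uM w'j by (intro Sub_add Sub_scale) auto
  have "form_integral V (Suc j) ((\<lambda>v. g (p v)) ` M)"
    unfolding form_integral_def
  proof (intro conjI)
    show "finite ((\<lambda>v. g (p v)) ` M)" using Mj by simp
    show "(\<lambda>v. g (p v)) ` M \<subseteq> Sub (Suc j)"
    proof
      fix x assume "x \<in> (\<lambda>v. g (p v)) ` M"
      then obtain v where v: "v \<in> M" "x = g (p v)" by auto
      have "bf n (p v) f = 0" "bf n (p v) e = 0"
        using p_orth by (auto simp: e_def f_def bf_linear)
      then have "bf n x ?\<epsilon> = 0" "bf n x ?\<phi> = 0"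
        unfolding v gf[symmetric] ge[symmetric] unfolding g_def bf_act[OF gs] by auto
      moreover have "x \<in> Sub j" using v pj Sub_act[OF gs] by (simp add: g_def)
      ultimately show "x \<in> Sub (Suc j)" using Sub_Suc_iff[OF j] by simp
    qed
    show "\<forall>v\<in>(\<lambda>v. g (p v)) ` M. qf n v \<in> V"
    proof clarify
      fix v assume v: "v \<in> M"
      have "qf n (p v) \<in> V" unfolding p_qf
        by (intro subring_closed(4,6)[OF V] subring_power[OF V] Mj coef v uM \<alpha>V)
      then show "qf n (g (p v)) \<in> V" unfolding g_def qf_act[OF gs] .
    qed
    show "\<forall>v\<in>(\<lambda>v. g (p v)) ` M. \<forall>w\<in>(\<lambda>v. g (p v)) ` M. bf n v w \<in> V"
    proof clarify
      fix v v' assume v: "v \<in> M" "v' \<in> M"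
      have "bf n (p v) (p v') \<in> V" unfolding p_bf
        by (intro subring_closed(4,6)[OF V] Mj coef v uM bw')
      then show "bf n (g (p v)) (g (p v')) \<in> V" unfolding g_def bf_act[OF gs] .
    qed
  qed
  then obtain us3 where us3: "set us3 \<subseteq> nonsing (Suc j)" "\<And>v r. v \<in> M \<Longrightarrow> act us3 (g (p v)) r \<in> V"
    using IH unfolding movable_def by blast
  have us3': "set us3 \<subseteq> nonsing j" using us3 nonsing_Suc by blast
  \<comment> \<open>The later reflections are along vectors orthogonal to this plane, so its
    standard pair stays in place.\<close>
  have fix3: "act us3 ?\<epsilon> = ?\<epsilon>" "act us3 ?\<phi> = ?\<phi>"
  proof -
    have "bf n ?\<epsilon> x = 0 \<and> bf n ?\<phi> x = 0" if "x \<in> set us3" for x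
    proof -
      have "x \<in> Sub (Suc j)" using that us3 by (auto simp: nonsing_def)
      then show ?thesis unfolding Sub_Suc_iff[OF j] using bf_commute by metis
    qed
    then show "act us3 ?\<epsilon> = ?\<epsilon>" "act us3 ?\<phi> = ?\<phi>" by (auto intro!: act_orthogonal)
  qed
  have unitV: "unit_fun i r \<in> V" for i r using subring_closed(1,2)[OF V] by (simp add: unit_fun_def)
  define h where "h = act (us3 @ us2 @ us1)"
  have h: "h v = act us3 (g v)" for v by (simp add: h_def g_def)
  have w'f: "w' = (\<lambda>i. \<delta> * f i)" using \<delta>0 by (simp add: f_def fun_eq_iff)
  have hw': "h w' i \<in> V" for i
  proof -
    have "h w' = (\<lambda>i. \<delta> * ?\<epsilon> i)" unfolding w'f h g_def act_scale unfolding g_def[symmetric] gf fix3 ..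
    then show ?thesis using unitV \<delta>V by (simp add: subring_closed[OF V])
  qed
  have hu: "h u i \<in> V" for i
  proof -
    have ue: "u = (\<lambda>i. e i + \<alpha> * f i)" by (simp add: e_def fun_eq_iff add.assoc)
    have "h u = (\<lambda>i. ?\<phi> i + \<alpha> * ?\<epsilon> i)"
      unfolding h ue g_def act_scale act_add unfolding g_def[symmetric] gf ge fix3 ..
    then show ?thesis using unitV \<alpha>V by (simp add: subring_closed[OF V])
  qed
  have "h v i \<in> V" if v: "v \<in> M" for v i
  proof -
    have vp: "v = (\<lambda>i. (p v i + bf n v w' / \<delta> * u i) + bf n v u / \<delta> * w' i)"
      by (simp add: p_def fun_eq_iff ac_simps del: times_divide_eq_left)
    have hp: "h (p v) i \<in> V" using us3(2)[OF v] by (simp add: h)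
    have "h v i = (h (p v) i + bf n v w' / \<delta> * h u i) + bf n v u / \<delta> * h w' i"
      by (subst (1) vp) (simp only: h_def act_add act_scale)
    also have "\<dots> \<in> V" by (intro subring_closed(4,6)[OF V] hp hu hw' coef[OF v])
    finally show ?thesis .
  qed
  moreover have "set (us3 @ us2 @ us1) \<subseteq> nonsing j" using us1 us2 us3' by simp
  ultimately show ?thesis unfolding movable_def h_def by blast
qed

end

text \<open>The plane to split off is not that of the given pair but that of a pair with minimal
  valuation of the pairing; the quadratic decides which of the two vectors plays the role of
  \<open>u\<close>.\<close>

lemma (in char2) movable_step:
  assumes V: "valuation_subring V" and root: "\<And>\<alpha> \<delta> \<gamma> :: 'a. \<delta> \<noteq> 0 \<Longrightarrow>
      (\<exists>r\<in>V. \<alpha> * r\<^sup>2 + \<delta> * r + \<gamma> = 0) \<or> (\<exists>r\<in>V. \<gamma> * r\<^sup>2 + \<delta> * r + \<alpha> = 0)"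
    and inf: "infinite (UNIV :: 'a set)" and j: "j < n div 2"
    and IH: "\<And>M. form_integral V (Suc j) M \<Longrightarrow> movable V (Suc j) M"
    and M: "form_integral V j M" and "u \<in> M" "w \<in> M" "bf n u w \<noteq> 0"
  shows "movable V j M"
proof -
  have R: "is_subring V" using V by (simp add: valuation_subring_def)
  let ?S = "(\<lambda>(v, v'). bf n v v') ` (M \<times> M)"
  have "finite ?S" "?S \<noteq> {}" using assms by (auto simp: form_integral_def)
  from valuation_subring_minimal[OF V this]
  obtain \<delta> where \<delta>: "\<delta> \<in> ?S" "\<forall>x\<in>?S. \<exists>c\<in>V. x = c * \<delta>" by blast
  then obtain a b where ab: "a \<in> M" "b \<in> M" "\<delta> = bf n a b" by auto
  have min: "\<exists>c\<in>V. bf n v v' = c * \<delta>" if "v \<in> M" "v' \<in> M" for v v'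
    using bspec[OF \<delta>(2), of "bf n v v'"] that by auto
  then have \<delta>0: "\<delta> \<noteq> 0" using assms by force
  have div: "bf n v v' / bf n a b \<in> V" "bf n v v' / bf n b a \<in> V" if "v \<in> M" "v' \<in> M" for v v'
    using min[OF that] \<delta>0 by (auto simp: ab bf_commute[of n b a])
  from root[of "bf n a b" "qf n a" "qf n b"] \<delta>0 ab
  consider r where "r \<in> V" "qf n a * r\<^sup>2 + bf n a b * r + qf n b = 0"
    | r where "r \<in> V" "qf n b * r\<^sup>2 + bf n b a * r + qf n a = 0"
    by (auto simp: bf_commute[of n b a])
  then show ?thesis
  proof cases
    case 1
    then show ?thesis using movable_split[OF R inf j IH M ab(1,2) _ div(1)] \<delta>0 ab by blast
  next
    case 2
    then show ?thesis
      using movable_split[OF R inf j IH M ab(2,1) _ div(2)] \<delta>0 ab bf_commute[of n b a] by metis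
  qed
qed

lemma (in char2) movable_aux:
  assumes V: "valuation_subring V" and root: "\<And>\<alpha> \<delta> \<gamma> :: 'a. \<delta> \<noteq> 0 \<Longrightarrow>
      (\<exists>r\<in>V. \<alpha> * r\<^sup>2 + \<delta> * r + \<gamma> = 0) \<or> (\<exists>r\<in>V. \<gamma> * r\<^sup>2 + \<delta> * r + \<alpha> = 0)"
    and inf: "infinite (UNIV :: 'a set)"
    and IH: "\<And>M. j < n div 2 \<Longrightarrow> form_integral V (Suc j) M \<Longrightarrow> movable V (Suc j) M"
    and M: "form_integral V j M"
  shows "movable V j M"
proof -
  have R: "is_subring V" using V by (simp add: valuation_subring_def)
  have low: "j \<le> t" if "v \<in> M" "v t \<noteq> 0 \<or> v (n div 2 + t) \<noteq> 0" for v t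
    using M that by (force simp: form_integral_def Sub_def not_less)
  have nonzero: "\<exists>t<n div 2. v t \<noteq> 0 \<or> v (n div 2 + t) \<noteq> 0" if "bf n v w \<noteq> 0" for v w
  proof (rule ccontr)
    assume "\<not> ?thesis"
    then have "bf n v w = 0" by (auto simp: bf_def intro!: sum.neutral)
    then show False using that by simp
  qed
  show ?thesis
  proof (cases "\<exists>v\<in>M. \<exists>t<n div 2. v t \<noteq> 0 \<or> v (n div 2 + t) \<noteq> 0")
    case False
    have "act [] v r \<in> V" if v: "v \<in> M" for v r
    proof -
      have M': "v \<in> Sub j" "qf n v \<in> V" using M v by (auto simp: form_integral_def)
      consider "r < n div 2" | "n div 2 \<le> r" "r < 2 * (n div 2)" | "r = 2 * (n div 2)" "odd n" | "r \<ge> n"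
        by fastforce
      then show ?thesis
      proof cases
        case 2
        then have "r = n div 2 + (r - n div 2)" "r - n div 2 < n div 2" by auto
        then show ?thesis using False v subring_closed(2)[OF R] by (metis act_simps(1))
      next
        case 3
        \<comment> \<open>The form controls only the square of the last coordinate; a valuation ring
          contains square roots of its elements.\<close>
        have "qf n v = (v r)\<^sup>2" using False 3 v by (auto simp: qf_def)
        then show ?thesis using M'(2) valuation_subring_root[OF V] by simp
      qed (use False M'(1) v subring_closed(2)[OF R] in \<open>auto simp: Sub_def\<close>)
    qed
    then show ?thesis unfolding movable_def by (intro exI[of _ "[]"]) simp
  next
    case True
    then obtain v t where v: "v \<in> M" and t: "t < n div 2" "v t \<noteq> 0 \<or> v (n div 2 + t) \<noteq> 0" by blast
    have jt: "j \<le> t" using low[OF v t(2)] .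
    then have j: "j < n div 2" using t by simp
    show ?thesis
    proof (cases "\<exists>u\<in>M. \<exists>w\<in>M. bf n u w \<noteq> 0")
      case True
      then show ?thesis using movable_step[OF V root inf j IH[OF j] M] by blast
    next
      case False
      obtain x where x: "x = unit_fun t \<or> x = unit_fun (n div 2 + t)" "bf n v x \<noteq> 0"
        using t by (metis bf_unit_low bf_unit_high)
      then have x': "x \<in> Sub j" "qf n x = 0" using t jt Sub_unit[of j t] by (auto simp: qf_unit)
      have fin: "finite ((\<lambda>v'. bf n v' x) ` M)" using M by (simp add: form_integral_def)
      obtain c where c: "c \<noteq> 0" "\<And>v'. v' \<in> M \<Longrightarrow> c * bf n v' x \<in> V"
        using valuation_subring_common_denominator[OF V fin] by blast
      \<comment> \<open>If all pairings in \<open>M\<close> vanish, there is no plane to split off.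
        A basis vector that pairs with \<open>v\<close>, scaled until its pairings with
        \<open>M\<close> lie in \<open>V\<close>, creates one; moving the larger set moves
        \<open>M\<close>.\<close>
      let ?x = "\<lambda>i. c * x i"
      have b1: "bf n v' ?x \<in> V" "bf n ?x v' \<in> V" if "v' \<in> M" for v'
        using c(2)[OF that] bf_commute[of n x v'] by (simp_all add: bf_linear)
      have b2: "qf n ?x \<in> V" "bf n ?x ?x \<in> V" using x' subring_closed(2)[OF R] by (simp_all add: qf_scale)
      have "form_integral V j (insert ?x M)"
        using M x' b1 b2 unfolding form_integral_def by (simp add: Sub_scale)
      moreover have "bf n v ?x \<noteq> 0" using x(2) c(1) by (simp add: bf_linear)
      ultimately have "movable V j (insert ?x M)"
        using v by (intro movable_step[OF V root inf j IH[OF j], where u = v and w = ?x]) auto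
      then show ?thesis unfolding movable_def by (meson insertI2)
    qed
  qed
qed

lemma (in char2) movable_all:
  assumes V: "valuation_subring V" and root: "\<And>\<alpha> \<delta> \<gamma> :: 'a. \<delta> \<noteq> 0 \<Longrightarrow>
      (\<exists>r\<in>V. \<alpha> * r\<^sup>2 + \<delta> * r + \<gamma> = 0) \<or> (\<exists>r\<in>V. \<gamma> * r\<^sup>2 + \<delta> * r + \<alpha> = 0)"
    and inf: "infinite (UNIV :: 'a set)" and "form_integral V 0 M"
  shows "movable V 0 M"
proof -
  have "form_integral V j M \<Longrightarrow> movable V j M" if "j \<le> n div 2" for j M
    using that
  proof (induction j arbitrary: M rule: inc_induct)
    \<comment> \<open>At \<open>j = n div 2\<close> no plane is left, and the induction premise is
      void.\<close>
    case base
    show ?case by (rule movable_aux[OF V root inf _ base]) auto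
  next
    case (step j)
    show ?case by (rule movable_aux[OF V root inf step.IH step.prems])
  qed
  then show ?thesis using assms by blast
qed

section \<open>Graded pieces and evaluation of polynomials\<close>

abbreviation "keys \<equiv> Poly_Mapping.keys"
abbreviation "lookup \<equiv> Poly_Mapping.lookup"

lemma mpoly_expand: "f = (\<Sum>a\<in>keys f. Poly_Mapping.single a (lookup f a))"
  by (rule poly_mapping_eqI)
    (simp add: lookup_sum lookup_single when_def in_keys_iff if_distrib cong: if_cong)

lemma mpoly_induct:
  fixes f :: "'a \<Rightarrow>\<^sub>0 'b::comm_monoid_add"
  assumes "\<And>a c. a \<in> keys f \<Longrightarrow> P (Poly_Mapping.single a c)" "P 0" "\<And>g h. P g \<Longrightarrow> P h \<Longrightarrow> P (g + h)"
  shows "P f"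
proof -
  have "finite S \<Longrightarrow> S \<subseteq> keys f \<Longrightarrow> P (\<Sum>a\<in>S. Poly_Mapping.single a (lookup f a))" for S
    by (induction S rule: finite_induct) (auto intro: assms)
  then show ?thesis using mpoly_expand[of f] by (metis finite_keys order_refl)
qed

text \<open>Selection by an arbitrary set of monomials covers homogeneous parts as well as parts
  restricted both in degree and to given variables.\<close>

definition part :: "'a set \<Rightarrow> ('a \<Rightarrow>\<^sub>0 'b::zero) \<Rightarrow> 'a \<Rightarrow>\<^sub>0 'b" where
  "part T f = Abs_poly_mapping (\<lambda>a. if a \<in> T then lookup f a else 0)"

lemma lookup_part: "lookup (part T f) a = (if a \<in> T then lookup f a else 0)"
proof -
  have "finite {a. (if a \<in> T then lookup f a else 0) \<noteq> 0}"
    by (rule finite_subset[OF _ finite_keys[of f]]) (auto simp: in_keys_iff split: if_splits)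
  then show ?thesis by (simp add: part_def)
qed

lemma keys_part: "keys (part T f) = keys f \<inter> T"
  by (auto simp: in_keys_iff lookup_part split: if_splits)

lemma part_zero [simp]: "part T 0 = 0"
  by (rule poly_mapping_eqI) (simp add: lookup_part)

lemma part_add: "part T (f + g) = part T f + part T g"
  by (rule poly_mapping_eqI) (simp add: lookup_part lookup_add)

lemma part_single: "part T (Poly_Mapping.single a c) = (if a \<in> T then Poly_Mapping.single a c else 0)"
  by (rule poly_mapping_eqI) (auto simp: lookup_part lookup_single when_def)

lemma part_id: "keys f \<subseteq> T \<Longrightarrow> part T f = f"
  by (rule poly_mapping_eqI) (auto simp: lookup_part in_keys_iff)

lemma part_disjoint: "keys f \<inter> T = {} \<Longrightarrow> part T f = 0"
  by (rule poly_mapping_eqI) (auto simp: lookup_part in_keys_iff)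

lemma part_mult:
  fixes g h :: "'a::monoid_add \<Rightarrow>\<^sub>0 'b::semiring_0"
  assumes "\<And>a b. a \<in> keys g \<Longrightarrow> a + b \<in> T \<longleftrightarrow> b \<in> T'"
  shows "part T (g * h) = g * part T' h"
proof (rule mpoly_induct[of h])
  fix b d
  show "part T (g * Poly_Mapping.single b d) = g * part T' (Poly_Mapping.single b d)"
    by (rule mpoly_induct[of g]) (auto simp: mult_single part_single assms part_add distrib_right)
qed (auto simp: part_add distrib_left)

definition mdeg :: "('x \<Rightarrow>\<^sub>0 nat) \<Rightarrow> nat" where
  "mdeg a = sum (lookup a) (keys a)"

lemma mdeg_superset: "finite S \<Longrightarrow> keys a \<subseteq> S \<Longrightarrow> mdeg a = sum (lookup a) S"
  unfolding mdeg_def by (rule sum.mono_neutral_left) (auto simp: in_keys_iff)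

lemma mdeg_zero [simp]: "mdeg 0 = 0"
  by (simp add: mdeg_def)

lemma mdeg_single [simp]: "mdeg (Poly_Mapping.single x n) = n"
  by (simp add: mdeg_def)

lemma keys_add_nat: "keys (a + b :: 'x \<Rightarrow>\<^sub>0 nat) = keys a \<union> keys b"
  by (auto simp: in_keys_iff lookup_add)

lemma mdeg_add [simp]: "mdeg (a + b) = mdeg a + mdeg b"
  using mdeg_superset[of "keys a \<union> keys b" a] mdeg_superset[of "keys a \<union> keys b" b]
    mdeg_superset[of "keys a \<union> keys b" "a + b"] by (simp add: keys_add_nat lookup_add sum.distrib)

lemma lookup_le_mdeg: "lookup a x \<le> mdeg a"
proof (cases "x \<in> keys a")
  case True
  then show ?thesis unfolding mdeg_def by (intro member_le_sum) auto
qed (simp add: in_keys_iff)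

abbreviation homog_part :: "nat \<Rightarrow> ('x, 'k::zero) mpolynomial \<Rightarrow> ('x, 'k) mpolynomial" where
  "homog_part d \<equiv> part {a. mdeg a = d}"

definition homogeneous :: "nat \<Rightarrow> ('x, 'k::zero) mpolynomial \<Rightarrow> bool" where
  "homogeneous d f \<longleftrightarrow> (\<forall>a\<in>keys f. mdeg a = d)"

lemma homogeneous_part [simp]: "homogeneous d (homog_part d f)"
  by (auto simp: homogeneous_def keys_part)

lemma homog_part_id: "homogeneous d f \<Longrightarrow> homog_part d f = f"
  by (rule part_id) (auto simp: homogeneous_def)

lemma homog_part_other: "homogeneous d f \<Longrightarrow> e \<noteq> d \<Longrightarrow> homog_part e f = 0"
  by (rule part_disjoint) (auto simp: homogeneous_def)

lemma homogeneous_zero [simp]: "homogeneous d 0"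
  by (simp add: homogeneous_def)

lemma homogeneous_one: "homogeneous 0 (1 :: ('x, 'k::zero_neq_one) mpolynomial)"
  by (simp add: homogeneous_def)

lemma homogeneous_Const: "homogeneous 0 (Const c)"
  by (auto simp: homogeneous_def Const_def split: if_splits)

lemma homogeneous_Var: "homogeneous 1 (Var x)"
  by (auto simp: homogeneous_def Var_def split: if_splits)

lemma homogeneous_add: "homogeneous d f \<Longrightarrow> homogeneous d g \<Longrightarrow> homogeneous d (f + g)"
  using keys_add[of f g] by (auto simp: homogeneous_def)

lemma homogeneous_sum: "(\<And>i. i \<in> I \<Longrightarrow> homogeneous d (f i)) \<Longrightarrow> homogeneous d (sum f I)"
  by (induction I rule: infinite_finite_induct) (auto intro: homogeneous_add)

lemma homogeneous_mult:
  fixes f g :: "('x, 'k::semiring_0) mpolynomial"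
  shows "homogeneous d f \<Longrightarrow> homogeneous e g \<Longrightarrow> homogeneous (d + e) (f * g)"
  using keys_mult[of f g] by (fastforce simp: homogeneous_def)

lemma homogeneous_power:
  fixes f :: "('x, 'k::comm_semiring_1) mpolynomial"
  shows "homogeneous d f \<Longrightarrow> homogeneous (d * k) (f ^ k)"
  by (induction k) (auto simp: homogeneous_def[of 0] dest: homogeneous_mult)

lemma homogeneous_prod:
  fixes f :: "'i \<Rightarrow> ('x, 'k::comm_semiring_1) mpolynomial"
  shows "(\<And>i. i \<in> I \<Longrightarrow> homogeneous (d i) (f i)) \<Longrightarrow> homogeneous (sum d I) (prod f I)"
  by (induction I rule: infinite_finite_induct) (auto simp: homogeneous_one intro: homogeneous_mult)

lemma homog_part_expand:
  assumes "\<And>a. a \<in> keys f \<Longrightarrow> mdeg a < N"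
  shows "f = (\<Sum>d<N. homog_part d f)"
  using assms by (intro poly_mapping_eqI) (auto simp: lookup_sum lookup_part in_keys_iff)

lemma homog_part_mult:
  fixes f g :: "('x, 'k::comm_semiring_1) mpolynomial"
  shows "homog_part e (f * g) = (\<Sum>i\<le>e. homog_part i f * homog_part (e - i) g)"
proof (rule mpoly_induct[of f])
  fix a c
  have "homog_part e (Poly_Mapping.single a c * g)
      = (if mdeg a \<le> e then Poly_Mapping.single a c * homog_part (e - mdeg a) g else 0)"
  proof (cases "mdeg a \<le> e")
    case True
    then show ?thesis by (simp, intro part_mult) (auto split: if_splits)
  next
    case False
    have "homog_part e (Poly_Mapping.single a c * g) = Poly_Mapping.single a c * part {} g"
      using False by (intro part_mult) (auto split: if_splits)
    then show ?thesis using False part_disjoint[of g "{}"] by simp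
  qed
  then show "homog_part e (Poly_Mapping.single a c * g)
      = (\<Sum>i\<le>e. homog_part i (Poly_Mapping.single a c) * homog_part (e - i) g)"
    by (simp add: part_single if_distrib[of "\<lambda>x. x * _"] cong: if_cong)
qed (auto simp: part_add distrib_right sum.distrib)

definition vars_in :: "'x set \<Rightarrow> ('x, 'k::zero) mpolynomial \<Rightarrow> bool" where
  "vars_in U f \<longleftrightarrow> (\<forall>a\<in>keys f. keys a \<subseteq> U)"

lemma poly_ring_vars_in: "f \<in> poly_ring n m \<longleftrightarrow> vars_in ({..<n} \<times> {..<m}) f"
  by (simp add: poly_ring_def vars_in_def)

lemma vars_in_zero [simp]: "vars_in U 0" and vars_in_one [simp]: "vars_in U (1 :: ('x, 'k::zero_neq_one) mpolynomial)"
  by (auto simp: vars_in_def)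

lemma vars_in_Const [simp]: "vars_in U (Const c)"
  by (auto simp: vars_in_def Const_def split: if_splits)

lemma vars_in_Var: "x \<in> U \<Longrightarrow> vars_in U (Var x)"
  by (auto simp: vars_in_def Var_def split: if_splits)

lemma vars_in_add: "vars_in U f \<Longrightarrow> vars_in U g \<Longrightarrow> vars_in U (f + g)"
  using keys_add[of f g] by (fastforce simp: vars_in_def)

lemma vars_in_sum: "(\<And>i. i \<in> I \<Longrightarrow> vars_in U (f i)) \<Longrightarrow> vars_in U (sum f I)"
  by (induction I rule: infinite_finite_induct) (auto intro: vars_in_add)

lemma vars_in_mult:
  fixes f g :: "('x, 'k::semiring_0) mpolynomial"
  shows "vars_in U f \<Longrightarrow> vars_in U g \<Longrightarrow> vars_in U (f * g)"
  using keys_mult[of f g] by (fastforce simp: vars_in_def keys_add_nat)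

lemma vars_in_power:
  fixes f :: "('x, 'k::comm_semiring_1) mpolynomial"
  shows "vars_in U f \<Longrightarrow> vars_in U (f ^ k)"
  by (induction k) (auto intro: vars_in_mult)

lemma vars_in_prod:
  fixes f :: "'i \<Rightarrow> ('x, 'k::comm_semiring_1) mpolynomial"
  shows "(\<And>i. i \<in> I \<Longrightarrow> vars_in U (f i)) \<Longrightarrow> vars_in U (prod f I)"
  by (induction I rule: infinite_finite_induct) (auto intro: vars_in_mult)

lemma vars_in_part: "vars_in U f \<Longrightarrow> vars_in U (part T f)"
  by (auto simp: vars_in_def keys_part)

definition monom_val :: "('x \<Rightarrow> 'r::comm_semiring_1) \<Rightarrow> ('x \<Rightarrow>\<^sub>0 nat) \<Rightarrow> 'r" where
  "monom_val s a = (\<Prod>x\<in>keys a. s x ^ lookup a x)"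

lemma monom_val_superset:
  "finite S \<Longrightarrow> keys a \<subseteq> S \<Longrightarrow> monom_val s a = (\<Prod>x\<in>S. s x ^ lookup a x)"
  unfolding monom_val_def by (rule prod.mono_neutral_left) (auto simp: in_keys_iff)

lemma monom_val_zero [simp]: "monom_val s 0 = 1"
  by (simp add: monom_val_def)

lemma monom_val_single [simp]: "monom_val s (Poly_Mapping.single x n) = s x ^ n"
  by (simp add: monom_val_def)

lemma monom_val_add: "monom_val s (a + b) = monom_val s a * monom_val s b"
  using monom_val_superset[of "keys a \<union> keys b" a s] monom_val_superset[of "keys a \<union> keys b" b s]
    monom_val_superset[of "keys a \<union> keys b" "a + b" s]
  by (simp add: keys_add_nat lookup_add power_add prod.distrib)

lemma monom_val_mult: "monom_val (\<lambda>x. s x * s' x) a = monom_val s a * monom_val s' a"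
  by (simp add: monom_val_def power_mult_distrib prod.distrib)

lemma monom_val_const: "monom_val (\<lambda>_. c) a = c ^ mdeg a"
  by (simp add: monom_val_def mdeg_def power_sum)

definition ring_map :: "('k::comm_ring_1 \<Rightarrow> 'r::comm_ring_1) \<Rightarrow> bool" where
  "ring_map \<phi> \<longleftrightarrow> \<phi> 1 = 1 \<and> (\<forall>x y. \<phi> (x + y) = \<phi> x + \<phi> y \<and> \<phi> (x * y) = \<phi> x * \<phi> y)"

lemma ring_map_simps:
  assumes "ring_map \<phi>"
  shows "\<phi> 1 = 1" "\<phi> (x + y) = \<phi> x + \<phi> y" "\<phi> (x * y) = \<phi> x * \<phi> y" "\<phi> 0 = 0"
    "\<phi> (- x) = - \<phi> x" "\<phi> (x - y) = \<phi> x - \<phi> y" "\<phi> (x ^ k) = \<phi> x ^ k"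
proof -
  show 1: "\<phi> 1 = 1" and 2: "\<And>x y. \<phi> (x + y) = \<phi> x + \<phi> y" and 3: "\<And>x y. \<phi> (x * y) = \<phi> x * \<phi> y"
    using assms by (auto simp: ring_map_def)
  show 4: "\<phi> 0 = 0" using 2[of 0 0] by simp
  show 5: "\<phi> (- x) = - \<phi> x" for x using 2[of x "- x"] 4 by (simp add: minus_unique)
  show "\<phi> (x - y) = \<phi> x - \<phi> y" using 2[of x "- y"] 5[of y] by simp
  show "\<phi> (x ^ k) = \<phi> x ^ k" by (induction k) (auto simp: 1 3)
qed

lemma ring_map_sum: "ring_map \<phi> \<Longrightarrow> \<phi> (sum f I) = (\<Sum>i\<in>I. \<phi> (f i))"
  by (induction I rule: infinite_finite_induct) (auto simp: ring_map_simps)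

lemma ring_map_prod: "ring_map \<phi> \<Longrightarrow> \<phi> (prod f I) = (\<Prod>i\<in>I. \<phi> (f i))"
  by (induction I rule: infinite_finite_induct) (auto simp: ring_map_simps)

lemma ring_map_id [simp]: "ring_map id" "ring_map (\<lambda>x. x)"
  by (auto simp: ring_map_def)

lemma ring_map_Const [simp]: "ring_map Const"
  by (simp add: ring_map_def Const_def single_add mult_single)

lemma eval_mpoly_monom_val: "eval_mpoly \<phi> s f = (\<Sum>a\<in>keys f. \<phi> (lookup f a) * monom_val s a)"
  by (simp add: eval_mpoly_def monom_val_def)

lemma eval_zero [simp]: "eval_mpoly \<phi> s 0 = 0"
  by (simp add: eval_mpoly_def)

context
  fixes \<phi> :: "'k::comm_ring_1 \<Rightarrow> 'r::comm_ring_1"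
  assumes \<phi>: "ring_map \<phi>"
begin

lemma eval_superset:
  "finite S \<Longrightarrow> keys f \<subseteq> S \<Longrightarrow> eval_mpoly \<phi> s f = (\<Sum>a\<in>S. \<phi> (lookup f a) * monom_val s a)"
  unfolding eval_mpoly_monom_val
  by (rule sum.mono_neutral_left) (auto simp: in_keys_iff ring_map_simps[OF \<phi>])

lemma eval_single: "eval_mpoly \<phi> s (Poly_Mapping.single a c) = \<phi> c * monom_val s a"
  by (simp add: eval_mpoly_monom_val ring_map_simps[OF \<phi>])

lemma eval_add: "eval_mpoly \<phi> s (f + g) = eval_mpoly \<phi> s f + eval_mpoly \<phi> s g"
proof -
  let ?S = "keys f \<union> keys g"
  have "keys (f + g) \<subseteq> ?S" by (rule keys_add)
  then show ?thesis
    using eval_superset[of ?S f s] eval_superset[of ?S g s] eval_superset[of ?S "f + g" s]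
    by (simp add: lookup_add ring_map_simps[OF \<phi>] distrib_right sum.distrib)
qed

lemma eval_mult: "eval_mpoly \<phi> s (f * g) = eval_mpoly \<phi> s f * eval_mpoly \<phi> s g"
proof (rule mpoly_induct[of f])
  fix a c
  show "eval_mpoly \<phi> s (Poly_Mapping.single a c * g) = eval_mpoly \<phi> s (Poly_Mapping.single a c) * eval_mpoly \<phi> s g"
    by (rule mpoly_induct[of g])
      (auto simp: mult_single eval_single monom_val_add ring_map_simps[OF \<phi>] eval_add distrib_left distrib_right mult_ac)
qed (auto simp: eval_add distrib_right)

lemma eval_Const: "eval_mpoly \<phi> s (Const c) = \<phi> c"
  by (simp add: Const_def eval_single)

lemma eval_Var: "eval_mpoly \<phi> s (Var x) = s x"
  by (simp add: Var_def eval_single ring_map_simps[OF \<phi>])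

lemma ring_map_eval: "ring_map (eval_mpoly \<phi> s)"
  using eval_Const[of s 1] by (simp add: ring_map_def eval_add eval_mult Const_def ring_map_simps[OF \<phi>])

lemma ring_map_comp_eval:
  "ring_map \<eta> \<Longrightarrow> \<eta> (eval_mpoly \<phi> s f) = eval_mpoly (\<lambda>c. \<eta> (\<phi> c)) (\<lambda>x. \<eta> (s x)) f"
  by (simp add: eval_mpoly_def ring_map_sum ring_map_prod ring_map_simps)

end

lemma eval_cong:
  assumes "vars_in U f" "\<And>x. x \<in> U \<Longrightarrow> s x = s' x"
  shows "eval_mpoly \<phi> s f = eval_mpoly \<phi> s' f"
  unfolding eval_mpoly_def using assms
  by (intro sum.cong arg_cong2[of _ _ _ _ "(*)"] prod.cong) (auto simp: vars_in_def subset_iff)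

lemma eval_scale:
  assumes "homogeneous d f"
  shows "eval_mpoly \<phi> (\<lambda>x. c * s x) f = c ^ d * eval_mpoly \<phi> s f"
  unfolding eval_mpoly_monom_val sum_distrib_left using assms
  by (intro sum.cong) (auto simp: monom_val_mult monom_val_const homogeneous_def mult.left_commute)

section \<open>Polynomials vanishing at all points\<close>

text \<open>Distinct monomials are distinct characters of the multiplicative monoid of points, so
  Dedekind's argument shows that they are linearly independent functions.\<close>

lemma monom_val_separates:
  assumes inf: "infinite (UNIV :: 'k::field set)" and "a \<noteq> b"
  obtains s :: "'x \<Rightarrow> 'k::field" where "monom_val s a \<noteq> monom_val s b"
proof -
  obtain x where x: "lookup a x \<noteq> lookup b x" using assms(2) by (metis poly_mapping_eqI)
  define p where "p = (monom 1 (lookup a x) - monom 1 (lookup b x) :: 'k poly)"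
  have "coeff p (lookup a x) = 1" using x by (simp add: p_def)
  then have "p \<noteq> 0" by force
  then have "finite {t. poly p t = 0}" by (rule poly_roots_finite)
  then obtain t where t: "poly p t \<noteq> 0" using inf ex_new_if_finite by blast
  have *: "monom_val ((\<lambda>_. 1)(x := t)) c = t ^ lookup c x" for c
  proof (cases "x \<in> keys c")
    case True
    have "monom_val ((\<lambda>_. 1)(x := t)) c = (\<Prod>y\<in>{x}. ((\<lambda>_. 1)(x := t)) y ^ lookup c y)"
      unfolding monom_val_def using True by (intro prod.mono_neutral_right) auto
    then show ?thesis by simp
  next
    case False
    have "monom_val ((\<lambda>_. 1)(x := t)) c = 1"
      unfolding monom_val_def using False by (intro prod.neutral) auto
    then show ?thesis using False by (simp add: in_keys_iff)
  qed
  show thesis by (rule that[of "(\<lambda>_. 1)(x := t)"]) (use t in \<open>simp add: * p_def poly_monom\<close>)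
qed

lemma monom_val_independent:
  fixes c :: "('x \<Rightarrow>\<^sub>0 nat) \<Rightarrow> 'k::field"
  assumes inf: "infinite (UNIV :: 'k set)" and "finite S"
    and "\<And>s :: 'x \<Rightarrow> 'k. (\<Sum>a\<in>S. c a * monom_val s a) = 0"
  shows "\<forall>a\<in>S. c a = 0"
  using assms(2,3)
proof (induction S arbitrary: c rule: finite_induct)
  case (insert b S)
  have "c a = 0" if a: "a \<in> S" for a
  proof -
    obtain s0 :: "'x \<Rightarrow> 'k" where s0: "monom_val s0 a \<noteq> monom_val s0 b"
      using monom_val_separates[OF inf, of a b] a insert.hyps by metis
    \<comment> \<open>The relation at the pointwise product of \<open>s0\<close> and
      \<open>s\<close>, minus \<open>monom_val s0 b\<close> times the relation at \<open>s\<close>,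
      has no term for \<open>b\<close>.\<close>
    have "(\<Sum>a\<in>S. c a * (monom_val s0 a - monom_val s0 b) * monom_val s a) = 0" for s :: "'x \<Rightarrow> 'k"
    proof -
      have "(\<Sum>a\<in>insert b S. c a * (monom_val s0 a - monom_val s0 b) * monom_val s a)
        = (\<Sum>a\<in>insert b S. c a * monom_val (\<lambda>x. s0 x * s x) a)
          - monom_val s0 b * (\<Sum>a\<in>insert b S. c a * monom_val s a)"
        unfolding sum_distrib_left sum_subtractf[symmetric]
        by (intro sum.cong) (auto simp: monom_val_mult algebra_simps)
      also have "\<dots> = 0" using insert.prems[of s] insert.prems[of "\<lambda>x. s0 x * s x"] by simp
      finally show ?thesis using insert.hyps by simp
    qed
    from insert.IH[OF this] have "c a * (monom_val s0 a - monom_val s0 b) = 0" using a by blast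
    then show ?thesis using s0 by simp
  qed
  then have S0: "\<forall>a\<in>S. c a = 0" by blast
  have "c b * monom_val (\<lambda>_. 1) b = 0" using insert.prems[of "\<lambda>_. 1"] insert.hyps S0 by simp
  then show ?case using S0 by (simp add: monom_val_const)
qed simp

lemma mpoly_zero_if_vanishing:
  fixes f :: "('x, 'k::field) mpolynomial"
  assumes "infinite (UNIV :: 'k set)" and "\<And>s. eval_mpoly id s f = 0"
  shows "f = 0"
proof -
  have "(\<Sum>a\<in>keys f. lookup f a * monom_val s a) = 0" for s
    using assms(2)[of s] by (simp add: eval_mpoly_monom_val)
  from monom_val_independent[OF assms(1) _ this] show ?thesis
    by (intro poly_mapping_eqI) (auto simp: in_keys_iff)
qed

section \<open>Ideal powers and Frobenius splitting\<close>

definition gen_monomial :: "'r::comm_ring_1 set \<Rightarrow> ('r \<Rightarrow> nat) \<Rightarrow> 'r" where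
  "gen_monomial S e = (\<Prod>g\<in>S. g ^ e g)"

text \<open>An ideal of the whole ambient ring, not of the subalgebra. Admitting exponent sums above
  \<open>l\<close> makes monotonicity in \<open>l\<close> easy.\<close>

definition power_ideal :: "'r::comm_ring_1 set \<Rightarrow> nat \<Rightarrow> 'r set" where
  "power_ideal S l = is_submodule UNIV hull {gen_monomial S e | e. l \<le> sum e S}"

lemma gen_monomial_add: "gen_monomial S (\<lambda>g. e g + e' g) = gen_monomial S e * gen_monomial S e'"
  by (simp add: gen_monomial_def power_add prod.distrib)

lemma gen_monomial_mult: "gen_monomial S (\<lambda>g. k * e g) = gen_monomial S e ^ k"
  by (simp add: gen_monomial_def prod_power_distrib mult.commute flip: power_mult)

lemma power_ideal_closed:
  "0 \<in> power_ideal S l" "x \<in> power_ideal S l \<Longrightarrow> y \<in> power_ideal S l \<Longrightarrow> x + y \<in> power_ideal S l"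
  "x \<in> power_ideal S l \<Longrightarrow> a * x \<in> power_ideal S l"
  unfolding power_ideal_def by (auto intro: span_closed)

lemma power_ideal_sum: "(\<And>i. i \<in> I \<Longrightarrow> f i \<in> power_ideal S l) \<Longrightarrow> sum f I \<in> power_ideal S l"
  by (induction I rule: infinite_finite_induct) (auto intro: power_ideal_closed)

lemma power_ideal_base: "l \<le> sum e S \<Longrightarrow> gen_monomial S e \<in> power_ideal S l"
  unfolding power_ideal_def by (rule span_base) blast

text \<open>\<open>P\<close> is only asked to be additive, with the multiples put into the base
  case: it is applied to maps such as \<open>frob_split\<close> that are additive but not
  linear.\<close>

lemma power_ideal_least:
  assumes "\<And>e r. l \<le> sum e S \<Longrightarrow> P (r * gen_monomial S e)" "P 0" "\<And>x y. P x \<Longrightarrow> P y \<Longrightarrow> P (x + y)"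
    and x: "x \<in> power_ideal S l"
  shows "P x"
proof -
  have "power_ideal S l \<subseteq> {x. \<forall>r. P (r * x)}"
    unfolding power_ideal_def
  proof (rule span_minimal)
    show "is_submodule UNIV {x. \<forall>r. P (r * x)}"
      using assms(2,3) by (intro submoduleI) (auto simp: distrib_left simp flip: mult.assoc)
  qed (use assms(1) in blast)
  then have "P (1 * x)" using x by blast
  then show ?thesis by simp
qed

lemma power_ideal_mono: "k \<le> l \<Longrightarrow> x \<in> power_ideal S l \<Longrightarrow> x \<in> power_ideal S k"
  by (rule power_ideal_least[where S = S and l = l])
    (auto intro!: power_ideal_closed intro: power_ideal_base order_trans)

lemma power_ideal_0: "x \<in> power_ideal S 0"
  using power_ideal_closed(3)[OF power_ideal_base[of 0 "\<lambda>_. 0" S], of x] by (simp add: gen_monomial_def)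

lemma power_ideal_mult:
  assumes x: "x \<in> power_ideal S k" and y: "y \<in> power_ideal S l"
  shows "x * y \<in> power_ideal S (k + l)"
proof (rule power_ideal_least[OF _ _ _ x])
  fix e r assume e: "k \<le> sum e S"
  show "r * gen_monomial S e * y \<in> power_ideal S (k + l)"
  proof (rule power_ideal_least[OF _ _ _ y])
    fix e' r' assume "l \<le> sum e' S"
    then have "gen_monomial S (\<lambda>g. e g + e' g) \<in> power_ideal S (k + l)"
      using e by (intro power_ideal_base) (simp add: sum.distrib)
    then have "(r * r') * gen_monomial S (\<lambda>g. e g + e' g) \<in> power_ideal S (k + l)" by (rule power_ideal_closed)
    then show "r * gen_monomial S e * (r' * gen_monomial S e') \<in> power_ideal S (k + l)"
      by (simp add: gen_monomial_add mult_ac)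
  qed (auto simp: distrib_left intro: power_ideal_closed)
qed (auto simp: distrib_right intro: power_ideal_closed)

lemma power_ideal_member:
  assumes "finite S" "g \<in> S"
  shows "g \<in> power_ideal S 1"
proof -
  have "gen_monomial S (\<lambda>h. if h = g then 1 else 0) = g"
    using assms by (simp add: gen_monomial_def if_distrib[of "\<lambda>k. _ ^ k"] cong: if_cong)
  then show ?thesis using power_ideal_base[of 1 "\<lambda>h. if h = g then 1 else 0" S] assms by simp
qed

lemma power_ideal_power: "x \<in> power_ideal S 1 \<Longrightarrow> x ^ k \<in> power_ideal S k"
proof (induction k)
  case (Suc k)
  then show ?case using power_ideal_mult[of x S 1 "x ^ k" k] by simp
qed (simp add: power_ideal_0)

section \<open>Degree bounds from ideal powers\<close>

context
  fixes S :: "('x, 'k::field) mpolynomial set"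
  assumes fin: "finite S" and hom2: "\<And>g. g \<in> S \<Longrightarrow> homogeneous 2 g"
begin

lemma homogeneous_gen_monomial: "homogeneous (2 * sum e S) (gen_monomial S e)"
  unfolding gen_monomial_def sum_distrib_left by (intro homogeneous_prod homogeneous_power hom2)

text \<open>A component of degree \<open>e\<close> is built from products of at least
  \<open>e / 2\<close> generators of degree 2. Rounding the exponent up is compatible with
  products.\<close>

lemma homog_part_subalgebra:
  assumes "a \<in> subalgebra hull S"
  shows "homog_part e a \<in> power_ideal S ((e + 1) div 2)"
proof -
  let ?P = "{a. \<forall>e. homog_part e a \<in> power_ideal S ((e + 1) div 2)}"
  have "subalgebra hull S \<subseteq> ?P"
  proof (rule hull_minimal)
    show "S \<subseteq> ?P"
    proof clarify
      fix g e assume g: "g \<in> S"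
      show "homog_part e g \<in> power_ideal S ((e + 1) div 2)"
        using homog_part_id[OF hom2[OF g]] homog_part_other[OF hom2[OF g]] power_ideal_member[OF fin g]
          power_ideal_closed(1) by (cases "e = 2") auto
    qed
    show "subalgebra ?P"
      unfolding subalgebra_def
    proof (intro conjI ballI)
      show "range Const \<subseteq> ?P"
      proof clarify
        fix c :: 'k and e
        show "homog_part e (Const c) \<in> power_ideal S ((e + 1) div 2)"
          by (cases "e = 0") (auto simp: power_ideal_0 power_ideal_closed(1) homog_part_other[OF homogeneous_Const])
      qed
    next
      fix f g assume "f \<in> ?P" "g \<in> ?P"
      then have fg: "homog_part e f \<in> power_ideal S ((e + 1) div 2)"
        "homog_part e g \<in> power_ideal S ((e + 1) div 2)" for e by auto
      then show "f + g \<in> ?P" by (auto simp: part_add intro: power_ideal_closed)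
      show "f * g \<in> ?P"
      proof clarify
        fix e
        have "homog_part i f * homog_part (e - i) g \<in> power_ideal S ((e + 1) div 2)" if "i \<le> e" for i
        proof (rule power_ideal_mono[OF _ power_ideal_mult[OF fg]])
          obtain j where "e = i + j" using \<open>i \<le> e\<close> le_Suc_ex by blast
          then show "(e + 1) div 2 \<le> (i + 1) div 2 + (e - i + 1) div 2" by simp
        qed
        then show "homog_part e (f * g) \<in> power_ideal S ((e + 1) div 2)"
          unfolding homog_part_mult by (intro power_ideal_sum) auto
      qed
    qed
  qed
  then show ?thesis using assms by blast
qed

text \<open>All powers of \<open>f\<close> are combinations of the powers below the degree
  \<open>r\<close> of the equation. Comparing degrees, the coefficients that matter in
  \<open>f ^ N\<close> have degree at least \<open>d * N - d * r\<close>; the loss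
  \<open>k = d * r\<close> is the same for all \<open>N\<close>.\<close>

lemma integral_power_in_ideal:
  assumes f: "homogeneous d f" and int: "integral_over (subalgebra hull S) f"
  shows "\<exists>k. \<forall>N. f ^ N \<in> power_ideal S ((d * N + 1 - k) div 2)"
proof -
  let ?A = "subalgebra hull S"
  obtain r a where a: "\<forall>i<r. a i \<in> ?A" "f ^ r = (\<Sum>i<r. a i * f ^ i)"
    using int unfolding integral_over_def by blast
  let ?M = "is_submodule ?A hull ((\<lambda>i. f ^ i) ` {..<r})"
  have base: "f ^ i \<in> ?M" if "i < r" for i using that by (auto intro: span_base)
  have top: "f ^ r \<in> ?M" using a base
    by (auto intro!: submodule_sum[OF submodule_span] span_closed(3))
  have step: "f * x \<in> ?M" if "x \<in> ?M" for x
  proof -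
    have "?M \<subseteq> {x. f * x \<in> ?M}"
    proof (rule span_minimal)
      show "is_submodule ?A {x. f * x \<in> ?M}"
        using span_closed by (intro submoduleI) (auto simp: distrib_left mult.left_commute)
      show "(\<lambda>i. f ^ i) ` {..<r} \<subseteq> {x. f * x \<in> ?M}"
      proof clarify
        fix i assume "i < r"
        then have "f ^ Suc i \<in> ?M" using base[of "Suc i"] top by (cases "Suc i = r") (auto simp del: power_Suc)
        then show "f * f ^ i \<in> ?M" by simp
      qed
    qed
    then show ?thesis using that by blast
  qed
  have fN: "f ^ N \<in> ?M" for N
  proof (induction N)
    case 0
    show ?case using base[of 0] top by (cases "r = 0") auto
  next
    case (Suc N)
    then show ?case using step by simp
  qed
  define k where "k = d * r"
  let ?P = "{h. \<forall>e. homog_part e h \<in> power_ideal S ((e + 1 - k) div 2)}"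
  have "?M \<subseteq> ?P"
  proof (rule span_minimal)
    show "(\<lambda>i. f ^ i) ` {..<r} \<subseteq> ?P"
    proof clarify
      fix i e assume i: "i < r"
      show "homog_part e (f ^ i) \<in> power_ideal S ((e + 1 - k) div 2)"
      proof (cases "e = d * i")
        case True
        then have "e \<le> k" using i by (simp add: k_def)
        \<comment> \<open>\<open>e + 1 - k\<close> is at most 1, so the required exponent is zero
          and the condition void.\<close>
        then have "(e + 1 - k) div 2 = 0" by simp
        then show ?thesis by (simp add: power_ideal_0)
      next
        case False
        then show ?thesis
          using homog_part_other[OF homogeneous_power[OF f]] power_ideal_closed(1) by metis
      qed
    qed
    show "is_submodule ?A ?P"
    proof (rule submoduleI)
      fix b h assume b: "b \<in> ?A" and h: "h \<in> ?P"
      show "b * h \<in> ?P"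
      proof clarify
        fix e
        have "homog_part i b * homog_part (e - i) h \<in> power_ideal S ((e + 1 - k) div 2)" if "i \<le> e" for i
        proof (rule power_ideal_mono)
          show "homog_part i b * homog_part (e - i) h \<in> power_ideal S ((i + 1) div 2 + (e - i + 1 - k) div 2)"
            using h by (intro power_ideal_mult homog_part_subalgebra b) auto
          have "i \<le> 2 * ((i + 1) div 2)" by presburger
          then have "e + 1 - k \<le> 2 * ((i + 1) div 2) + (e - i + 1 - k)" using that by linarith
          then have "(e + 1 - k) div 2 \<le> (2 * ((i + 1) div 2) + (e - i + 1 - k)) div 2" by (rule div_le_mono)
          then show "(e + 1 - k) div 2 \<le> (i + 1) div 2 + (e - i + 1 - k) div 2" by simp
        qed
        then show "homog_part e (b * h) \<in> power_ideal S ((e + 1 - k) div 2)"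
          unfolding homog_part_mult by (intro power_ideal_sum) auto
      qed
    qed (auto simp: part_add intro: power_ideal_closed)
  qed
  then have "f ^ N \<in> ?P" for N using fN by (rule subsetD)
  then have "homog_part (d * N) (f ^ N) \<in> power_ideal S ((d * N + 1 - k) div 2)" for N by simp
  then show ?thesis using homog_part_id[OF homogeneous_power[OF f]] by metis
qed

text \<open>When \<open>f\<close> is written through products of at least \<open>l\<close>
  generators, only the part of each cofactor of complementary degree, at most
  \<open>d - 2 * l\<close>, contributes. Since \<open>f\<close> and the generators use only
  variables in \<open>U\<close>, the same selection discards all other variables from the
  cofactors.\<close>

lemma homogeneous_in_span:
  assumes f: "f \<in> power_ideal S l" "homogeneous d f" "vars_in U f"
    and S: "\<And>g. g \<in> S \<Longrightarrow> vars_in U g"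
  shows "f \<in> is_submodule (subalgebra hull S) hull {Poly_Mapping.single a 1 | a. mdeg a \<le> d - 2 * l \<and> keys a \<subseteq> U}"
    (is "_ \<in> ?N")
proof -
  let ?A = "subalgebra hull S"
  let ?T = "\<lambda>d. {a. mdeg a = d \<and> keys a \<subseteq> U}"
  have A: "is_subring ?A" by (intro subring_if_subalgebra subalgebra_hull)
  have low: "part (?T e) r \<in> ?N" if "e \<le> d - 2 * l" for e r
  proof (subst mpoly_expand, rule submodule_sum[OF submodule_span])
    fix a assume "a \<in> keys (part (?T e) r)"
    then have "Poly_Mapping.single a 1 \<in> ?N" using that by (intro span_base) (auto simp: keys_part)
    moreover have "Const c \<in> ?A" for c using subalgebra_hull[of S] by (auto simp: subalgebra_def)
    ultimately have "Const (lookup (part (?T e) r) a) * Poly_Mapping.single a 1 \<in> ?N" by (rule span_closed(3)[rotated])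
    then show "Poly_Mapping.single a (lookup (part (?T e) r) a) \<in> ?N" by (simp add: Const_def mult_single)
  qed
  have "part (?T d) f \<in> ?N"
  proof (rule power_ideal_least[OF _ _ _ f(1), where P = "\<lambda>f. part (?T d) f \<in> ?N"])
    fix e r assume e: "l \<le> sum e S"
    have hom: "\<And>a. a \<in> keys (gen_monomial S e) \<Longrightarrow> mdeg a = 2 * sum e S"
      using homogeneous_gen_monomial[of e] by (simp add: homogeneous_def)
    have "vars_in U (gen_monomial S e)" unfolding gen_monomial_def by (intro vars_in_prod vars_in_power S)
    then have vars: "\<And>a. a \<in> keys (gen_monomial S e) \<Longrightarrow> keys a \<subseteq> U" by (simp add: vars_in_def)
    show "part (?T d) (r * gen_monomial S e) \<in> ?N"
    proof (cases "2 * sum e S \<le> d")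
      case True
      have "part (?T d) (gen_monomial S e * r) = gen_monomial S e * part (?T (d - 2 * sum e S)) r"
        using True by (intro part_mult) (use hom vars in \<open>auto simp: keys_add_nat\<close>)
      moreover have "gen_monomial S e \<in> ?A"
        unfolding gen_monomial_def using hull_subset[of S subalgebra]
        by (intro subring_prod[OF A] subring_power[OF A]) auto
      moreover have "part (?T (d - 2 * sum e S)) r \<in> ?N" using e by (intro low) auto
      ultimately show ?thesis by (simp add: mult.commute span_closed(3))
    next
      case False
      have "part (?T d) (gen_monomial S e * r) = gen_monomial S e * part {} r"
        using False by (intro part_mult) (use hom in auto)
      then show ?thesis using part_disjoint[of r "{}"] by (simp add: mult.commute span_closed(1))
    qed
  qed (auto simp: part_add intro: span_closed)
  moreover have "part (?T d) f = f" using f by (intro part_id) (auto simp: homogeneous_def vars_in_def)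
  ultimately show ?thesis by simp
qed

end


section \<open>Frobenius splitting of the polynomial ring\<close>

lemma frobenius_add:
  fixes x y :: "'r::comm_ring_1"
  assumes "(2 :: 'r) = 0"
  shows "(x + y) ^ 2 ^ e = x ^ 2 ^ e + y ^ 2 ^ e"
proof (induction e)
  case (Suc e)
  have sq: "(a + b) ^ 2 = a ^ 2 + b ^ 2" for a b :: 'r
    using assms by (simp add: power2_sum)
  show ?case unfolding power_Suc2 power_mult Suc sq ..
qed simp

definition frob_root :: "nat \<Rightarrow> 'k::field \<Rightarrow> 'k" where
  "frob_root e c = (SOME r. r ^ 2 ^ e = c)"

definition mono_scale :: "nat \<Rightarrow> ('x \<Rightarrow>\<^sub>0 nat) \<Rightarrow> 'x \<Rightarrow>\<^sub>0 nat" where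
  "mono_scale q a = Poly_Mapping.map (\<lambda>n. q * n) a"

lemma lookup_mono_scale: "lookup (mono_scale q a) x = q * lookup a x"
  by (simp add: mono_scale_def Poly_Mapping.map.rep_eq when_def)

text \<open>With \<open>q = 2 ^ e\<close>, the polynomial ring is free over its q-th powers on the
  monomials with all exponents below \<open>q\<close>. For such an \<open>a\<close> this is the q-th
  root of the coefficient at the basis monomial \<open>a\<close>.\<close>

definition frob_split :: "nat \<Rightarrow> ('x \<Rightarrow>\<^sub>0 nat) \<Rightarrow> ('x, 'k::field) mpolynomial \<Rightarrow> ('x, 'k) mpolynomial" where
  "frob_split e a f = Abs_poly_mapping (\<lambda>b. frob_root e (lookup f (mono_scale (2 ^ e) b + a)))"

locale alg_closed_char2 =
  fixes ty :: "'k::alg_closed_field itself"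
  assumes two: "(2 :: 'k) = 0"
begin

lemma two_mpoly: "(2 :: ('x, 'k) mpolynomial) = 0"
  by (rule poly_mapping_eqI) (simp add: lookup_numeral two when_def)

lemma infinite_field: "infinite (UNIV :: 'k set)"
proof
  assume fin: "finite (UNIV :: 'k set)"
  \<comment> \<open>If the field were finite, this nonconstant polynomial would take the value 1
    everywhere and have no root.\<close>
  define p where "p = (\<Prod>a\<in>(UNIV :: 'k set). [:- a, 1:]) + 1"
  have "degree (\<Prod>a\<in>(UNIV :: 'k set). [:- a, 1:]) = card (UNIV :: 'k set)"
    by (subst degree_prod_eq_sum_degree) auto
  moreover have "card (UNIV :: 'k set) > 0" using fin by (simp add: card_gt_0_iff)
  ultimately have "degree p > 0" unfolding p_def by (subst degree_add_eq_left) auto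
  then obtain x where "poly p x = 0" using alg_closed_imp_poly_has_root by blast
  moreover have "poly p x = 1" for x using fin by (auto simp: p_def poly_prod)
  ultimately show False by simp
qed

lemma frob_root_power: "frob_root e c ^ 2 ^ e = (c :: 'k)"
proof -
  have "\<exists>r. r ^ 2 ^ e = c" by (metis nth_root_exists zero_less_numeral zero_less_power)
  then show ?thesis unfolding frob_root_def by (rule someI_ex)
qed

lemma frob_inj: "x ^ 2 ^ e = y ^ 2 ^ e \<Longrightarrow> x = (y :: 'k)"
proof -
  assume "x ^ 2 ^ e = y ^ 2 ^ e"
  moreover have "(x + y) ^ 2 ^ e = x ^ 2 ^ e + y ^ 2 ^ e" by (rule frobenius_add[OF two])
  moreover have add_self: "z + z = 0" for z :: 'k by (metis two mult_2 mult_zero_left)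
  ultimately have "x + y = 0" by simp
  then show "x = y" using add_self[of y] by (metis add_right_cancel)
qed

text \<open>Roots of order a power of 2 are unique in characteristic 2, so the chosen ones are
  additive: both sides have the same power.\<close>

lemma frob_root_simps:
  fixes x y :: 'k
  shows "frob_root e (x + y) = frob_root e x + frob_root e y"
    "frob_root e (x ^ 2 ^ e * y) = x * frob_root e y" "frob_root e x = 0 \<longleftrightarrow> x = 0" "frob_root e 0 = (0 :: 'k)"
proof -
  show "frob_root e (x + y) = frob_root e x + frob_root e y"
    by (rule frob_inj[where e = e]) (simp add: frob_root_power frobenius_add[OF two])
  show "frob_root e (x ^ 2 ^ e * y) = x * frob_root e y"
    by (rule frob_inj[where e = e]) (simp add: frob_root_power power_mult_distrib)
  show zero: "frob_root e 0 = (0 :: 'k)" by (rule frob_inj[where e = e]) (simp add: frob_root_power)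
  show "frob_root e x = 0 \<longleftrightarrow> x = 0" using frob_root_power[of e x] zero by (auto simp: power_0_left)
qed

lemma lookup_frob_split:
  "lookup (frob_split e a f) b = frob_root e (lookup f (mono_scale (2 ^ e) b + a) :: 'k)"
proof -
  have "inj (\<lambda>b. mono_scale (2 ^ e) b + a)"
    by (rule injI) (simp add: poly_mapping_eq_iff fun_eq_iff lookup_mono_scale lookup_add)
  then have "finite ((\<lambda>b. mono_scale (2 ^ e) b + a) -` keys f)" by (intro finite_vimageI) auto
  then have "finite {b. frob_root e (lookup f (mono_scale (2 ^ e) b + a)) \<noteq> 0}"
    by (rule rev_finite_subset) (auto simp: frob_root_simps in_keys_iff)
  then show ?thesis by (simp add: frob_split_def)
qed

lemma frob_split_add: "frob_split e a (f + g) = frob_split e a f + frob_split e a (g :: ('x, 'k) mpolynomial)"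
  by (rule poly_mapping_eqI) (simp add: lookup_frob_split lookup_add frob_root_simps)

lemma frob_split_zero: "frob_split e a (0 :: ('x, 'k) mpolynomial) = 0"
  by (rule poly_mapping_eqI) (simp add: lookup_frob_split frob_root_simps)

lemma single_power: "Poly_Mapping.single b (c :: 'k) ^ q = Poly_Mapping.single (mono_scale q b) (c ^ q)"
proof (induction q)
  case 0
  have "mono_scale 0 b = 0" by (rule poly_mapping_eqI) (simp add: lookup_mono_scale)
  then show ?case by simp
next
  case (Suc q)
  have "b + mono_scale q b = mono_scale (Suc q) b"
    by (rule poly_mapping_eqI) (simp add: lookup_mono_scale lookup_add)
  then show ?case using Suc by (simp add: mult_single)
qed

lemma frob_split_power_mult:
  fixes g h :: "('x, 'k) mpolynomial"
  assumes a: "\<And>x. lookup a x < 2 ^ e"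
  shows "frob_split e a (g ^ 2 ^ e * h) = g * frob_split e a h"
proof (rule mpoly_induct[of h])
  fix \<beta> d
  let ?h = "Poly_Mapping.single \<beta> d :: ('x, 'k) mpolynomial"
  show "frob_split e a (g ^ 2 ^ e * ?h) = g * frob_split e a ?h"
  proof (rule mpoly_induct[of g])
    fix \<alpha> c
    let ?q = "2 ^ e :: nat"
    have eq: "Poly_Mapping.single \<alpha> c ^ ?q * ?h = Poly_Mapping.single (mono_scale ?q \<alpha> + \<beta>) (c ^ ?q * d)"
      by (simp add: single_power mult_single)
    show "frob_split e a (Poly_Mapping.single \<alpha> c ^ ?q * ?h) = Poly_Mapping.single \<alpha> c * frob_split e a ?h"
    proof (cases "\<exists>b. \<beta> = mono_scale ?q b + a")
      case True
      then obtain b0 where b0: "\<beta> = mono_scale ?q b0 + a" by blast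
      have inj: "mono_scale ?q b0 = mono_scale ?q b \<longleftrightarrow> b0 = b" for b0 b :: "'x \<Rightarrow>\<^sub>0 nat"
        by (simp add: poly_mapping_eq_iff fun_eq_iff lookup_mono_scale)
      have "mono_scale ?q \<alpha> + mono_scale ?q b0 = mono_scale ?q (\<alpha> + b0)"
        by (rule poly_mapping_eqI) (simp add: lookup_mono_scale lookup_add distrib_left)
      then have sum: "mono_scale ?q \<alpha> + \<beta> = mono_scale ?q (\<alpha> + b0) + a" by (simp add: b0 add.assoc[symmetric])
      have "frob_split e a ?h = Poly_Mapping.single b0 (frob_root e d)"
        by (rule poly_mapping_eqI) (simp add: lookup_frob_split b0 lookup_single when_def inj frob_root_simps)
      moreover have "frob_split e a (Poly_Mapping.single (mono_scale ?q \<alpha> + \<beta>) (c ^ ?q * d))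
          = Poly_Mapping.single (\<alpha> + b0) (c * frob_root e d)"
        unfolding sum
        by (rule poly_mapping_eqI) (simp add: lookup_frob_split lookup_single when_def inj frob_root_simps)
      ultimately show ?thesis by (simp add: eq mult_single)
    next
      case False
      have "mono_scale ?q \<alpha> + \<beta> \<noteq> mono_scale ?q b + a" for b
      proof
        assume asm: "mono_scale ?q \<alpha> + \<beta> = mono_scale ?q b + a"
        have x: "?q * lookup \<alpha> x + lookup \<beta> x = ?q * lookup b x + lookup a x" for x
          using arg_cong[OF asm, of "\<lambda>m. lookup m x"] by (simp add: lookup_mono_scale lookup_add)
        \<comment> \<open>Exponents of \<open>a\<close> are below \<open>q\<close>, hence are
          remainders, so the quotients can be compared; then \<open>\<beta>\<close> itself would
          have remainder \<open>a\<close>.\<close>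
        have le: "lookup \<alpha> x \<le> lookup b x" for x
        proof (rule ccontr)
          assume "\<not> ?thesis"
          then have "?q * Suc (lookup b x) \<le> ?q * lookup \<alpha> x" by (intro mult_le_mono2) simp
          then show False using x[of x] a[of x] by simp
        qed
        have "\<beta> = mono_scale ?q (b - \<alpha>) + a"
        proof (rule poly_mapping_eqI)
          fix y
          have "?q * lookup \<alpha> y \<le> ?q * lookup b y" using le[of y] by (rule mult_le_mono2)
          then show "lookup \<beta> y = lookup (mono_scale ?q (b - \<alpha>) + a) y"
            using x[of y] by (simp add: lookup_mono_scale lookup_add lookup_minus diff_mult_distrib2)
        qed
        then show False using False by blast
      qed
      then have "frob_split e a (Poly_Mapping.single (mono_scale ?q \<alpha> + \<beta>) (c ^ ?q * d)) = 0"
        by (intro poly_mapping_eqI) (simp add: lookup_frob_split lookup_single when_def frob_root_simps)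
      moreover have "frob_split e a ?h = 0"
        using False by (intro poly_mapping_eqI) (simp add: lookup_frob_split lookup_single when_def frob_root_simps)
      ultimately show ?thesis by (simp add: eq)
    qed
  qed (auto simp: frob_split_add frob_split_zero frobenius_add[OF two_mpoly] distrib_right power_0_left)
qed (auto simp: frob_split_add frob_split_zero distrib_left)

text \<open>Pigeonhole on exponents: each generator leaves a remainder of at most
  \<open>q - 1\<close>, so at least \<open>l\<close> full q-th powers of generators come out, and
  these pass through the splitting.\<close>

lemma frob_split_power_ideal:
  fixes h :: "('x, 'k) mpolynomial"
  assumes S: "finite S" and a: "\<And>x. lookup a x < 2 ^ e"
    and L: "2 ^ e * l + card S * (2 ^ e - 1) \<le> L" and h: "h \<in> power_ideal S L"
  shows "frob_split e a h \<in> power_ideal S l"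
proof (rule power_ideal_least[OF _ _ _ h, where P = "\<lambda>h. frob_split e a h \<in> power_ideal S l"])
  fix w r assume w: "L \<le> sum w S"
  let ?q = "2 ^ e :: nat"
  have "w g = ?q * (w g div ?q) + w g mod ?q" for g by simp
  then have "gen_monomial S w = gen_monomial S (\<lambda>g. ?q * (w g div ?q) + w g mod ?q)" by simp
  also have "\<dots> = gen_monomial S (\<lambda>g. w g div ?q) ^ ?q * gen_monomial S (\<lambda>g. w g mod ?q)"
    by (simp only: gen_monomial_add gen_monomial_mult)
  finally have split: "r * gen_monomial S w = gen_monomial S (\<lambda>g. w g div ?q) ^ ?q * (gen_monomial S (\<lambda>g. w g mod ?q) * r)"
    by (simp add: mult_ac)
  have eq: "frob_split e a (r * gen_monomial S w)
      = gen_monomial S (\<lambda>g. w g div ?q) * frob_split e a (gen_monomial S (\<lambda>g. w g mod ?q) * r)"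
    unfolding split by (rule frob_split_power_mult[OF a])
  have "sum w S = ?q * (\<Sum>g\<in>S. w g div ?q) + (\<Sum>g\<in>S. w g mod ?q)"
    by (simp add: sum_distrib_left flip: sum.distrib)
  moreover have "(\<Sum>g\<in>S. w g mod ?q) \<le> card S * (?q - 1)"
    using sum_bounded_above[of S "\<lambda>g. w g mod ?q" "?q - 1"]
    by (simp add: Suc_leI less_eq_Suc_le[symmetric] le_diff_conv2)
  ultimately have "?q * l \<le> ?q * (\<Sum>g\<in>S. w g div ?q)" using w L by linarith
  then have "l \<le> (\<Sum>g\<in>S. w g div ?q)" by simp
  then show "frob_split e a (r * gen_monomial S w) \<in> power_ideal S l"
    unfolding eq by (subst mult.commute) (intro power_ideal_closed(3) power_ideal_base)
qed (auto simp: frob_split_add frob_split_zero intro: power_ideal_closed)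

text \<open>\<open>c0 = g0 ^ k\<close> is the multiplier of the tight closure argument: it lies in
  the k-th ideal power and so makes up for the loss \<open>k\<close>. It is nonzero because the
  polynomial ring is a domain, for which the order on the variables is used. Taking \<open>q\<close>
  above all its degrees turns the splitting of \<open>c0\<close> into a nonzero constant.\<close>

theorem homogeneous_integral_in_span:
  fixes f :: "('x::linorder, 'k) mpolynomial"
  assumes S: "finite S" "\<And>g. g \<in> S \<Longrightarrow> homogeneous 2 g" "\<And>g. g \<in> S \<Longrightarrow> vars_in U g"
    and g0: "g0 \<in> S" "g0 \<noteq> 0"
    and f: "homogeneous d f" "vars_in U f" "integral_over (subalgebra hull S) f"
  shows "f \<in> is_submodule (subalgebra hull S) hull
    {Poly_Mapping.single a 1 | a. mdeg a \<le> 2 * card S + 1 \<and> keys a \<subseteq> U}"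
proof -
  \<comment> \<open>\<open>card S\<close> is the loss in the pigeonhole step. Then
    \<open>d - 2 * l\<close> is at most \<open>2 * card S + 1\<close>, the 1 accounting for odd
    \<open>d\<close>.\<close>
  define l where "l = d div 2 - card S"
  have fl: "f \<in> power_ideal S l"
  proof (cases "d div 2 \<le> card S")
    case True
    then show ?thesis by (simp add: l_def power_ideal_0)
  next
    case False
    obtain k where k: "\<And>N. f ^ N \<in> power_ideal S ((d * N + 1 - k) div 2)"
      using integral_power_in_ideal[OF S(1,2) f(1,3)] by metis
    define c0 where "c0 = g0 ^ k"
    have c0: "c0 \<noteq> 0" "c0 \<in> power_ideal S k"
      using g0 power_ideal_power[OF power_ideal_member[OF S(1) g0(1)]] by (auto simp: c0_def)
    obtain a where a: "a \<in> keys c0" using c0(1) by (metis all_not_in_conv keys_eq_empty)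
    define e where "e = Max (mdeg ` keys c0)"
    have e: "mdeg b < 2 ^ e" if "b \<in> keys c0" for b
    proof -
      have "mdeg b \<le> e" unfolding e_def using that by (intro Max_ge) auto
      then show ?thesis using less_exp[of e] by linarith
    qed
    let ?q = "2 ^ e :: nat"
    have aq: "lookup a x < ?q" for x using e[OF a] lookup_le_mdeg[of a x] by linarith
    \<comment> \<open>A monomial that differs from \<open>a\<close> by a nontrivial q-th power has
      degree at least \<open>q\<close>, so it does not occur in \<open>c0\<close>.\<close>
    have "frob_split e a c0 = Const (frob_root e (lookup c0 a))"
    proof (rule poly_mapping_eqI)
      fix b
      show "lookup (frob_split e a c0) b = lookup (Const (frob_root e (lookup c0 a))) b"
      proof (cases "b = 0")
        case True
        have "mono_scale ?q 0 = (0 :: 'x \<Rightarrow>\<^sub>0 nat)" by (rule poly_mapping_eqI) (simp add: lookup_mono_scale)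
        then show ?thesis using True by (simp add: lookup_frob_split Const_def)
      next
        case False
        then obtain x where x: "lookup b x \<noteq> 0" by (metis lookup_zero poly_mapping_eqI)
        have "?q \<le> ?q * lookup b x" using x by simp
        also have "\<dots> \<le> mdeg (mono_scale ?q b + a)"
          using lookup_le_mdeg[of "mono_scale ?q b + a" x] by (simp add: lookup_add lookup_mono_scale)
        finally have "mono_scale ?q b + a \<notin> keys c0" using e by (meson not_less)
        then show ?thesis
          using False by (simp add: lookup_frob_split Const_def lookup_single in_keys_iff frob_root_simps)
      qed
    qed
    then have "frob_split e a (f ^ ?q * c0) = f * Const (frob_root e (lookup c0 a))"
      by (simp add: frob_split_power_mult[OF aq])
    moreover have "f ^ ?q * c0 \<in> power_ideal S ((d * ?q + 1 - k) div 2 + k)"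
      using k c0(2) by (intro power_ideal_mult)
    then have "frob_split e a (f ^ ?q * c0) \<in> power_ideal S l"
    proof (rule frob_split_power_ideal[OF S(1) aq, rotated])
      have "card S * (?q - 1) \<le> card S * ?q" by simp
      then have "?q * l + card S * (?q - 1) \<le> ?q * l + ?q * card S" by (simp add: mult.commute)
      also have "\<dots> = (d div 2) * ?q" using False by (simp add: l_def algebra_simps flip: distrib_left)
      also have "\<dots> \<le> (d * ?q + 1 - k) div 2 + k"
      proof -
        have "(d div 2) * 2 * ?q \<le> d * ?q" by (intro mult_le_mono1) simp
        \<comment> \<open>The integral equation loses about \<open>k / 2\<close> and the multiplier
          returns \<open>k\<close>.\<close>
        moreover have "A \<le> (B + 1 - k) div 2 + k" if "A * 2 \<le> B" for A B :: nat
          using that by presburger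
        ultimately show ?thesis by (simp add: mult_ac)
      qed
      finally show "?q * l + card S * (?q - 1) \<le> (d * ?q + 1 - k) div 2 + k" .
    qed
    ultimately have "f * Const (frob_root e (lookup c0 a)) \<in> power_ideal S l" by simp
    then have "Const (inverse (frob_root e (lookup c0 a))) * (f * Const (frob_root e (lookup c0 a))) \<in> power_ideal S l"
      by (rule power_ideal_closed)
    moreover have "frob_root e (lookup c0 a) \<noteq> 0" using a by (simp add: frob_root_simps in_keys_iff)
    then have "Const (inverse (frob_root e (lookup c0 a))) * Const (frob_root e (lookup c0 a))
        = (1 :: ('x, 'k) mpolynomial)" by (simp add: Const_def mult_single)
    ultimately show ?thesis by (simp add: mult.left_commute)
  qed
  have "f \<in> is_submodule (subalgebra hull S) hull
    {Poly_Mapping.single a 1 | a. mdeg a \<le> d - 2 * l \<and> keys a \<subseteq> U}"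
    by (rule homogeneous_in_span[OF S(1,2) fl f(1,2) S(3)])
  also have "\<dots> \<subseteq> is_submodule (subalgebra hull S) hull
    {Poly_Mapping.single a 1 | a. mdeg a \<le> 2 * card S + 1 \<and> keys a \<subseteq> U}"
  proof (rule hull_mono)
    have "d - 2 * l \<le> 2 * card S + 1" unfolding l_def by presburger
    then show "{Poly_Mapping.single a (1::'k) | a. mdeg a \<le> d - 2 * l \<and> keys a \<subseteq> U}
      \<subseteq> {Poly_Mapping.single a 1 | a. mdeg a \<le> 2 * card S + 1 \<and> keys a \<subseteq> U}"
      by (auto intro: order_trans)
  qed
  finally show ?thesis .
qed

end

section \<open>Reflections and the special orthogonal group\<close>

lemma qf_ring_map: "ring_map \<eta> \<Longrightarrow> \<eta> (qf n v) = qf n (\<lambda>r. \<eta> (v r))"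
  by (simp add: qf_def ring_map_sum ring_map_simps)

lemma bf_ring_map: "ring_map \<eta> \<Longrightarrow> \<eta> (bf n v w) = bf n (\<lambda>r. \<eta> (v r)) (\<lambda>r. \<eta> (w r))"
  by (simp add: bf_def ring_map_sum ring_map_simps)

lemma qf_cong: "(\<And>r. r < n \<Longrightarrow> v r = w r) \<Longrightarrow> qf n v = qf n w"
  unfolding qf_def by (intro arg_cong2[of _ _ _ _ "(+)"] sum.cong) (auto elim!: oddE)

lemma bf_cong: "(\<And>r. r < n \<Longrightarrow> v r = v' r) \<Longrightarrow> (\<And>r. r < n \<Longrightarrow> w r = w' r) \<Longrightarrow> bf n v w = bf n v' w'"
  unfolding bf_def by (intro sum.cong) auto

lemma quad_form_vec: "quad_form (vec n v) = qf n v"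
  unfolding quad_form_def qf_def Let_def dim_vec
  by (intro arg_cong2[of _ _ _ _ "(+)"] sum.cong) (auto elim!: oddE)

lemma bf_expand: "(\<Sum>c<n. bf n (unit_fun c) u * v c) = bf n v u"
proof -
  have *: "(\<Sum>c<n. unit_fun c t * v c) = v t" if "t < n" for t
    using that by (simp add: unit_fun_def if_distrib[of "\<lambda>x. x * _"] cong: if_cong)
  have "(\<Sum>c<n. bf n (unit_fun c) u * v c)
      = (\<Sum>t<n div 2. (\<Sum>c<n. unit_fun c t * v c) * u (n div 2 + t) + (\<Sum>c<n. unit_fun c (n div 2 + t) * v c) * u t)"
    unfolding bf_def sum_distrib_right
    by (subst sum.swap) (auto simp: sum.distrib sum_distrib_left sum_distrib_right algebra_simps intro!: sum.cong)
  also have "\<dots> = bf n v u" unfolding bf_def by (intro sum.cong) (auto simp: *)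
  finally show ?thesis .
qed

definition refl_mat :: "nat \<Rightarrow> (nat \<Rightarrow> 'k::field) \<Rightarrow> 'k mat" where
  "refl_mat n u = mat n n (\<lambda>(r, c). (if r = c then 1 else 0) + bf n (unit_fun c) u / qf n u * u r)"

lemma refl_mat_carrier [simp]: "refl_mat n u \<in> carrier_mat n n"
  by (simp add: refl_mat_def)

lemma refl_mat_vec: "refl_mat n u *\<^sub>v vec n v = vec n (reflect n u v)"
proof (rule eq_vecI)
  fix r assume "r < dim_vec (vec n (reflect n u v))"
  then have r: "r < n" by simp
  have "(refl_mat n u *\<^sub>v vec n v) $ r = (\<Sum>c<n. ((if r = c then 1 else 0) + bf n (unit_fun c) u / qf n u * u r) * v c)"
    using r by (simp add: refl_mat_def scalar_prod_def atLeast0LessThan)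
  also have "\<dots> = (\<Sum>c<n. (if r = c then 1 else 0) * v c) + (\<Sum>c<n. bf n (unit_fun c) u * v c) / qf n u * u r"
    by (simp add: algebra_simps sum.distrib sum_distrib_left sum_divide_distrib)
  also have "\<dots> = reflect n u v r"
    using r by (simp add: bf_expand reflect_def if_distrib[of "\<lambda>x. x * _"] cong: if_cong)
  finally show "(refl_mat n u *\<^sub>v vec n v) $ r = vec n (reflect n u v) $ r" using r by simp
qed (simp add: refl_mat_def)

lemma vec_eta: "v \<in> carrier_vec n \<Longrightarrow> v = vec n (\<lambda>r. v $ r)"
  by auto

lemma mat_eq_if_mult_vec:
  fixes A B :: "'k::comm_ring_1 mat"
  assumes A: "A \<in> carrier_mat n n" "B \<in> carrier_mat n n"
    and "\<And>v. v \<in> carrier_vec n \<Longrightarrow> A *\<^sub>v v = B *\<^sub>v v"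
  shows "A = B"
proof (rule mat_col_eqI)
  fix i assume "i < dim_col B"
  then have i: "i < n" using A by simp
  have "C *\<^sub>v unit_vec n i = col C i" if "C \<in> carrier_mat n n" for C :: "'k mat"
    using that i by (intro eq_vecI) auto
  then show "col A i = col B i" using assms(3)[of "unit_vec n i"] A by simp
qed (use A in auto)

context alg_closed_char2
begin

sublocale char2 n ty for n
  by standard (rule two)

lemma refl_mat_square:
  assumes "qf n u \<noteq> (0 :: 'k)"
  shows "refl_mat n u * refl_mat n u = 1\<^sub>m n"
proof (rule mat_eq_if_mult_vec)
  fix v :: "'k vec" assume v: "v \<in> carrier_vec n"
  have "refl_mat n u *\<^sub>v (refl_mat n u *\<^sub>v vec n (\<lambda>r. v $ r)) = vec n (\<lambda>r. v $ r)"
    by (simp add: refl_mat_vec reflect_reflect[OF assms])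
  then show "(refl_mat n u * refl_mat n u) *\<^sub>v v = 1\<^sub>m n *\<^sub>v v"
    using v vec_eta[OF v] assoc_mult_mat_vec[OF refl_mat_carrier refl_mat_carrier v] by simp
qed (use mult_carrier_mat[OF refl_mat_carrier refl_mat_carrier] in auto)

lemma refl_mat_prod_orth:
  assumes u: "qf n u \<noteq> (0 :: 'k)" and w: "qf n w \<noteq> 0"
  shows "refl_mat n u * refl_mat n w \<in> orth_group n"
proof -
  let ?A = "refl_mat n u" and ?B = "refl_mat n w"
  have inv: "(refl_mat n x * refl_mat n y) * (refl_mat n y * refl_mat n x) = 1\<^sub>m n"
    if "qf n x \<noteq> 0" "qf n y \<noteq> 0" for x y :: "nat \<Rightarrow> 'k"
  proof -
    have "(refl_mat n x * refl_mat n y) * (refl_mat n y * refl_mat n x)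
        = refl_mat n x * (refl_mat n y * refl_mat n y) * refl_mat n x"
      by (simp add: assoc_mult_mat[where ?n\<^sub>1 = n and ?n\<^sub>2 = n and ?n\<^sub>3 = n and ?n\<^sub>4 = n]
          mult_carrier_mat[where n = n and nr = n and nc = n])
    then show ?thesis using that by (simp add: refl_mat_square right_mult_one_mat[OF refl_mat_carrier])
  qed
  have "invertible_mat (?A * ?B)"
    unfolding invertible_mat_def inverts_mat_def
    using inv[OF u w] inv[OF w u]
    by (intro conjI exI[of _ "?B * ?A"]) (auto simp: refl_mat_def)
  moreover have "quad_form ((?A * ?B) *\<^sub>v v) = quad_form v" if v: "v \<in> carrier_vec n" for v
  proof -
    have "(?A * ?B) *\<^sub>v v = ?A *\<^sub>v (?B *\<^sub>v vec n (\<lambda>r. v $ r))"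
      using v vec_eta[OF v] assoc_mult_mat_vec[OF refl_mat_carrier refl_mat_carrier v] by simp
    then have "(?A * ?B) *\<^sub>v v = vec n (reflect n u (reflect n w (\<lambda>r. v $ r)))" by (simp add: refl_mat_vec)
    then show ?thesis using vec_eta[OF v] u w by (metis quad_form_vec qf_reflect)
  qed
  moreover have "?A * ?B \<in> carrier_mat n n" using mult_carrier_mat[OF refl_mat_carrier refl_mat_carrier] .
  ultimately show ?thesis by (simp add: orth_group_def)
qed

text \<open>Regular functions on the locus where \<open>D\<close> does not vanish: a polynomial over
  a power of \<open>D\<close>. Values at the zeros of \<open>D\<close> are ignored.\<close>

definition ratl :: "'k poly \<Rightarrow> ('k \<Rightarrow> 'k) \<Rightarrow> bool" where
  "ratl D \<phi> \<longleftrightarrow> (\<exists>F N. \<forall>t. poly D t \<noteq> 0 \<longrightarrow> poly F t = poly D t ^ N * \<phi> t)"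

lemma ratl_poly: "ratl D (poly p)"
  unfolding ratl_def by (intro exI[of _ p] exI[of _ 0]) simp

lemma ratl_const: "ratl D (\<lambda>_. c)"
  unfolding ratl_def by (intro exI[of _ "[:c:]"] exI[of _ 0]) simp

lemma ratl_inverse: "ratl D (\<lambda>t. inverse (poly D t))"
  unfolding ratl_def by (intro exI[of _ 1] exI[of _ 1]) simp

lemma ratl_add:
  assumes "ratl D \<phi>" "ratl D \<psi>"
  shows "ratl D (\<lambda>t. \<phi> t + \<psi> t)"
proof -
  obtain F N G M where "\<forall>t. poly D t \<noteq> 0 \<longrightarrow> poly F t = poly D t ^ N * \<phi> t"
    "\<forall>t. poly D t \<noteq> 0 \<longrightarrow> poly G t = poly D t ^ M * \<psi> t" using assms unfolding ratl_def by blast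
  then show ?thesis unfolding ratl_def
    by (intro exI[of _ "D ^ M * F + D ^ N * G"] exI[of _ "N + M"]) (auto simp: algebra_simps power_add)
qed

lemma ratl_mult:
  assumes "ratl D \<phi>" "ratl D \<psi>"
  shows "ratl D (\<lambda>t. \<phi> t * \<psi> t)"
proof -
  obtain F N G M where "\<forall>t. poly D t \<noteq> 0 \<longrightarrow> poly F t = poly D t ^ N * \<phi> t"
    "\<forall>t. poly D t \<noteq> 0 \<longrightarrow> poly G t = poly D t ^ M * \<psi> t" using assms unfolding ratl_def by blast
  then show ?thesis unfolding ratl_def
    by (intro exI[of _ "F * G"] exI[of _ "N + M"]) (auto simp: algebra_simps power_add)
qed

lemma ratl_sum: "(\<And>i. i \<in> I \<Longrightarrow> ratl D (\<phi> i)) \<Longrightarrow> ratl D (\<lambda>t. \<Sum>i\<in>I. \<phi> i t)"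
  by (induction I rule: infinite_finite_induct) (auto intro: ratl_add ratl_const)

lemma ratl_prod: "(\<And>i. i \<in> I \<Longrightarrow> ratl D (\<phi> i)) \<Longrightarrow> ratl D (\<lambda>t. \<Prod>i\<in>I. \<phi> i t)"
  by (induction I rule: infinite_finite_induct) (auto intro: ratl_mult ratl_const)

lemma ratl_power: "ratl D \<phi> \<Longrightarrow> ratl D (\<lambda>t. \<phi> t ^ N)"
  by (induction N) (auto intro: ratl_mult ratl_const)

lemma ratl_eval:
  assumes "vars_in U p" "\<And>x. x \<in> U \<Longrightarrow> ratl D (\<lambda>t. s t x)"
  shows "ratl D (\<lambda>t. eval_mpoly id (s t) p)"
  unfolding eval_mpoly_def using assms
  by (intro ratl_sum ratl_mult ratl_prod ratl_power ratl_const) (auto simp: vars_in_def)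

lemma ring_map_poly: "ring_map (\<lambda>p :: 'k poly. poly p t)"
  by (simp add: ring_map_def)

text \<open>The segment from \<open>w\<close> to \<open>u\<close> yields a path of products of two reflections from the identity to
  \<open>refl_mat n u * refl_mat n w\<close>, defined off the zeros of a polynomial in one variable. Zariski open
  sets pull back to empty or cofinite subsets of the parameter line, so the path is connected.\<close>

lemma refl_mat_prod_special_orth:
  assumes u: "qf n u \<noteq> (0 :: 'k)" and w: "qf n w \<noteq> 0"
  shows "refl_mat n u * refl_mat n w \<in> special_orth_group n"
proof -
  \<comment> \<open>The line from \<open>w\<close> in direction \<open>u + w\<close>; in
    characteristic 2 it reaches \<open>u\<close> at parameter 1.\<close>
  define L where "L = (\<lambda>r. [:w r, u r + w r:])"
  define D where "D = qf n L"
  define line where "line t = (\<lambda>r. poly (L r) t)" for t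
  define \<gamma> where "\<gamma> t = refl_mat n (line t) * refl_mat n w" for t
  have D: "poly D t = qf n (line t)" for t
    unfolding D_def line_def by (rule qf_ring_map[OF ring_map_poly])
  have line01: "line 0 = w" "line 1 = u" by (auto simp: line_def L_def add.commute two)
  have D01: "poly D 0 \<noteq> 0" "poly D 1 \<noteq> 0" using u w by (auto simp: D line01)
  have D0: "D \<noteq> 0" using D01 by auto
  let ?T = "{t. poly D t \<noteq> 0}"
  have orth: "\<gamma> t \<in> orth_group n" if "t \<in> ?T" for t
    using that w refl_mat_prod_orth by (simp add: \<gamma>_def D)
  have entry: "ratl D (\<lambda>t. \<gamma> t $$ (r, c))" if rc: "r < n" "c < n" for r c
  proof -
    have "ratl D (\<lambda>t. (if r = j then 1 else 0) + poly (bf n (\<lambda>i. [:unit_fun j i:]) L) t * inverse (poly D t) * poly (L r) t)" for j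
      by (intro ratl_add ratl_mult ratl_inverse ratl_poly ratl_const)
    moreover have "poly (bf n (\<lambda>i. [:unit_fun j i:]) L) t = bf n (unit_fun j) (line t)" for j t
      unfolding line_def by (subst bf_ring_map[OF ring_map_poly]) simp
    ultimately have "ratl D (\<lambda>t. refl_mat n (line t) $$ (r, j))" if "j < n" for j
      using rc that by (simp add: refl_mat_def D line_def divide_inverse)
    then have "ratl D (\<lambda>t. \<Sum>j<n. refl_mat n (line t) $$ (r, j) * refl_mat n w $$ (j, c))"
      by (intro ratl_sum ratl_mult ratl_const) auto
    moreover have "\<gamma> t $$ (r, c) = (\<Sum>j<n. refl_mat n (line t) $$ (r, j) * refl_mat n w $$ (j, c))" for t
      using rc by (simp add: \<gamma>_def refl_mat_def scalar_prod_def atLeast0LessThan)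
    ultimately show ?thesis by simp
  qed
  \<comment> \<open>Being empty or cofinite survives finite intersections and arbitrary unions; a
    basic open set pulls back to the nonvanishing locus of the numerator of a regular
    function.\<close>
  have pull: "?T \<inter> \<gamma> -` E = {} \<or> finite (?T - \<gamma> -` E)" if "openin (zariski_mat n) E" for E
    using that unfolding zariski_mat_def openin_topology_generated_by_iff
  proof (induction rule: generate_topology_on.induct)
    case (Int a b)
    then show ?case by (auto simp: vimage_Int Diff_Int)
  next
    case (UN K)
    show ?case
    proof (cases "\<exists>k\<in>K. finite (?T - \<gamma> -` k)")
      case True
      then obtain k where "k \<in> K" "finite (?T - \<gamma> -` k)" by blast
      then have "finite (?T - \<gamma> -` \<Union>K)" by (auto elim: rev_finite_subset)
      then show ?thesis by blast
    next
      case False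
      then show ?thesis using UN by blast
    qed
  next
    case (Basis E)
    then obtain p where p: "E = {g \<in> carrier_mat n n. eval_mpoly id (\<lambda>rc. g $$ rc) p \<noteq> 0}" "p \<in> poly_ring n n"
      by blast
    have "ratl D (\<lambda>t. eval_mpoly id (\<lambda>rc. \<gamma> t $$ rc) p)"
      using p(2) entry by (intro ratl_eval) (auto simp: poly_ring_vars_in)
    then obtain F N where F: "\<And>t. poly D t \<noteq> 0 \<Longrightarrow> poly F t = poly D t ^ N * eval_mpoly id (\<lambda>rc. \<gamma> t $$ rc) p"
      unfolding ratl_def by blast
    have iff: "\<gamma> t \<in> E \<longleftrightarrow> poly F t \<noteq> 0" if "t \<in> ?T" for t
      using F[of t] that orth[OF that] by (auto simp: p(1) orth_group_def)
    show ?case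
    proof (cases "F = 0")
      case True
      then show ?thesis using iff by auto
    next
      case False
      then have "finite {t. poly F t = 0}" by (rule poly_roots_finite)
      then have "finite (?T - \<gamma> -` E)" by (rule rev_finite_subset) (use iff in auto)
      then show ?thesis by blast
    qed
  qed auto
  \<comment> \<open>The constant polynomial 1 shows that every matrix is a point of the
    topology.\<close>
  have "openin (zariski_mat n) {g \<in> carrier_mat n n. eval_mpoly id (\<lambda>rc. g $$ rc) (1 :: (nat \<times> nat, 'k) mpolynomial) \<noteq> 0}"
    unfolding zariski_mat_def
    by (rule topology_generated_by_Basis) (auto simp: poly_ring_vars_in intro!: exI[of _ "1 :: (nat \<times> nat, 'k) mpolynomial"])
  moreover have "eval_mpoly id s (1 :: (nat \<times> nat, 'k) mpolynomial) = 1" for s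
    using ring_map_simps(1)[OF ring_map_eval[OF ring_map_id(1)]] .
  ultimately have "carrier_mat n n \<subseteq> topspace (zariski_mat n :: 'k mat topology)"
    using openin_subset by fastforce
  moreover have "\<gamma> ` ?T \<subseteq> carrier_mat n n" using orth by (auto simp: orth_group_def)
  ultimately have top: "\<gamma> ` ?T \<subseteq> topspace (zariski_mat n)" by blast
  have infT: "infinite ?T"
  proof
    assume "finite ?T"
    moreover have "finite {t. poly D t = 0}" using D0 by (rule poly_roots_finite)
    ultimately have "finite (?T \<union> {t. poly D t = 0})" by blast
    then show False using infinite_field by (simp add: Un_def)
  qed
  have "connectedin (zariski_mat n) (\<gamma> ` ?T)"
    unfolding connectedin
  proof (intro conjI top notI, elim exE conjE)
    fix E1 E2
    assume E: "openin (zariski_mat n) E1" "openin (zariski_mat n) E2"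
      and disj: "E1 \<inter> E2 \<inter> \<gamma> ` ?T = {}" and ne: "E1 \<inter> \<gamma> ` ?T \<noteq> {}" "E2 \<inter> \<gamma> ` ?T \<noteq> {}"
    have "finite (?T - \<gamma> -` E1)" "finite (?T - \<gamma> -` E2)" using pull[OF E(1)] pull[OF E(2)] ne by blast+
    then have "finite ((?T - \<gamma> -` E1) \<union> (?T - \<gamma> -` E2))" by blast
    moreover have "?T \<subseteq> (?T - \<gamma> -` E1) \<union> (?T - \<gamma> -` E2)" using disj by blast
    ultimately show False using infT finite_subset by blast
  qed
  then have "connectedin (subtopology (zariski_mat n) (orth_group n)) (\<gamma> ` ?T)"
    using orth by (auto simp: connectedin_subtopology)
  moreover have "\<gamma> 0 = 1\<^sub>m n" using refl_mat_square[OF w] by (simp add: \<gamma>_def line01)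
  then have "1\<^sub>m n \<in> \<gamma> ` ?T" using D01 by (metis (mono_tags) image_eqI mem_Collect_eq)
  moreover have "refl_mat n u * refl_mat n w \<in> \<gamma> ` ?T"
    using D01 by (intro image_eqI[of _ _ 1]) (auto simp: \<gamma>_def line01)
  ultimately show ?thesis
    unfolding special_orth_group_def connected_component_of_def by blast
qed

lemma special_orth_subset: "special_orth_group n \<subseteq> (orth_group n :: 'k mat set)"
  unfolding special_orth_group_def connected_component_of_def
  by (auto simp: connectedin_subtopology)

end

section \<open>Invariants\<close>

text \<open>It agrees with the substitution in \<open>diag_subst\<close> on the indices that occur,
  but is defined as zero for rows outside the range, so that all its values are homogeneous of
  degree 1.\<close>

definition lin_subst :: "nat \<Rightarrow> 'k::comm_ring_1 mat \<Rightarrow> nat \<times> nat \<Rightarrow> (nat \<times> nat, 'k) mpolynomial" where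
  "lin_subst n g = (\<lambda>(r, i). if r < n then \<Sum>c<n. Const (g $$ (r, c)) * Var (c, i) else 0)"

lemma diag_subst_lin_subst:
  assumes g: "g \<in> carrier_mat n n" and f: "f \<in> poly_ring n m"
  shows "diag_subst n g f = eval_mpoly Const (lin_subst n g) f"
  unfolding diag_subst_def
proof (rule eval_cong)
  show "vars_in ({..<n} \<times> {..<m}) f" using f by (simp add: poly_ring_vars_in)
  fix x :: "nat \<times> nat" assume "x \<in> {..<n} \<times> {..<m}"
  then obtain r i where "x = (r, i)" "r < n" by auto
  then show "(case x of (r, i) \<Rightarrow> (map_mat Const g *\<^sub>v indet_vec n i) $ r) = lin_subst n g x"
    using g by (auto simp: lin_subst_def indet_vec_def scalar_prod_def atLeast0LessThan)
qed

lemma homogeneous_monom_val: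
  fixes s :: "'x \<Rightarrow> ('y, 'k::comm_ring_1) mpolynomial"
  assumes "\<And>x. homogeneous 1 (s x)"
  shows "homogeneous (mdeg a) (monom_val s a)"
proof -
  have "homogeneous (\<Sum>x\<in>keys a. 1 * lookup a x) (monom_val s a)"
    unfolding monom_val_def using assms by (intro homogeneous_prod homogeneous_power)
  then show ?thesis by (simp add: mdeg_def)
qed

lemma homog_part_eval:
  fixes s :: "'x \<Rightarrow> ('y, 'k::comm_ring_1) mpolynomial"
  assumes "\<And>x. homogeneous 1 (s x)"
  shows "homog_part d (eval_mpoly Const s f) = eval_mpoly Const s (homog_part d f)"
proof (rule mpoly_induct[of f])
  fix a c
  have "homogeneous (0 + mdeg a) (Const c * monom_val s a)"
    by (intro homogeneous_mult homogeneous_Const homogeneous_monom_val assms)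
  then show "homog_part d (eval_mpoly Const s (Poly_Mapping.single a c))
      = eval_mpoly Const s (homog_part d (Poly_Mapping.single a c))"
    by (cases "d = mdeg a")
      (auto simp: eval_single[OF ring_map_Const] part_single homog_part_id homog_part_other)
qed (auto simp: eval_add[OF ring_map_Const] part_add)

lemma homogeneous_lin_subst: "homogeneous 1 (lin_subst n g x)"
proof -
  have "homogeneous (0 + 1) (Const c * Var y)" for c and y :: "nat \<times> nat"
    by (intro homogeneous_mult homogeneous_Const homogeneous_Var)
  then show ?thesis by (auto simp: lin_subst_def split: prod.splits intro!: homogeneous_sum)
qed

lemma poly_ring_part: "f \<in> poly_ring n m \<Longrightarrow> part T f \<in> poly_ring n m"
  by (simp add: poly_ring_vars_in vars_in_part)

lemma diag_subst_poly_ring: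
  assumes "g \<in> carrier_mat n n" "f \<in> poly_ring n m"
  shows "diag_subst n g f \<in> poly_ring n m"
  unfolding diag_subst_lin_subst[OF assms] eval_mpoly_def poly_ring_vars_in
proof (intro vars_in_sum vars_in_mult vars_in_prod vars_in_power vars_in_Const)
  fix a x assume "a \<in> keys f" "x \<in> keys a"
  then have "x \<in> {..<n} \<times> {..<m}" using assms(2) by (auto simp: poly_ring_def)
  then show "vars_in ({..<n} \<times> {..<m}) (lin_subst n g x)"
    by (auto simp: lin_subst_def intro!: vars_in_sum vars_in_mult vars_in_Var)
qed

lemma invariants_homog_part:
  assumes G: "G \<subseteq> carrier_mat n n" and f: "f \<in> invariants n m G"
  shows "homog_part d f \<in> invariants n m G"
proof -
  have fR: "f \<in> poly_ring n m" using f by (simp add: invariants_def)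
  have "diag_subst n g (homog_part d f) = homog_part d f" if g: "g \<in> G" for g
  proof -
    have gc: "g \<in> carrier_mat n n" using G g by blast
    have "diag_subst n g (homog_part d f) = homog_part d (diag_subst n g f)"
      unfolding diag_subst_lin_subst[OF gc fR] diag_subst_lin_subst[OF gc poly_ring_part[OF fR]]
      by (rule homog_part_eval[OF homogeneous_lin_subst, symmetric])
    then show ?thesis using f g by (simp add: invariants_def)
  qed
  then show ?thesis using poly_ring_part[OF fR] by (simp add: invariants_def)
qed

definition act_pt :: "nat \<Rightarrow> 'k::comm_ring_1 mat \<Rightarrow> (nat \<times> nat \<Rightarrow> 'k) \<Rightarrow> nat \<times> nat \<Rightarrow> 'k" where
  "act_pt n g s = (\<lambda>(r, i). (g *\<^sub>v vec n (\<lambda>c. s (c, i))) $ r)"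

lemma eval_diag_subst:
  assumes g: "g \<in> carrier_mat n n" and f: "f \<in> poly_ring n m"
  shows "eval_mpoly id s (diag_subst n g f) = eval_mpoly id (act_pt n g s) f"
proof -
  have id: "ring_map (id :: 'a \<Rightarrow> 'a)" by simp
  have "eval_mpoly id s (diag_subst n g f) = eval_mpoly (\<lambda>c. eval_mpoly id s (Const c)) (\<lambda>x. eval_mpoly id s (lin_subst n g x)) f"
    unfolding diag_subst_lin_subst[OF assms] by (rule ring_map_comp_eval[OF ring_map_Const ring_map_eval[OF id]])
  also have "\<dots> = eval_mpoly id (\<lambda>x. eval_mpoly id s (lin_subst n g x)) f"
    by (simp only: eval_Const[OF id])
  also have "\<dots> = eval_mpoly id (act_pt n g s) f"
  proof (rule eval_cong)
    show "vars_in ({..<n} \<times> {..<m}) f" using f by (simp add: poly_ring_vars_in)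
    fix x :: "nat \<times> nat" assume "x \<in> {..<n} \<times> {..<m}"
    then obtain r i where x: "x = (r, i)" "r < n" by auto
    have "eval_mpoly id s (lin_subst n g x) = (\<Sum>c<n. g $$ (r, c) * s (c, i))"
      using x by (simp add: lin_subst_def ring_map_sum[OF ring_map_eval[OF id]] eval_mult[OF id] eval_Const[OF id] eval_Var[OF id])
    then show "eval_mpoly id s (lin_subst n g x) = act_pt n g s x"
      using x g by (simp add: act_pt_def scalar_prod_def atLeast0LessThan)
  qed
  finally show ?thesis .
qed

lemma eval_Const_Var: "eval_mpoly Const Var f = (f :: ('x, 'k::comm_ring_1) mpolynomial)"
proof (rule mpoly_induct[of f])
  fix a :: "'x \<Rightarrow>\<^sub>0 nat" and c :: 'k
  have "monom_val Var b = (Poly_Mapping.single b 1 :: ('x, 'k) mpolynomial)" for b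
  proof (rule mpoly_induct[of b])
    fix x k
    have "Var x ^ k = (Poly_Mapping.single (Poly_Mapping.single x k) 1 :: ('x, 'k) mpolynomial)" for k
      by (induction k) (auto simp: Var_def mult_single simp flip: single_add)
    then show "monom_val Var (Poly_Mapping.single x k)
        = (Poly_Mapping.single (Poly_Mapping.single x k) 1 :: ('x, 'k) mpolynomial)" by simp
  qed (auto simp: monom_val_add mult_single)
  then show "eval_mpoly Const Var (Poly_Mapping.single a c) = Poly_Mapping.single a c"
    by (simp add: eval_single[OF ring_map_Const] Const_def mult_single)
qed (auto simp: eval_add[OF ring_map_Const])

lemma Q_poly_qf: "Q_poly n i = qf n (\<lambda>r. Var (r, i))"
  by (simp add: Q_poly_def indet_vec_def quad_form_vec)

text \<open>A reflection acting on all columns at once, free of matrices because it is needed over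
  the extension field as well.\<close>

definition move :: "nat \<Rightarrow> (nat \<Rightarrow> 'a::field) \<Rightarrow> (nat \<times> nat \<Rightarrow> 'a) \<Rightarrow> nat \<times> nat \<Rightarrow> 'a" where
  "move n u s = (\<lambda>(r, i). reflect n u (\<lambda>r. s (r, i)) r)"

lemma vars_in_qf: "(\<And>r. r < n \<Longrightarrow> vars_in U (v r)) \<Longrightarrow> vars_in U (qf n v)"
  unfolding qf_def
  by (auto intro!: vars_in_add vars_in_sum vars_in_mult vars_in_power elim!: oddE)

lemma vars_in_bf: "(\<And>r. r < n \<Longrightarrow> vars_in U (v r)) \<Longrightarrow> (\<And>r. r < n \<Longrightarrow> vars_in U (w r)) \<Longrightarrow> vars_in U (bf n v w)"
  unfolding bf_def by (intro vars_in_sum vars_in_add vars_in_mult) auto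

lemma homogeneous_qf:
  assumes "\<And>r. r < n \<Longrightarrow> homogeneous 1 (v r)" shows "homogeneous 2 (qf n v)"
proof -
  have mult: "homogeneous 2 (v r * v r')" if "r < n" "r' < n" for r r'
    using homogeneous_mult[of 1 "v r" 1 "v r'"] assms that by (simp add: numeral_2_eq_2)
  show ?thesis unfolding qf_def power2_eq_square
    by (auto intro!: homogeneous_add homogeneous_sum mult elim!: oddE)
qed

lemma homogeneous_bf:
  assumes "\<And>r. r < n \<Longrightarrow> homogeneous 1 (v r)" "\<And>r. r < n \<Longrightarrow> homogeneous 1 (w r)"
  shows "homogeneous 2 (bf n v w)"
proof -
  have mult: "homogeneous 2 (v r * w r')" if "r < n" "r' < n" for r r'
    using homogeneous_mult[of 1 "v r" 1 "w r'"] assms that by (simp add: numeral_2_eq_2)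
  show ?thesis unfolding bf_def
    by (auto intro!: homogeneous_add homogeneous_sum mult)
qed

lemma finite_bounded_monomials:
  assumes "finite U"
  shows "finite {a :: 'x \<Rightarrow>\<^sub>0 nat. mdeg a \<le> d \<and> keys a \<subseteq> U}"
proof (rule inj_on_finite)
  show "inj_on (\<lambda>a. restrict (lookup a) U) {a. mdeg a \<le> d \<and> keys a \<subseteq> U}"
  proof (rule inj_onI, rule poly_mapping_eqI)
    fix a b :: "'x \<Rightarrow>\<^sub>0 nat" and x
    assume *: "a \<in> {a. mdeg a \<le> d \<and> keys a \<subseteq> U}" "b \<in> {a. mdeg a \<le> d \<and> keys a \<subseteq> U}"
      "restrict (lookup a) U = restrict (lookup b) U"
    show "lookup a x = lookup b x"
    proof (cases "x \<in> U")
      case True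
      then show ?thesis using fun_cong[OF *(3), of x] by simp
    next
      case False
      then have "x \<notin> keys a" "x \<notin> keys b" using * by auto
      then show ?thesis by (simp add: in_keys_iff)
    qed
  qed
  show "(\<lambda>a. restrict (lookup a) U) ` {a. mdeg a \<le> d \<and> keys a \<subseteq> U} \<subseteq> (PiE U (\<lambda>_. {..d}))"
  proof clarify
    fix a :: "'x \<Rightarrow>\<^sub>0 nat" assume "mdeg a \<le> d"
    then have "lookup a x \<le> d" for x using lookup_le_mdeg[of a x] by linarith
    then show "restrict (lookup a) U \<in> PiE U (\<lambda>_. {..d})" by auto
  qed
  show "finite (PiE U (\<lambda>_. {..d}))" using assms by (intro finite_PiE) auto
qed

context alg_closed_char2
begin

lemma polar_form_vec: "polar_form (vec n v) (vec n w) = bf n v (w :: nat \<Rightarrow> ('x, 'k) mpolynomial)"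
proof -
  have "vec n v + vec n w = vec n (\<lambda>r. v r + w r)" by auto
  then show ?thesis by (simp add: polar_form_def quad_form_vec qf_add_general two_mpoly)
qed

lemma B_poly_bf: "(B_poly n i j :: (nat \<times> nat, 'k) mpolynomial) = bf n (\<lambda>r. Var (r, i)) (\<lambda>r. Var (r, j))"
  by (simp add: B_poly_def indet_vec_def polar_form_vec)

abbreviation QB :: "nat \<Rightarrow> nat \<Rightarrow> (nat \<times> nat, 'k) mpolynomial set" where
  "QB n m \<equiv> {Q_poly n i | i. i < m} \<union> {B_poly n i j | i j. i < j \<and> j < m}"

lemma QB_properties:
  shows "finite (QB n m)" "g \<in> QB n m \<Longrightarrow> homogeneous 2 g" "g \<in> QB n m \<Longrightarrow> vars_in ({..<n} \<times> {..<m}) g"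
proof -
  have "finite {B_poly n i j :: (nat \<times> nat, 'k) mpolynomial | i j. i < j \<and> j < m}"
    by (rule finite_subset[of _ "(\<lambda>(i, j). B_poly n i j) ` ({..<m} \<times> {..<m})"]) auto
  moreover have "finite {Q_poly n i :: (nat \<times> nat, 'k) mpolynomial | i. i < m}" by simp
  ultimately show "finite (QB n m)" by blast
  show "g \<in> QB n m \<Longrightarrow> homogeneous 2 g"
    by (auto simp: Q_poly_qf B_poly_bf intro!: homogeneous_qf homogeneous_bf homogeneous_Var)
  show "g \<in> QB n m \<Longrightarrow> vars_in ({..<n} \<times> {..<m}) g"
    by (auto simp: Q_poly_qf B_poly_bf intro!: vars_in_qf vars_in_bf vars_in_Var)
qed

lemma exists_nonsingular:
  assumes "n \<ge> 1"
  obtains u where "qf n u \<noteq> (0 :: 'k)"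
proof (cases "odd n")
  case True
  define z where "z = 2 * (n div 2)"
  have "(\<Sum>t<n div 2. unit_fun z t * unit_fun z (n div 2 + t)) = (0 :: 'k)"
    by (intro sum.neutral) (auto simp: unit_fun_def z_def)
  then have "qf n (unit_fun z) = (1 :: 'k)"
    using True unfolding qf_def z_def[symmetric] by (simp add: unit_fun_def)
  then show thesis using that by (metis zero_neq_one)
next
  case False
  then have n: "0 < n div 2" using assms by (auto elim!: evenE)
  have "qf n (\<lambda>r. unit_fun 0 r + unit_fun (n div 2 + 0) r) = (1 :: 'k)"
    using n by (subst qf_add, subst bf_unit_high) (auto simp: qf_unit unit_fun_def)
  then show thesis using that by (metis zero_neq_one)
qed

lemma Q_poly_nonzero:
  assumes "n \<ge> 1"
  shows "Q_poly n i \<noteq> (0 :: (nat \<times> nat, 'k) mpolynomial)"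
proof
  assume "Q_poly n i = (0 :: (nat \<times> nat, 'k) mpolynomial)"
  obtain u where u: "qf n u \<noteq> (0 :: 'k)" using exists_nonsingular[OF assms] .
  have "eval_mpoly id (\<lambda>(r, i). u r) (Q_poly n i) = qf n u"
    unfolding Q_poly_qf qf_ring_map[OF ring_map_eval[OF ring_map_id(1)]] eval_Var[OF ring_map_id(1)] by simp
  then show False using u \<open>Q_poly n i = 0\<close> by simp
qed

lemma mpoly_eq_if_eval:
  fixes f g :: "('x, 'k) mpolynomial"
  assumes "\<And>s. eval_mpoly id s f = eval_mpoly id s g"
  shows "f = g"
proof -
  have "f - g = 0"
    using assms by (intro mpoly_zero_if_vanishing[OF infinite_field])
      (simp add: ring_map_simps(6)[OF ring_map_eval[OF ring_map_id(1)]])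
  then show ?thesis by simp
qed

lemma orth_act_pt:
  assumes g: "g \<in> orth_group n"
  shows "qf n (\<lambda>r. act_pt n g s (r, i)) = qf n (\<lambda>r. s (r, i) :: 'k)"
    and "bf n (\<lambda>r. act_pt n g s (r, i)) (\<lambda>r. act_pt n g s (r, j)) = bf n (\<lambda>r. s (r, i)) (\<lambda>r. s (r, j) :: 'k)"
proof -
  have gc: "g \<in> carrier_mat n n" using g by (simp add: orth_group_def)
  have vec_g: "g *\<^sub>v vec n v = vec n (\<lambda>r. (g *\<^sub>v vec n v) $ r)" for v using gc by auto
  have inv: "qf n (\<lambda>r. (g *\<^sub>v vec n v) $ r) = qf n v" for v
    using g vec_g[of v] unfolding orth_group_def by (metis (mono_tags, lifting) mem_Collect_eq quad_form_vec vec_carrier)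
  then show "qf n (\<lambda>r. act_pt n g s (r, i)) = qf n (\<lambda>r. s (r, i))" by (simp add: act_pt_def)
  let ?v = "\<lambda>r. s (r, i)" and ?w = "\<lambda>r. s (r, j)"
  have add: "(g *\<^sub>v vec n (\<lambda>r. ?v r + ?w r)) $ r = (g *\<^sub>v vec n ?v) $ r + (g *\<^sub>v vec n ?w) $ r" if "r < n" for r
  proof -
    have "vec n (\<lambda>r. ?v r + ?w r) = vec n ?v + vec n ?w" by auto
    then show ?thesis using gc that by (simp add: mult_add_distrib_mat_vec[OF gc])
  qed
  have "qf n (\<lambda>r. (g *\<^sub>v vec n ?v) $ r + (g *\<^sub>v vec n ?w) $ r) = qf n (\<lambda>r. ?v r + ?w r)"
    unfolding inv[of "\<lambda>r. ?v r + ?w r", symmetric] by (rule qf_cong) (simp add: add)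
  then show "bf n (\<lambda>r. act_pt n g s (r, i)) (\<lambda>r. act_pt n g s (r, j)) = bf n ?v ?w"
    by (simp add: qf_add inv act_pt_def)
qed

lemma eval_Q_poly: "eval_mpoly id s (Q_poly n i) = qf n (\<lambda>r. s (r, i) :: 'k)"
  unfolding Q_poly_qf qf_ring_map[OF ring_map_eval[OF ring_map_id(1)]] eval_Var[OF ring_map_id(1)] ..

lemma eval_B_poly: "eval_mpoly id s (B_poly n i j) = bf n (\<lambda>r. s (r, i)) (\<lambda>r. s (r, j) :: 'k)"
  unfolding B_poly_bf bf_ring_map[OF ring_map_eval[OF ring_map_id(1)]] eval_Var[OF ring_map_id(1)] ..

lemma subalgebra_invariants:
  assumes "G \<subseteq> carrier_mat n n"
  shows "subalgebra (invariants n m G :: (nat \<times> nat, 'k) mpolynomial set)"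
proof -
  have R: "ring_map (diag_subst n g)" for g :: "'k mat"
    unfolding diag_subst_def by (rule ring_map_eval[OF ring_map_Const])
  have "diag_subst n g (Const c) = Const c" for g :: "'k mat" and c
    unfolding diag_subst_def by (rule eval_Const[OF ring_map_Const])
  then show ?thesis
    unfolding subalgebra_def
    by (auto simp: invariants_def poly_ring_vars_in ring_map_simps[OF R] intro: vars_in_add vars_in_mult)
qed

lemma QB_algebra_invariants:
  assumes G: "G \<subseteq> orth_group n"
  shows "QB_algebra n m \<subseteq> (invariants n m G :: (nat \<times> nat, 'k) mpolynomial set)"
  unfolding QB_algebra_def
proof (rule hull_minimal)
  have Gc: "G \<subseteq> carrier_mat n n" using G by (auto simp: orth_group_def)
  show "subalgebra (invariants n m G)" by (rule subalgebra_invariants[OF Gc])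
  show "QB n m \<subseteq> invariants n m G"
  proof
    fix f assume f: "f \<in> QB n m"
    then have fR: "f \<in> poly_ring n m" using QB_properties(3) by (simp add: poly_ring_vars_in)
    have "diag_subst n g f = f" if g: "g \<in> G" for g
    proof (rule mpoly_eq_if_eval)
      fix s
      have go: "g \<in> orth_group n" and gc: "g \<in> carrier_mat n n" using g G Gc by auto
      show "eval_mpoly id s (diag_subst n g f) = eval_mpoly id s f"
        unfolding eval_diag_subst[OF gc fR] using f orth_act_pt[OF go] by (auto simp: eval_Q_poly eval_B_poly)
    qed
    then show "f \<in> invariants n m G" using fR by (simp add: invariants_def)
  qed
qed

lemma submodule_invariants:
  assumes G: "G \<subseteq> orth_group n"
  shows "is_submodule (QB_algebra n m) (invariants n m G :: (nat \<times> nat, 'k) mpolynomial set)"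
proof -
  have "G \<subseteq> carrier_mat n n" using G by (auto simp: orth_group_def)
  then have "subalgebra (invariants n m G :: (nat \<times> nat, 'k) mpolynomial set)" by (rule subalgebra_invariants)
  then have "is_subring (invariants n m G :: (nat \<times> nat, 'k) mpolynomial set)" by (rule subring_if_subalgebra)
  then show ?thesis using QB_algebra_invariants[OF G, of m]
    by (intro submoduleI) (auto intro: subring_closed)
qed

section \<open>Reflections acting on invariants, and integrality\<close>

lemma move_move: "qf n u \<noteq> (0 :: 'k) \<Longrightarrow> move n u (move n u s) = s"
  by (auto simp: move_def reflect_reflect)

text \<open>A product of two reflections is in \<open>SO(n)\<close>, so all reflections change
  \<open>f\<close> into the same polynomial: the right side does not depend on
  \<open>u\<close>.\<close>

lemma invariants_move:
  assumes f: "f \<in> invariants n m (special_orth_group n :: 'k mat set)"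
    and u0: "qf n u0 \<noteq> 0" and u: "qf n u \<noteq> 0"
  shows "eval_mpoly id (move n u s) f = eval_mpoly id s (diag_subst n (refl_mat n u0) f)"
proof -
  have fR: "f \<in> poly_ring n m" using f by (simp add: invariants_def)
  then have fv: "vars_in ({..<n} \<times> {..<m}) f" by (simp add: poly_ring_vars_in)
  have refl: "eval_mpoly id (act_pt n (refl_mat n w) s) f = eval_mpoly id (move n w s) f" for w s
    by (rule eval_cong[OF fv]) (auto simp: act_pt_def refl_mat_vec move_def)
  have prod: "eval_mpoly id (move n u (move n u0 s)) f = eval_mpoly id s f" for s
  proof -
    let ?g = "refl_mat n u * refl_mat n u0"
    have gc: "?g \<in> carrier_mat n n" using mult_carrier_mat[OF refl_mat_carrier refl_mat_carrier] .
    have "diag_subst n ?g f = f"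
      using f refl_mat_prod_special_orth[OF u u0] by (simp add: invariants_def)
    then have "eval_mpoly id s f = eval_mpoly id (act_pt n ?g s) f"
      using eval_diag_subst[OF gc fR, of s] by simp
    also have "\<dots> = eval_mpoly id (move n u (move n u0 s)) f"
    proof (rule eval_cong[OF fv])
      fix x :: "nat \<times> nat" assume "x \<in> {..<n} \<times> {..<m}"
      then show "act_pt n ?g s x = move n u (move n u0 s) x"
        by (auto simp: act_pt_def move_def refl_mat_vec assoc_mult_mat_vec[OF refl_mat_carrier refl_mat_carrier])
    qed
    finally show ?thesis by simp
  qed
  have "eval_mpoly id s (diag_subst n (refl_mat n u0) f) = eval_mpoly id (move n u0 s) f"
    using eval_diag_subst[OF refl_mat_carrier fR] refl by simp
  \<comment> \<open>This is \<open>prod\<close> at the point moved by \<open>u0\<close>; the two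
    equal reflections then cancel.\<close>
  also have "\<dots> = eval_mpoly id (move n u (move n u0 (move n u0 s))) f" using prod by simp
  finally show ?thesis by (simp add: move_move[OF u0])
qed

text \<open>Clearing denominators turns the identity \<open>f (s\<^sub>u v) = f' v\<close> into a polynomial identity in \<open>u\<close>
  and \<open>v\<close>, so it persists over every extension field.\<close>

lemma move_identity_extends:
  fixes \<kappa> :: "'k \<Rightarrow> 'a::field"
  assumes \<kappa>: "ring_map \<kappa>" and f: "vars_in ({..<n} \<times> {..<m}) f" "homogeneous d f"
    and f': "vars_in ({..<n} \<times> {..<m}) f'"
    and id: "\<And>s u. qf n u \<noteq> (0 :: 'k) \<Longrightarrow> eval_mpoly id (move n u s) f = eval_mpoly id s f'"
    and u: "qf n u \<noteq> 0" and two_a: "(2 :: 'a) = 0"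
  shows "eval_mpoly \<kappa> (move n u s) f = eval_mpoly \<kappa> s f'"
proof -
  \<comment> \<open>The reflecting vector becomes a further generic vector, stored in column
    \<open>m\<close>, which neither \<open>f\<close> nor \<open>f'\<close> uses.\<close>
  define U where "U = (\<lambda>r. Var (r, m) :: (nat \<times> nat, 'k) mpolynomial)"
  define qU where "qU = qf n U"
  \<comment> \<open>The reflected coordinates multiplied by \<open>qU\<close>; by homogeneity this
    multiplies the value of \<open>f\<close> by \<open>qU ^ d\<close>.\<close>
  define \<sigma> where "\<sigma> = (\<lambda>(r, i). qU * Var (r, i) + bf n (\<lambda>r. Var (r, i)) U * U r)"
  \<comment> \<open>The factor \<open>qU\<close> in front makes \<open>P\<close> vanish also at
    points where the reflecting vector is singular.\<close>
  define P where "P = qU * (eval_mpoly Const \<sigma> f - qU ^ d * f')"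
  have eval_P: "eval_mpoly \<phi> s P = qf n (\<lambda>r. s (r, m)) * (eval_mpoly \<phi> (\<lambda>(r, i). qf n (\<lambda>r. s (r, m)) * s (r, i)
      + bf n (\<lambda>r. s (r, i)) (\<lambda>r. s (r, m)) * s (r, m)) f - qf n (\<lambda>r. s (r, m)) ^ d * eval_mpoly \<phi> s f')"
    if \<phi>: "ring_map \<phi>" for \<phi> :: "'k \<Rightarrow> 'b::field" and s
  proof -
    have E: "ring_map (eval_mpoly \<phi> s)" by (rule ring_map_eval[OF \<phi>])
    have qU: "eval_mpoly \<phi> s qU = qf n (\<lambda>r. s (r, m))"
      unfolding qU_def U_def qf_ring_map[OF E] eval_Var[OF \<phi>] ..
    have \<sigma>: "(\<lambda>x. eval_mpoly \<phi> s (\<sigma> x)) = (\<lambda>(r, i). qf n (\<lambda>r. s (r, m)) * s (r, i)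
      + bf n (\<lambda>r. s (r, i)) (\<lambda>r. s (r, m)) * s (r, m))"
      by (auto simp: \<sigma>_def ring_map_simps[OF E] qU bf_ring_map[OF E] eval_Var[OF \<phi>] U_def)
    have "eval_mpoly \<phi> s (eval_mpoly Const \<sigma> f) = eval_mpoly \<phi> (\<lambda>x. eval_mpoly \<phi> s (\<sigma> x)) f"
      using ring_map_comp_eval[OF ring_map_Const E, of \<sigma> f] by (simp add: eval_Const[OF \<phi>])
    then show ?thesis by (simp add: P_def ring_map_simps[OF E] qU \<sigma>)
  qed
  have scaled: "(\<lambda>(r, i). qf n (\<lambda>r. s (r, m)) * s (r, i) + bf n (\<lambda>r. s (r, i)) (\<lambda>r. s (r, m)) * s (r, m))
      = (\<lambda>x. qf n (\<lambda>r. s (r, m)) * move n (\<lambda>r. s (r, m)) s x)"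
    if "qf n (\<lambda>r. s (r, m)) \<noteq> 0" for s :: "nat \<times> nat \<Rightarrow> 'b::field"
    using that by (auto simp: move_def reflect_def distrib_left)
  have "P = 0"
  proof (rule mpoly_zero_if_vanishing[OF infinite_field])
    fix s :: "nat \<times> nat \<Rightarrow> 'k"
    show "eval_mpoly id s P = 0"
    proof (cases "qf n (\<lambda>r. s (r, m)) = 0")
      case False
      show ?thesis
        unfolding eval_P[OF ring_map_id(1)] scaled[OF False] eval_scale[OF f(2)] id[OF False] by simp
    qed (simp add: eval_P)
  qed
  define s' where "s' = (\<lambda>(r, i). if i = m then u r else s (r, i))"
  have s'm: "(\<lambda>r. s' (r, m)) = u" by (simp add: s'_def)
  have "eval_mpoly \<kappa> s' P = 0" using \<open>P = 0\<close> by simp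
  then have "qf n u ^ d * eval_mpoly \<kappa> (move n u s') f = qf n u ^ d * eval_mpoly \<kappa> s' f'"
    using u scaled[of s'] unfolding eval_P[OF \<kappa>] s'm by (simp add: eval_scale[OF f(2)])
  then have "eval_mpoly \<kappa> (move n u s') f = eval_mpoly \<kappa> s' f'" using u by simp
  moreover have "eval_mpoly \<kappa> (move n u s') f = eval_mpoly \<kappa> (move n u s) f"
    by (rule eval_cong[OF f(1)]) (auto simp: move_def s'_def)
  moreover have "eval_mpoly \<kappa> s' f' = eval_mpoly \<kappa> s f'"
    by (rule eval_cong[OF f']) (auto simp: s'_def)
  ultimately show ?thesis by simp
qed

lemma homogeneous_invariant_integral:
  fixes f :: "(nat \<times> nat, 'k) mpolynomial"
  assumes n: "n \<ge> 1" and f: "f \<in> invariants n m (special_orth_group n)" "homogeneous d f"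
  shows "integral_over (QB_algebra n m) f"
proof -
  define \<iota> :: "(nat \<times> nat, 'k) mpolynomial \<Rightarrow> (nat \<times> nat, 'k) mpolynomial fract alg_closure"
    where "\<iota> p = to_ac (to_fract p)" for p
  have \<iota>: "ring_map \<iota>" by (simp add: ring_map_def \<iota>_def)
  have inj: "\<iota> p = \<iota> q \<longleftrightarrow> p = q" for p q by (simp add: \<iota>_def)
  define \<kappa> where "\<kappa> c = \<iota> (Const c)" for c
  have \<kappa>: "ring_map \<kappa>" using \<iota> by (auto simp: ring_map_def \<kappa>_def ring_map_simps[OF ring_map_Const])
  have two': "(2 :: (nat \<times> nat, 'k) mpolynomial fract alg_closure) = 0"
  proof -
    have "\<iota> (1 + 1) = 0" using two_mpoly[where 'x = "nat \<times> nat"] by (simp add: ring_map_simps(4)[OF \<iota>])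
    then show ?thesis unfolding ring_map_simps(1,2)[OF \<iota>] by simp
  qed
  interpret K: alg_closed_char2 "TYPE((nat \<times> nat, 'k) mpolynomial fract alg_closure)"
    by standard (rule two')
  obtain u0 where u0: "qf n u0 \<noteq> (0 :: 'k)" using exists_nonsingular[OF n] .
  define f' where "f' = diag_subst n (refl_mat n u0) f"
  have fR: "f \<in> poly_ring n m" using f by (simp add: invariants_def)
  have fv: "vars_in ({..<n} \<times> {..<m}) f" "vars_in ({..<n} \<times> {..<m}) f'"
    using fR diag_subst_poly_ring[OF refl_mat_carrier fR] by (auto simp: poly_ring_vars_in f'_def)
  \<comment> \<open>The generic point, set to zero off the index range so that its columns lie in
    \<open>K.Sub n 0\<close>.\<close>
  define s where "s = (\<lambda>(r, i). if r < n \<and> i < m then \<iota> (Var (r, i)) else 0)"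
  define v where "v i = (\<lambda>r. s (r, i))" for i
  have move1: "eval_mpoly \<kappa> (move n u t) f = eval_mpoly \<kappa> t f'" if "qf n u \<noteq> 0" for u t
    using move_identity_extends[OF \<kappa> fv(1) f(2) fv(2) _ that two'] invariants_move[OF f(1) u0]
    unfolding f'_def by blast
  have move2: "eval_mpoly \<kappa> (move n u t) f' = eval_mpoly \<kappa> t f" if "qf n u \<noteq> 0" for u t
    using move1[OF that, of "move n u t"] K.move_move[OF that] by simp
  define mv where "mv us t = (\<lambda>(r, i). K.act n us (\<lambda>r. t (r, i)) r)"
    for us and t :: "nat \<times> nat \<Rightarrow> (nat \<times> nat, 'k) mpolynomial fract alg_closure"
  have mv_Cons: "mv (u # us) t = move n u (mv us t)" for u us t
    by (auto simp: mv_def move_def)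
  \<comment> \<open>Each reflection exchanges the values of \<open>f\<close> and \<open>f'\<close>;
    only the unordered pair is preserved along the list.\<close>
  have mv_eval: "eval_mpoly \<kappa> (mv us t) f \<in> {eval_mpoly \<kappa> t f, eval_mpoly \<kappa> t f'} \<and>
      {eval_mpoly \<kappa> (mv us t) f, eval_mpoly \<kappa> (mv us t) f'} = {eval_mpoly \<kappa> t f, eval_mpoly \<kappa> t f'}"
    if "set us \<subseteq> K.nonsing n 0" for us t
    using that
  proof (induction us)
    case Nil
    then show ?case by (auto simp: mv_def)
  next
    case (Cons u us)
    then have "qf n u \<noteq> 0" by (simp add: K.nonsing_def)
    then show ?case using Cons unfolding mv_Cons by (simp add: move1 move2) blast
  qed
  have eval_f: "eval_mpoly \<kappa> s f = \<iota> f"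
  proof -
    have "\<iota> f = \<iota> (eval_mpoly Const Var f)" by (simp add: eval_Const_Var)
    also have "\<dots> = eval_mpoly \<kappa> (\<lambda>x. \<iota> (Var x)) f"
      unfolding ring_map_comp_eval[OF ring_map_Const \<iota>] \<kappa>_def ..
    also have "\<dots> = eval_mpoly \<kappa> s f" by (rule eval_cong[OF fv(1)]) (auto simp: s_def)
    finally show ?thesis by simp
  qed
  have QB: "QB n m \<subseteq> QB_algebra n m" unfolding QB_algebra_def by (rule hull_subset)
  have subalg: "subalgebra (QB_algebra n m :: (nat \<times> nat, 'k) mpolynomial set)"
    unfolding QB_algebra_def by (rule subalgebra_hull)
  then have subring: "is_subring (QB_algebra n m :: (nat \<times> nat, 'k) mpolynomial set)"
    by (rule subring_if_subalgebra)
  let ?A = "\<iota> ` QB_algebra n m"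
  have subring': "is_subring ?A"
    unfolding is_subring_def
  proof (intro conjI ballI)
    show "1 \<in> ?A" using subring_closed(1)[OF subring] ring_map_simps(1)[OF \<iota>] by (metis image_eqI)
  next
    fix x y assume "x \<in> ?A" "y \<in> ?A"
    then obtain p q where pq: "x = \<iota> p" "y = \<iota> q" "p \<in> QB_algebra n m" "q \<in> QB_algebra n m" by auto
    show "x - y \<in> ?A" unfolding pq ring_map_simps(6)[OF \<iota>, symmetric]
      by (intro imageI subring_closed(3)[OF subring] pq)
    show "x * y \<in> ?A" unfolding pq ring_map_simps(3)[OF \<iota>, symmetric]
      by (intro imageI subring_closed(4)[OF subring] pq)
  qed
  have "integral_over ?A (\<iota> f)"
  proof (rule ccontr)
    assume "\<not> integral_over ?A (\<iota> f)"
    then obtain V where V: "valuation_subring V" "?A \<subseteq> V" "\<iota> f \<notin> V"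
      using not_integral_imp_valuation_subring[OF subring'] by blast
    have R: "is_subring V" using V by (simp add: valuation_subring_def)
    have inV: "\<iota> g \<in> V" if "g \<in> QB n m" for g
      using subsetD[OF V(2) imageI[OF subsetD[OF QB that]]] .
    have vi: "qf n (v i) = \<iota> (Q_poly n i)" if "i < m" for i
      unfolding Q_poly_qf qf_ring_map[OF \<iota>] by (rule qf_cong) (use that in \<open>simp add: v_def s_def\<close>)
    have bij: "bf n (v i) (v j) = \<iota> (B_poly n i j)" if "i < m" "j < m" for i j
      unfolding B_poly_bf bf_ring_map[OF \<iota>] by (rule bf_cong) (use that in \<open>simp_all add: v_def s_def\<close>)
    have bV: "bf n (v i) (v j) \<in> V" if "i < m" "j < m" for i j
    proof -
      consider "i = j" | "i < j" | "j < i" by linarith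
      then show ?thesis
      proof cases
        case 1
        then show ?thesis using subring_closed(2)[OF R] by simp
      next
        case 2
        then have "B_poly n i j \<in> QB n m" using that by blast
        then show ?thesis unfolding bij[OF that] by (rule inV)
      next
        case 3
        then have "B_poly n j i \<in> QB n m" using that by blast
        then show ?thesis unfolding bf_commute[of n "v i"] bij[OF that(2,1)] by (rule inV)
      qed
    qed
    have qV: "qf n (v i) \<in> V" if "i < m" for i
    proof -
      have "Q_poly n i \<in> QB n m" using that by blast
      then show ?thesis unfolding vi[OF that] by (rule inV)
    qed
    have bd: "K.form_integral n V 0 (v ` {..<m})"
      unfolding K.form_integral_def using qV bV by (auto simp: K.Sub_def v_def s_def)
    have "K.movable n V 0 (v ` {..<m})"
      by (rule K.movable_all[OF V(1) _ K.infinite_field bd]) (rule quadratic_root_or_inverse[OF V(1)])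
    then obtain us where us: "set us \<subseteq> K.nonsing n 0" "\<And>i r. i < m \<Longrightarrow> K.act n us (v i) r \<in> V"
      unfolding K.movable_def by auto
    have \<kappa>V: "\<kappa> c \<in> V" for c
    proof -
      have "Const c \<in> QB_algebra n m" using subalg by (auto simp: subalgebra_def)
      then show ?thesis unfolding \<kappa>_def using V(2) by blast
    qed
    have evalV: "eval_mpoly \<kappa> (mv us s) h \<in> V" if h: "vars_in ({..<n} \<times> {..<m}) h" for h
      unfolding eval_mpoly_def
    proof (intro subring_sum[OF R] subring_closed(4)[OF R] subring_prod[OF R] subring_power[OF R] \<kappa>V)
      fix a x assume "a \<in> keys h" "x \<in> keys a"
      then have "x \<in> {..<n} \<times> {..<m}" using h by (auto simp: vars_in_def)
      then show "mv us s x \<in> V" using us(2) by (auto simp: mv_def v_def)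
    qed
    \<comment> \<open>The value of \<open>f\<close> at the generic point is one of the two values at
      the moved point. Both lie in \<open>V\<close>, as the coordinates there and all constants
      do.\<close>
    have "\<iota> f \<in> {eval_mpoly \<kappa> (mv us s) f, eval_mpoly \<kappa> (mv us s) f'}"
      using mv_eval[OF us(1), of s] eval_f by simp
    then show False using evalV fv V(3) by auto
  qed
  then obtain r a where a: "\<And>i. i < r \<Longrightarrow> a i \<in> ?A" "\<iota> f ^ r = (\<Sum>i<r. a i * \<iota> f ^ i)"
    unfolding integral_over_def by blast
  then have "\<forall>i. \<exists>b. i < r \<longrightarrow> b \<in> QB_algebra n m \<and> a i = \<iota> b" by blast
  then obtain b where b: "\<And>i. i < r \<Longrightarrow> b i \<in> QB_algebra n m" "\<And>i. i < r \<Longrightarrow> a i = \<iota> (b i)" by metis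
  have "\<iota> (f ^ r) = \<iota> (\<Sum>i<r. b i * f ^ i)"
    using a(2) b(2) by (simp add: ring_map_sum[OF \<iota>] ring_map_simps[OF \<iota>])
  then have "f ^ r = (\<Sum>i<r. b i * f ^ i)" by (simp add: inj)
  then show ?thesis unfolding integral_over_def using b(1) by blast
qed

lemma invariants_subset_span:
  assumes n: "n \<ge> 1" and m: "m \<ge> 1"
  shows "invariants n m (special_orth_group n) \<subseteq> is_submodule (QB_algebra n m) hull
    {Poly_Mapping.single a (1 :: 'k) | a. mdeg a \<le> 2 * card (QB n m) + 1 \<and> keys a \<subseteq> {..<n} \<times> {..<m}}"
    (is "_ \<subseteq> ?N")
proof
  fix f assume f: "f \<in> invariants n m (special_orth_group n :: 'k mat set)"
  have G: "special_orth_group n \<subseteq> (carrier_mat n n :: 'k mat set)"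
    using special_orth_subset by (auto simp: orth_group_def)
  \<comment> \<open>The nonzero generator from which the multiplier is formed; it exists because
    \<open>m\<close> is positive.\<close>
  have Q0: "Q_poly n 0 \<in> QB n m" using m by (intro UnI1 CollectI exI[of _ 0]) auto
  have part: "homog_part d f \<in> ?N" for d
  proof -
    have h: "homog_part d f \<in> invariants n m (special_orth_group n)" by (rule invariants_homog_part[OF G f])
    then have v: "vars_in ({..<n} \<times> {..<m}) (homog_part d f)"
      by (simp add: invariants_def poly_ring_vars_in)
    have int: "integral_over (subalgebra hull QB n m) (homog_part d f)"
      using homogeneous_invariant_integral[OF n h homogeneous_part] by (simp add: QB_algebra_def)
    show ?thesis unfolding QB_algebra_def
      by (rule homogeneous_integral_in_span[OF QB_properties Q0 Q_poly_nonzero[OF n] homogeneous_part v int])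
  qed
  obtain N where "\<And>a. a \<in> keys f \<Longrightarrow> mdeg a < N"
    using finite_nat_set_iff_bounded[of "mdeg ` keys f"] by auto
  then have "f = (\<Sum>d<N. homog_part d f)" by (rule homog_part_expand)
  then show "f \<in> ?N" using part submodule_sum[OF submodule_span] by (metis (no_types, lifting))
qed

text \<open>Stated for every set of matrices between \<open>SO(n)\<close> and \<open>O(n)\<close>,
  to give both claims: a larger one has fewer invariants, so all lie in the same Noetherian
  module.\<close>

lemma invariants_finitely_generated:
  assumes n: "n \<ge> 1" and m: "m \<ge> 1"
    and G: "special_orth_group n \<subseteq> G" "G \<subseteq> (orth_group n :: 'k mat set)"
  shows "finitely_generated_over (QB_algebra n m) (invariants n m G)"
proof -
  let ?S = "{Poly_Mapping.single a (1 :: 'k) | a. mdeg a \<le> 2 * card (QB n m) + 1 \<and> keys a \<subseteq> {..<n} \<times> {..<m}}"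
  have "?S = (\<lambda>a. Poly_Mapping.single a 1) ` {a. mdeg a \<le> 2 * card (QB n m) + 1 \<and> keys a \<subseteq> {..<n} \<times> {..<m}}"
    by auto
  then have finS: "finite ?S" using finite_bounded_monomials[of "{..<n} \<times> {..<m}"] by simp
  have A: "is_subring (QB_algebra n m :: (nat \<times> nat, 'k) mpolynomial set)"
    unfolding QB_algebra_def by (intro subring_if_subalgebra subalgebra_hull)
  have "noetherian_over (QB_algebra n m) (QB_algebra n m :: (nat \<times> nat, 'k) mpolynomial set)"
    unfolding QB_algebra_def by (rule noetherian_subalgebra_hull[OF QB_properties(1)])
  from noetherian_over_span[OF A this finS]
  have "noetherian_over (QB_algebra n m) (is_submodule (QB_algebra n m) hull ?S)" .
  moreover have "invariants n m G \<subseteq> is_submodule (QB_algebra n m) hull ?S"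
    using invariants_subset_span[OF n m] G(1) by (auto simp: invariants_def)
  ultimately show ?thesis
    by (intro finitely_generated_over_noetherian[OF A _ submodule_invariants[OF G(2)]])
qed

end

theorem corollary4p2:
  fixes n m :: nat
  assumes "CHAR('k::alg_closed_field) = 2"
    and "n \<ge> 1" and "m \<ge> 1"
  shows "finitely_generated_over (QB_algebra n m)
           (invariants n m (orth_group n :: 'k mat set)) \<and>
         finitely_generated_over (QB_algebra n m)
           (invariants n m (special_orth_group n :: 'k mat set))"
proof -
  have "(of_nat CHAR('k) :: 'k) = 0" by (rule of_nat_CHAR)
  then interpret alg_closed_char2 "TYPE('k)"
    by unfold_locales (simp add: assms(1))
  show ?thesis
    using invariants_finitely_generated[OF assms(2,3)] special_orth_subset by blast
qed

end
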